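(* Let $(X_i)_{i\in\mathbb Z}$ be the stationary sequence $X_i=X_0\circ T^i$ described in the context. Assume that the couple $(T,\mathbb P)$ is ergodic and that $$\int_0^{\infty}\sqrt{\sum_{k=0}^\infty \min\{\alpha_{1,\mathbf X}(k),H(t)\}}\;dt<\infty .$$ Then $\sqrt n\,W_1(\mu_n,\mu)$ converges in distribution, as $n\to\infty$, to the random variable $\int_{\mathbb R}|G(t)|\,dt$, where $G$ is a centered Gaussian random variable with values in $\mathbb L^1(\mathbb R,dt)$ whose covariance is described as follows: for any $f,g\in \mathbb L^\infty(\mathbb R,dt)$, $$\mathrm{Cov}\left(\int f(t)G(t)\,dt,\int g(t)G(t)\,dt\right)=\sum_{k\in\mathbb Z}\mathbb E\left(\iint f(t)g(s)\,(\mathbf 1_{X_0\le t}-F(t))(\mathbf 1_{X_k\le s}-F(s))\,dt\,ds\right).$$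
   Context: Setting. $(\Omega,\mathcal A,\mathbb P)$ is a probability space, $T:\Omega\to\Omega$ is a bijective bi-measurable transformation preserving $\mathbb P$, and $\mathcal F_0\subseteq\mathcal A$ is a sub-$\sigma$-algebra with $\mathcal F_0\subseteq T^{-1}(\mathcal F_0)$. The couple $(T,\mathbb P)$ is ergodic if every $A\in\mathcal A$ with $T(A)=A$ has probability $0$ or $1$. $X_0$ is an $\mathcal F_0$-measurable integrable real-valued random variable with distribution $\mu$ and distribution function $F$, and $\mathbf X=(X_i)_{i\in\mathbb Z}$ with $X_i=X_0\circ T^i$. Notation. $\mu_n=\frac1n\sum_{k=1}^n\delta_{X_k}$ is the empirical measure. $W_1(\mu_1,\mu_2)=\inf_\pi\int|x-y|\,\pi(dx,dy)$, the infimum being over probability measures $\pi$ on $\mathbb R^2$ with marginals $\mu_1,\mu_2$. $H(t)=\mathbb P(|X_0|>t)$ for $t\ge0$. For $n\ge 0$, $\alpha_{1,\mathbf X}(n)=\sup_{x\in\mathbb R}\|\mathbb E(\mathbf 1_{X_n\le x}|\mathcal F_0)-F(x)\|_1$, where $\|\cdot\|_1$ is the norm of $\mathbb L^1(\mathbb P)$. *)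

theory Defs
  imports "HOL-Probability.Probability"
begin

definition measure_preserving_automorphism :: "'a measure \<Rightarrow> ('a \<Rightarrow> 'a) \<Rightarrow> bool" where
  "measure_preserving_automorphism M T \<longleftrightarrow>
     bij_betw T (space M) (space M) \<and>
     T \<in> measurable M M \<and>
     the_inv_into (space M) T \<in> measurable M M \<and>
     distr M M T = M"

definition ergodic :: "'a measure \<Rightarrow> ('a \<Rightarrow> 'a) \<Rightarrow> bool" where
  "ergodic M T \<longleftrightarrow> (\<forall>A\<in>sets M. T ` A = A \<longrightarrow> measure M A = 0 \<or> measure M A = 1)"

definition int_iterate :: "'a measure \<Rightarrow> ('a \<Rightarrow> 'a) \<Rightarrow> int \<Rightarrow> 'a \<Rightarrow> 'a" where
  "int_iterate M T i =
     (if i \<ge> 0 then T ^^ nat i else the_inv_into (space M) T ^^ nat (- i))"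

definition orbit_process :: "'a measure \<Rightarrow> ('a \<Rightarrow> 'a) \<Rightarrow> ('a \<Rightarrow> real) \<Rightarrow> int \<Rightarrow> 'a \<Rightarrow> real" where
  "orbit_process M T X0 i \<omega> = X0 (int_iterate M T i \<omega>)"

definition tail_prob :: "'a measure \<Rightarrow> ('a \<Rightarrow> real) \<Rightarrow> real \<Rightarrow> real" where
  "tail_prob M X0 t = measure M {\<omega> \<in> space M. \<bar>X0 \<omega>\<bar> > t}"

definition alpha1 :: "'a measure \<Rightarrow> 'a measure \<Rightarrow> (int \<Rightarrow> 'a \<Rightarrow> real) \<Rightarrow> nat \<Rightarrow> real" where
  "alpha1 M F0 X n =
     (SUP x. \<integral>\<omega>. \<bar>real_cond_exp M F0 (\<lambda>\<omega>'. indicator {..x} (X (int n) \<omega>')) \<omega>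
                     - cdf (distr M borel (X 0)) x\<bar> \<partial>M)"

definition empirical_measure :: "(int \<Rightarrow> 'a \<Rightarrow> real) \<Rightarrow> nat \<Rightarrow> 'a \<Rightarrow> real measure" where
  "empirical_measure X n \<omega> =
     distr (uniform_count_measure {1..n}) borel (\<lambda>k. X (int k) \<omega>)"

definition couplings :: "real measure \<Rightarrow> real measure \<Rightarrow> (real \<times> real) measure set" where
  "couplings \<mu> \<nu> =
     {\<pi>. prob_space \<pi> \<and> sets \<pi> = sets borel \<and> distr \<pi> borel fst = \<mu> \<and> distr \<pi> borel snd = \<nu>}"

definition wasserstein1 :: "real measure \<Rightarrow> real measure \<Rightarrow> ennreal" where
  "wasserstein1 \<mu> \<nu> = (INF \<pi>\<in>couplings \<mu> \<nu>. \<integral>\<^sup>+p. ennreal \<bar>fst p - snd p\<bar> \<partial>\<pi>)"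

definition ennreal_sqrt :: "ennreal \<Rightarrow> ennreal" where
  "ennreal_sqrt x = (if x = \<top> then \<top> else ennreal (sqrt (enn2real x)))"

definition converges_in_distribution ::
    "'a measure \<Rightarrow> (nat \<Rightarrow> 'a \<Rightarrow> real) \<Rightarrow> 'b measure \<Rightarrow> ('b \<Rightarrow> real) \<Rightarrow> bool" where
  "converges_in_distribution M Y N Z \<longleftrightarrow>
     (\<forall>n. Y n \<in> borel_measurable M) \<and> Z \<in> borel_measurable N \<and>
     weak_conv_m (\<lambda>n. distr M borel (Y n)) (distr N borel Z)"

definition covariance :: "'b measure \<Rightarrow> ('b \<Rightarrow> real) \<Rightarrow> ('b \<Rightarrow> real) \<Rightarrow> real" where
  "covariance N U V =
     (\<integral>w. (U w - (\<integral>w'. U w' \<partial>N)) * (V w - (\<integral>w'. V w' \<partial>N)) \<partial>N)"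

text \<open>
  Elements of \<open>L\<^sup>1(\<real>, dt)\<close> are represented by integrable functions, without passing to the
  quotient by almost everywhere equality. \<open>L1_borel\<close> carries the Borel sigma-algebra of the
  topology induced by the \<open>L\<^sup>1\<close> seminorm; its measurable sets are therefore saturated under
  almost everywhere equality and correspond to the Borel sets of the quotient.
\<close>

definition L1_open :: "(real \<Rightarrow> real) set \<Rightarrow> bool" where
  "L1_open U \<longleftrightarrow>
     (\<forall>f\<in>U. integrable lborel f) \<and>
     (\<forall>f\<in>U. \<exists>e>0. \<forall>g. integrable lborel g \<longrightarrow> (\<integral>t. \<bar>g t - f t\<bar> \<partial>lborel) < e \<longrightarrow> g \<in> U)"

definition L1_borel :: "(real \<Rightarrow> real) measure" where
  "L1_borel = sigma {f. integrable lborel f} {U. L1_open U}"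

definition Linfty :: "(real \<Rightarrow> real) set" where
  "Linfty = {f \<in> borel_measurable borel. \<exists>C. AE t in lborel. \<bar>f t\<bar> \<le> C}"

text \<open>Point masses count as Gaussian laws, of variance zero.\<close>

definition gaussian_law :: "real measure \<Rightarrow> bool" where
  "gaussian_law \<nu> \<longleftrightarrow>
     (\<exists>m. \<nu> = return borel m) \<or>
     (\<exists>m \<sigma>. \<sigma> > 0 \<and> \<nu> = density lborel (\<lambda>x. ennreal (normal_density m \<sigma> x)))"

text \<open>
  A random variable with values in a separable Banach space is Gaussian (centered) if its image
  under every continuous linear functional is a (centered) real Gaussian variable. The dual of
  \<open>L\<^sup>1(\<real>, dt)\<close> is \<open>L\<^sup>\<infinity>(\<real>, dt)\<close>, acting by integration.
\<close>

definition centered_gaussian_L1 :: "'b measure \<Rightarrow> ('b \<Rightarrow> real \<Rightarrow> real) \<Rightarrow> bool" where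
  "centered_gaussian_L1 N G \<longleftrightarrow>
     G \<in> measurable N L1_borel \<and>
     (\<forall>f\<in>Linfty. gaussian_law (distr N borel (\<lambda>w. \<integral>t. f t * G w t \<partial>lborel)) \<and>
                  (\<integral>w. (\<integral>t. f t * G w t \<partial>lborel) \<partial>N) = 0)"

end

theory Submission
  imports Defs
begin

text \<open>
  On the line \<open>W\<^sub>1\<close> is the \<open>L\<^sup>1\<close> distance of the distribution functions, so the statistic is the norm of the
  empirical process \<open>E\<^sub>n(t) = n\<^sup>-\<^sup>1\<^sup>/\<^sup>2 \<Sum>\<^sub>k (1(X\<^sub>k \<le> t) - F(t))\<close>. Finite linear combinations of its values
  are partial sums of bounded functions with summable mixing coefficients. Gordin's decomposition with a finite
  horizon reduces them to bounded stationary martingale differences, for which McLeish's product argument and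
  the ergodic theorem give the central limit theorem. The covariances obey
  \<open>|Cov(1(X\<^sub>0 \<le> s), 1(X\<^sub>k \<le> t))| \<le> min(\<alpha>(k), h(s), h(t))\<close> with \<open>h\<close> comparable to \<open>H\<close>, so the second moments of
  \<open>E\<^sub>n(t)\<close> and of its increments are bounded uniformly in \<open>n\<close>, with an integrable square root. This makes the
  norm uniformly close to a finite sum of grid values. The limit is a series \<open>\<Sum>\<^sub>k \<xi>\<^sub>k L\<^sub>k\<close> with independent
  standard normal \<open>\<xi>\<^sub>k\<close>, where the functions \<open>L\<^sub>k\<close> come from Gram--Schmidt orthogonalisation of the long-run
  covariance kernel along the rationals; it satisfies the same bounds, and grid values at rationals are finite sums.
\<close>

section \<open>The Wasserstein distance on the line\<close>

text \<open>The norm depends on the whole path, so finite-dimensional convergence has to be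
  supplemented. Approximation in mean takes the place of tightness in \<open>L1\<close>: since
  \<open>|exp (iua) - exp (iub)| <= |u| |a - b|\<close>, two random norms with small expected
  distance have close characteristic functions. By Tonelli this expected distance is an integral
  over \<open>t\<close> of first moments at single points, which are bounded by roots of variances;
  this is the origin of the square root under the integral of the hypothesis. The distribution
  function may jump, so the process is sampled at right end points of cells, where right continuity
  controls the increments. The function \<open>h\<close> is the mean of
  \<open>|1(X_0 <= t) - F(t)|\<close>, that is \<open>2 F(t) (1 - F(t))\<close>, and it is at most
  \<open>2 H(|t|)\<close> for almost every \<open>t\<close>. It bounds covariances on both half
  lines at once, and its positivity on an interval is what forces the mixing coefficients to be
  summable.\<close>

lemma nn_integral_abs_diff_atMost_indicator:
  fixes x y :: real
  shows "(\<integral>\<^sup>+t. ennreal \<bar>indicator {..t} x - indicator {..t} y\<bar> \<partial>lborel) = ennreal \<bar>x - y\<bar>"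
proof -
  have "(\<integral>\<^sup>+t. ennreal \<bar>indicator {..t} x - indicator {..t} y\<bar> \<partial>lborel)
      = (\<integral>\<^sup>+t. indicator {min x y..<max x y} t \<partial>lborel)"
    by (intro nn_integral_cong) (auto split: split_indicator simp: min_def max_def)
  also have "\<dots> = emeasure lborel {min x y..<max x y}"
    by simp
  also have "\<dots> = ennreal \<bar>x - y\<bar>"
    by (subst emeasure_lborel_Ico) (auto simp: min_def max_def abs_if)
  finally show ?thesis .
qed

lemma (in prob_space) integral_indicator_atMost_eq_cdf:
  assumes "X \<in> borel_measurable M"
  shows "(\<integral>\<omega>. indicator {..t} (X \<omega>) \<partial>M) = cdf (distr M borel X) t"
proof -
  have "(\<integral>\<omega>. indicator {..t} (X \<omega>) \<partial>M) = (\<integral>x. (indicator {..t} x :: real) \<partial>distr M borel X)"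
    using assms by (intro integral_distr[symmetric]) auto
  also have "\<dots> = cdf (distr M borel X) t"
    by (simp add: cdf_def)
  finally show ?thesis .
qed

text \<open>Both distribution functions are integrals over the same coupling, so their difference at
  \<open>t\<close> is at most the mean of \<open>|1(x <= t) - 1(y <= t)|\<close>. Tonelli and the
  layer-cake identity above turn the integral over \<open>t\<close> into the cost.\<close>

lemma ennreal_cdf_diff_le_coupling_cost:
  assumes "\<pi> \<in> couplings \<mu> \<nu>"
  shows "(\<integral>\<^sup>+t. ennreal \<bar>cdf \<mu> t - cdf \<nu> t\<bar> \<partial>lborel) \<le> (\<integral>\<^sup>+p. ennreal \<bar>fst p - snd p\<bar> \<partial>\<pi>)"
proof -
  from assms have \<pi>: "prob_space \<pi>" "sets \<pi> = sets borel" "distr \<pi> borel fst = \<mu>" "distr \<pi> borel snd = \<nu>"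
    by (auto simp: couplings_def)
  interpret prob_space \<pi> by fact
  have [measurable]: "fst \<in> borel_measurable \<pi>" "snd \<in> borel_measurable \<pi>"
    unfolding measurable_cong_sets[OF \<pi>(2) refl] by (simp_all add: borel_prod[symmetric])
  interpret P: pair_sigma_finite lborel \<pi> ..
  have "(\<integral>\<^sup>+t. ennreal \<bar>cdf \<mu> t - cdf \<nu> t\<bar> \<partial>lborel)
     \<le> (\<integral>\<^sup>+t. \<integral>\<^sup>+p. ennreal \<bar>indicator {..t} (fst p) - indicator {..t} (snd p)\<bar> \<partial>\<pi> \<partial>lborel)"
  proof (intro nn_integral_mono)
    fix t :: real
    have i: "integrable \<pi> (\<lambda>p. indicator {..t} (fst p) :: real)" "integrable \<pi> (\<lambda>p. indicator {..t} (snd p) :: real)"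
      by (auto intro!: integrable_const_bound[where B=1])
    have "\<bar>cdf \<mu> t - cdf \<nu> t\<bar> = \<bar>\<integral>p. indicator {..t} (fst p) - indicator {..t} (snd p) \<partial>\<pi>\<bar>"
      using i by (simp add: \<pi>(3,4)[symmetric] integral_indicator_atMost_eq_cdf)
    also have "\<dots> \<le> (\<integral>p. \<bar>indicator {..t} (fst p) - indicator {..t} (snd p)\<bar> \<partial>\<pi>)"
      by (rule integral_abs_bound)
    also have "ennreal \<dots> = (\<integral>\<^sup>+p. ennreal \<bar>indicator {..t} (fst p) - indicator {..t} (snd p)\<bar> \<partial>\<pi>)"
      using i by (intro nn_integral_eq_integral[symmetric] integrable_abs) auto
    finally show "ennreal \<bar>cdf \<mu> t - cdf \<nu> t\<bar> \<le> \<dots>" by (simp add: ennreal_leI)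
  qed
  \<comment> \<open>Spelling the indicators out as comparisons exposes their joint measurability in
    \<open>t\<close> and \<open>p\<close>.\<close>
  also have "\<dots> = (\<integral>\<^sup>+p. \<integral>\<^sup>+t. ennreal \<bar>indicator {..t} (fst p) - indicator {..t} (snd p)\<bar> \<partial>lborel \<partial>\<pi>)"
    unfolding indicator_def atMost_iff by (intro P.Fubini'[symmetric]) measurable
  also have "\<dots> = (\<integral>\<^sup>+p. ennreal \<bar>fst p - snd p\<bar> \<partial>\<pi>)"
    by (simp add: nn_integral_abs_diff_atMost_indicator)
  finally show ?thesis .
qed

text \<open>Quantile functions live on the open unit interval, while the interval between two values
  of a distribution function may contain \<open>1\<close>; the difference is a null set.\<close>

lemma nn_integral_mult_indicator_unit_interval:
  fixes a b :: real
  assumes "0 \<le> a" "b \<le> 1"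
  shows "(\<integral>\<^sup>+u. indicator {a<..b} u * indicator {0<..<1} u \<partial>lborel) = (\<integral>\<^sup>+u. indicator {a<..b} u \<partial>lborel)"
proof (rule nn_integral_cong_AE)
  show "AE u in lborel. indicator {a<..b} u * indicator {0<..<1} u = (indicator {a<..b} u :: ennreal)"
    using AE_lborel_singleton[of "1::real"]
    by eventually_elim (use assms in \<open>simp add: indicator_def\<close>)
qed

text \<open>Both quantile functions are evaluated at one uniform variable. The quantile at
  \<open>u\<close> is at most \<open>t\<close> iff \<open>u\<close> is at most the distribution
  function at \<open>t\<close>, so for fixed \<open>t\<close> the two indicators differ exactly when
  \<open>u\<close> lies between the two values of the distribution functions.\<close>

lemma quantile_coupling:
  assumes "real_distribution \<mu>" "real_distribution \<nu>"
  shows "\<exists>\<pi>\<in>couplings \<mu> \<nu>.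
    (\<integral>\<^sup>+p. ennreal \<bar>fst p - snd p\<bar> \<partial>\<pi>) = (\<integral>\<^sup>+t. ennreal \<bar>cdf \<mu> t - cdf \<nu> t\<bar> \<partial>lborel)"
proof -
  interpret \<mu>: cdf_distribution \<mu> using assms by (simp add: cdf_distribution_def)
  interpret \<nu>: cdf_distribution \<nu> using assms by (simp add: cdf_distribution_def)
  let ?U = "restrict_space lborel {0<..<1::real}"
  interpret U: prob_space ?U
    by (auto simp add: emeasure_restrict_space space_restrict_space intro!: prob_spaceI)
  interpret P: pair_sigma_finite lborel ?U ..
  have sU: "sets ?U = sets (restrict_space borel {0<..<1::real})"
    by (intro sets_restrict_space_cong) simp
  define \<pi> where "\<pi> = distr ?U borel (\<lambda>u. (\<mu>.I u, \<nu>.I u))"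
  have [measurable]: "\<mu>.I \<in> borel_measurable ?U" "\<nu>.I \<in> borel_measurable ?U"
    using \<mu>.measurable_CI \<nu>.measurable_CI unfolding measurable_cong_sets[OF sU refl] by blast+
  have [measurable]: "(\<lambda>u. (\<mu>.I u, \<nu>.I u)) \<in> borel_measurable ?U"
    by (simp add: borel_prod[symmetric])
  have fs [measurable]: "fst \<in> borel_measurable (borel :: (real \<times> real) measure)"
    "snd \<in> borel_measurable (borel :: (real \<times> real) measure)"
    by (simp_all add: borel_prod[symmetric])
  have "\<pi> \<in> couplings \<mu> \<nu>"
    unfolding couplings_def \<pi>_def using \<mu>.distr_I_eq_M \<nu>.distr_I_eq_M
    by (auto intro!: U.prob_space_distr simp: distr_distr comp_def)
  moreover have "(\<integral>\<^sup>+p. ennreal \<bar>fst p - snd p\<bar> \<partial>\<pi>) = (\<integral>\<^sup>+t. ennreal \<bar>cdf \<mu> t - cdf \<nu> t\<bar> \<partial>lborel)"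
  proof -
    have "(\<integral>\<^sup>+p. ennreal \<bar>fst p - snd p\<bar> \<partial>\<pi>) = (\<integral>\<^sup>+u. ennreal \<bar>\<mu>.I u - \<nu>.I u\<bar> \<partial>?U)"
      unfolding \<pi>_def by (subst nn_integral_distr) auto
    also have "\<dots> = (\<integral>\<^sup>+u. \<integral>\<^sup>+t. ennreal \<bar>indicator {..t} (\<mu>.I u) - indicator {..t} (\<nu>.I u)\<bar> \<partial>lborel \<partial>?U)"
      by (simp add: nn_integral_abs_diff_atMost_indicator)
    also have "\<dots> = (\<integral>\<^sup>+t. \<integral>\<^sup>+u. ennreal \<bar>indicator {..t} (\<mu>.I u) - indicator {..t} (\<nu>.I u)\<bar> \<partial>?U \<partial>lborel)"
      unfolding indicator_def atMost_iff by (intro P.Fubini') measurable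
    also have "\<dots> = (\<integral>\<^sup>+t. ennreal \<bar>cdf \<mu> t - cdf \<nu> t\<bar> \<partial>lborel)"
    proof (intro nn_integral_cong)
      fix t :: real
      have "(\<integral>\<^sup>+u. ennreal \<bar>indicator {..t} (\<mu>.I u) - indicator {..t} (\<nu>.I u)\<bar> \<partial>?U)
          = (\<integral>\<^sup>+u. indicator {min (cdf \<mu> t) (cdf \<nu> t)<..max (cdf \<mu> t) (cdf \<nu> t)} u \<partial>?U)"
        by (intro nn_integral_cong)
          (auto simp: space_restrict_space \<mu>.pseudoinverse[symmetric] \<nu>.pseudoinverse[symmetric]
             min_def max_def split: split_indicator)
      also have "\<dots> = (\<integral>\<^sup>+u. indicator {min (cdf \<mu> t) (cdf \<nu> t)<..max (cdf \<mu> t) (cdf \<nu> t)} u * indicator {0<..<1} u \<partial>lborel)"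
        by (subst nn_integral_restrict_space) auto
      also have "\<dots> = (\<integral>\<^sup>+u. indicator {min (cdf \<mu> t) (cdf \<nu> t)<..max (cdf \<mu> t) (cdf \<nu> t)} u \<partial>lborel)"
        using \<mu>.cdf_bounded_prob[of t] \<nu>.cdf_bounded_prob[of t] \<mu>.cdf_nonneg[of t] \<nu>.cdf_nonneg[of t]
        by (intro nn_integral_mult_indicator_unit_interval) simp_all
      also have "\<dots> = ennreal \<bar>cdf \<mu> t - cdf \<nu> t\<bar>"
        by (subst nn_integral_indicator) (auto simp: min_def max_def abs_if)
      finally show "(\<integral>\<^sup>+u. ennreal \<bar>indicator {..t} (\<mu>.I u) - indicator {..t} (\<nu>.I u)\<bar> \<partial>?U) = \<dots>" .
    qed
    finally show ?thesis .
  qed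
  ultimately show ?thesis by blast
qed

lemma wasserstein1_eq_cdf:
  assumes "real_distribution \<mu>" "real_distribution \<nu>"
  shows "wasserstein1 \<mu> \<nu> = (\<integral>\<^sup>+t. ennreal \<bar>cdf \<mu> t - cdf \<nu> t\<bar> \<partial>lborel)"
proof (rule antisym)
  from quantile_coupling[OF assms] obtain \<pi> where "\<pi> \<in> couplings \<mu> \<nu>"
    "(\<integral>\<^sup>+p. ennreal \<bar>fst p - snd p\<bar> \<partial>\<pi>) = (\<integral>\<^sup>+t. ennreal \<bar>cdf \<mu> t - cdf \<nu> t\<bar> \<partial>lborel)" by blast
  then show "wasserstein1 \<mu> \<nu> \<le> (\<integral>\<^sup>+t. ennreal \<bar>cdf \<mu> t - cdf \<nu> t\<bar> \<partial>lborel)"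
    unfolding wasserstein1_def by (auto intro: INF_lower2)
  show "(\<integral>\<^sup>+t. ennreal \<bar>cdf \<mu> t - cdf \<nu> t\<bar> \<partial>lborel) \<le> wasserstein1 \<mu> \<nu>"
    unfolding wasserstein1_def by (intro INF_greatest ennreal_cdf_diff_le_coupling_cost)
qed

section \<open>Joint characteristic functions\<close>

text \<open>Levy's continuity theorem is transferred to weighted expectations by tilting the measure; a complex weight
  \<open>W\<close> bounded by \<open>1\<close> is recovered from the densities \<open>2 + Re W\<close> and \<open>2 + Im W\<close>.\<close>

definition tilted_law :: "'a measure \<Rightarrow> ('a \<Rightarrow> real) \<Rightarrow> ('a \<Rightarrow> real) \<Rightarrow> real measure" where
  "tilted_law M w v = distr (density M (\<lambda>x. ennreal (w x / (\<integral>y. w y \<partial>M)))) borel v"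

context prob_space
begin

context
  fixes w v :: "'a \<Rightarrow> real"
  assumes meas [measurable]: "w \<in> borel_measurable M" "v \<in> borel_measurable M"
    and bds: "\<And>x. 1 \<le> w x" "\<And>x. w x \<le> 3"
begin

lemma weight_nonneg: "0 \<le> w x"
  using bds(1)[of x] by simp

lemma integrable_weight: "integrable M w"
  using bds(2) weight_nonneg by (intro integrable_const_bound[where B=3]) auto

lemma integral_weight_ge_1: "1 \<le> (\<integral>y. w y \<partial>M)"
proof -
  have "(\<integral>y. 1 \<partial>M) \<le> (\<integral>y. w y \<partial>M)"
    using bds(1) integrable_weight by (intro integral_mono) auto
  then show ?thesis by (simp add: prob_space)
qed

lemma integral_tilted_law:
  fixes h :: "real \<Rightarrow> complex"
  assumes [measurable]: "h \<in> borel_measurable borel"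
  shows "integral\<^sup>L (tilted_law M w v) h = (\<integral>x. w x *\<^sub>R h (v x) \<partial>M) /\<^sub>R (\<integral>y. w y \<partial>M)"
proof -
  have "integral\<^sup>L (tilted_law M w v) h = (\<integral>x. (w x / (\<integral>y. w y \<partial>M)) *\<^sub>R h (v x) \<partial>M)"
    unfolding tilted_law_def using integral_weight_ge_1 weight_nonneg
    by (subst integral_distr, simp, simp, subst integral_density)
       auto
  also have "\<dots> = (\<integral>x. (w x *\<^sub>R h (v x)) /\<^sub>R (\<integral>y. w y \<partial>M) \<partial>M)"
    by (simp add: divide_inverse mult.commute)
  also have "\<dots> = (\<integral>x. w x *\<^sub>R h (v x) \<partial>M) /\<^sub>R (\<integral>y. w y \<partial>M)"
    by (simp only: scaleR_conv_of_real integral_mult_right_zero)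
  finally show ?thesis .
qed

lemma real_distribution_tilted_law: "real_distribution (tilted_law M w v)"
proof -
  have "(\<integral>\<^sup>+x. ennreal (w x / (\<integral>y. w y \<partial>M)) \<partial>M) = ennreal (\<integral>x. w x / (\<integral>y. w y \<partial>M) \<partial>M)"
    using integral_weight_ge_1 weight_nonneg integrable_weight
    by (intro nn_integral_eq_integral) auto
  also have "\<dots> = 1" using integral_weight_ge_1 by simp
  finally have "prob_space (density M (\<lambda>x. ennreal (w x / (\<integral>y. w y \<partial>M))))"
    by (intro prob_spaceI) (auto simp: emeasure_density cong: nn_integral_cong)
  then show ?thesis
    unfolding tilted_law_def real_distribution_def real_distribution_axioms_def
    by (auto intro!: prob_space.prob_space_distr)
qed

end

end

text \<open>The bounds \<open>1\<close> and \<open>3\<close> are those of \<open>2 + p\<close> with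
  \<open>|p| <= 1\<close>, the weights that occur below. The lower one keeps the normalising masses
  away from \<open>0\<close>.\<close>

lemma weighted_char_conv_imp_integral_conv_real:
  fixes w v :: "nat \<Rightarrow> 'a \<Rightarrow> real" and w' v' :: "'b \<Rightarrow> real" and h :: "real \<Rightarrow> complex"
  assumes M: "prob_space M" and N: "prob_space N"
    and meas: "\<And>n. w n \<in> borel_measurable M" "\<And>n. v n \<in> borel_measurable M"
      "w' \<in> borel_measurable N" "v' \<in> borel_measurable N"
    and bds: "\<And>n x. 1 \<le> w n x" "\<And>n x. w n x \<le> 3" "\<And>x. 1 \<le> w' x" "\<And>x. w' x \<le> 3"
    and conv: "\<And>s. (\<lambda>n. \<integral>x. w n x *\<^sub>R iexp (s * v n x) \<partial>M) \<longlonglongrightarrow> (\<integral>x. w' x *\<^sub>R iexp (s * v' x) \<partial>N)"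
    and h: "\<And>x. isCont h x" "\<And>x. norm (h x) \<le> B"
  shows "(\<lambda>n. \<integral>x. w n x *\<^sub>R h (v n x) \<partial>M) \<longlonglongrightarrow> (\<integral>x. w' x *\<^sub>R h (v' x) \<partial>N)"
proof -
  interpret M: prob_space M by fact
  interpret N: prob_space N by fact
  define c where "c n = (\<integral>x. w n x \<partial>M)" for n
  define c' where "c' = (\<integral>x. w' x \<partial>N)"
  note t = M.integral_tilted_law[OF meas(1,2) bds(1,2), folded c_def]
    N.integral_tilted_law[OF meas(3,4) bds(3,4), folded c'_def]
  note r = M.real_distribution_tilted_law[OF meas(1,2) bds(1,2)]
    N.real_distribution_tilted_law[OF meas(3,4) bds(3,4)]
  have c1: "1 \<le> c n" "1 \<le> c'" for n
    unfolding c_def c'_def using M.integral_weight_ge_1[OF meas(1,2) bds(1,2)]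
      N.integral_weight_ge_1[OF meas(3,4) bds(3,4)] by auto
  \<comment> \<open>At frequency \<open>0\<close> the hypothesis is convergence of the
    masses.\<close>
  have "(\<lambda>n. complex_of_real (c n)) \<longlonglongrightarrow> complex_of_real c'"
    using conv[of 0] unfolding c_def c'_def by (simp add: scaleR_conv_of_real)
  then have c: "c \<longlonglongrightarrow> c'" by (simp add: tendsto_of_real_iff)
  have [measurable]: "h \<in> borel_measurable borel"
    by (intro borel_measurable_continuous_onI continuous_at_imp_continuous_on ballI h)
  have "weak_conv_m (\<lambda>n. tilted_law M (w n) (v n)) (tilted_law N w' v')"
  proof (rule levy_continuity[OF r])
    fix s :: real
    have "(\<lambda>n. (\<integral>x. w n x *\<^sub>R iexp (s * v n x) \<partial>M) /\<^sub>R c n) \<longlonglongrightarrow> (\<integral>x. w' x *\<^sub>R iexp (s * v' x) \<partial>N) /\<^sub>R c'"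
      using c1(2) by (intro tendsto_intros conv c) auto
    then show "(\<lambda>n. char (tilted_law M (w n) (v n)) s) \<longlonglongrightarrow> char (tilted_law N w' v') s"
      unfolding char_def by (simp add: t del: of_real_mult)
  qed
  from weak_conv_imp_integral_bdd_continuous_conv[OF r this h]
  have "(\<lambda>n. (\<integral>x. w n x *\<^sub>R h (v n x) \<partial>M) /\<^sub>R c n) \<longlonglongrightarrow> (\<integral>x. w' x *\<^sub>R h (v' x) \<partial>N) /\<^sub>R c'"
    by (simp add: t)
  then have "(\<lambda>n. c n *\<^sub>R ((\<integral>x. w n x *\<^sub>R h (v n x) \<partial>M) /\<^sub>R c n)) \<longlonglongrightarrow> c' *\<^sub>R ((\<integral>x. w' x *\<^sub>R h (v' x) \<partial>N) /\<^sub>R c')"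
    by (rule tendsto_scaleR[OF c])
  moreover have "c n \<noteq> 0" "c' \<noteq> 0" for n
    using c1(1)[of n] c1(2) by auto
  ultimately show ?thesis
    by simp
qed

lemma weighted_char_conv_imp_integral_conv:
  fixes W :: "nat \<Rightarrow> 'a \<Rightarrow> complex" and v :: "nat \<Rightarrow> 'a \<Rightarrow> real"
    and W' :: "'b \<Rightarrow> complex" and v' :: "'b \<Rightarrow> real" and h :: "real \<Rightarrow> complex"
  assumes M: "prob_space M" and N: "prob_space N"
    and meas [measurable]: "\<And>n. W n \<in> borel_measurable M" "\<And>n. v n \<in> borel_measurable M"
      "W' \<in> borel_measurable N" "v' \<in> borel_measurable N"
    and bds: "\<And>n x. norm (W n x) \<le> 1" "\<And>x. norm (W' x) \<le> 1"
    and conv1: "\<And>s. (\<lambda>n. \<integral>x. iexp (s * v n x) \<partial>M) \<longlonglongrightarrow> (\<integral>x. iexp (s * v' x) \<partial>N)"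
    and conv: "\<And>s. (\<lambda>n. \<integral>x. W n x * iexp (s * v n x) \<partial>M) \<longlonglongrightarrow> (\<integral>x. W' x * iexp (s * v' x) \<partial>N)"
    and h: "\<And>x. isCont h x" "\<And>x. norm (h x) \<le> B"
  shows "(\<lambda>n. \<integral>x. W n x * h (v n x) \<partial>M) \<longlonglongrightarrow> (\<integral>x. W' x * h (v' x) \<partial>N)"
proof -
  interpret M: prob_space M by fact
  interpret N: prob_space N by fact
  have [measurable]: "h \<in> borel_measurable borel"
    by (intro borel_measurable_continuous_onI continuous_at_imp_continuous_on ballI h)
  have B: "0 \<le> B" using h(2)[of 0] norm_ge_zero order_trans by blast
  have [measurable]: "cnj \<in> borel_measurable borel"
    by (intro borel_measurable_continuous_onI continuous_intros)
  \<comment> \<open>\<open>p\<close> will be the real part, the imaginary part and \<open>0\<close>.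
    Being a combination of \<open>z\<close> and \<open>cnj z\<close>, it has a weighted transform
    given by that of the complex weight at \<open>s\<close> and, after conjugation, at
    \<open>-s\<close>.\<close>
  have key: "(\<lambda>n. \<integral>x. (2 + p (W n x)) *\<^sub>R h (v n x) \<partial>M) \<longlonglongrightarrow> (\<integral>x. (2 + p (W' x)) *\<^sub>R h (v' x) \<partial>N)"
    if p: "\<And>z. complex_of_real (p z) = a * z + b * cnj z" "\<And>z. \<bar>p z\<bar> \<le> norm z" and [measurable]: "p \<in> borel_measurable borel"
    for p :: "complex \<Rightarrow> real" and a b
  proof (rule weighted_char_conv_imp_integral_conv_real[OF M N])
    fix s
    have eq: "(\<integral>x. (2 + p (Z x)) *\<^sub>R iexp (s * u x) \<partial>K)
        = 2 * (\<integral>x. iexp (s * u x) \<partial>K) + a * (\<integral>x. Z x * iexp (s * u x) \<partial>K) + b * cnj (\<integral>x. Z x * iexp ((-s) * u x) \<partial>K)"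
      if "prob_space K" and [measurable]: "Z \<in> borel_measurable K" "u \<in> borel_measurable K" and Z: "\<And>x. norm (Z x) \<le> 1"
      for K :: "'c measure" and Z u
    proof -
      interpret K: prob_space K by fact
      have i: "integrable K (\<lambda>x. iexp (s * u x))" "integrable K (\<lambda>x. Z x * iexp (s * u x))"
         "integrable K (\<lambda>x. cnj (Z x) * iexp (s * u x))"
        by (auto intro!: K.integrable_const_bound[where B=1] simp: norm_mult Z)
      have "(\<integral>x. (2 + p (Z x)) *\<^sub>R iexp (s * u x) \<partial>K)
         = (\<integral>x. 2 * iexp (s * u x) + a * (Z x * iexp (s * u x)) + b * (cnj (Z x) * iexp (s * u x)) \<partial>K)"
        by (simp add: scaleR_conv_of_real p algebra_simps)
      also have "\<dots> = 2 * (\<integral>x. iexp (s * u x) \<partial>K) + a * (\<integral>x. Z x * iexp (s * u x) \<partial>K)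
           + b * (\<integral>x. cnj (Z x) * iexp (s * u x) \<partial>K)"
        using i by simp
      also have "(\<integral>x. cnj (Z x) * iexp (s * u x) \<partial>K) = cnj (\<integral>x. Z x * iexp ((-s) * u x) \<partial>K)"
        by (subst Bochner_Integration.integral_cnj[symmetric]) (simp add: exp_cnj)
      finally show ?thesis .
    qed
    show "(\<lambda>n. \<integral>x. (2 + p (W n x)) *\<^sub>R iexp (s * v n x) \<partial>M) \<longlonglongrightarrow> (\<integral>x. (2 + p (W' x)) *\<^sub>R iexp (s * v' x) \<partial>N)"
      unfolding eq[OF M meas(1,2) bds(1)] eq[OF N meas(3,4) bds(2)]
      by (intro tendsto_intros conv conv1)
  qed (use h bds p(2) in \<open>auto simp: abs_le_iff intro: order_trans\<close>, (smt (verit, best) p(2) bds)+)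
  \<comment> \<open>\<open>Z = (2 + Re Z) + \<i> (2 + Im Z) - 2 (1 + \<i>)\<close>. The constant
    weight is written \<open>2 + (\<lambda>_. 0) (Z x)\<close> so that it is an instance of
    \<open>key\<close> as well.\<close>
  have split: "(\<integral>x. Z x * h (u x) \<partial>K) = (\<integral>x. (2 + Re (Z x)) *\<^sub>R h (u x) \<partial>K) 
      + \<i> * (\<integral>x. (2 + Im (Z x)) *\<^sub>R h (u x) \<partial>K) - (1 + \<i>) * (\<integral>x. (2 + (\<lambda>_. 0) (Z x)) *\<^sub>R h (u x) \<partial>K)"
    if "prob_space K" and [measurable]: "Z \<in> borel_measurable K" "u \<in> borel_measurable K" and Z: "\<And>x. norm (Z x) \<le> 1"
    for K :: "'c measure" and Z u
  proof -
    interpret K: prob_space K by fact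
    have bd: "integrable K (\<lambda>x. (2 + p (Z x)) *\<^sub>R h (u x))" if [measurable]: "p \<in> borel_measurable borel"
        and p: "\<And>z. \<bar>p z\<bar> \<le> norm z" for p :: "complex \<Rightarrow> real"
    proof (rule K.integrable_const_bound[where B="3 * B"])
      show "AE x in K. norm ((2 + p (Z x)) *\<^sub>R h (u x)) \<le> 3 * B"
      proof (rule AE_I2)
        fix x
        have "\<bar>2 + p (Z x)\<bar> \<le> 3" using p[of "Z x"] Z[of x] by linarith
        then show "norm ((2 + p (Z x)) *\<^sub>R h (u x)) \<le> 3 * B"
          using h(2)[of "u x"] by (simp add: mult_mono)
      qed
    qed simp
    have "(\<integral>x. Z x * h (u x) \<partial>K) = (\<integral>x. (2 + Re (Z x)) *\<^sub>R h (u x)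
        + \<i> * ((2 + Im (Z x)) *\<^sub>R h (u x)) - (1 + \<i>) * ((2 + (\<lambda>_. 0) (Z x)) *\<^sub>R h (u x)) \<partial>K)"
    proof (intro Bochner_Integration.integral_cong refl)
      fix x
      show "Z x * h (u x) = (2 + Re (Z x)) *\<^sub>R h (u x)
        + \<i> * ((2 + Im (Z x)) *\<^sub>R h (u x)) - (1 + \<i>) * ((2 + (\<lambda>_. 0) (Z x)) *\<^sub>R h (u x))"
        by (subst complex_eq[of "Z x"]) (simp add: scaleR_conv_of_real algebra_simps)
    qed
    also have "\<dots> = (\<integral>x. (2 + Re (Z x)) *\<^sub>R h (u x) \<partial>K) 
      + \<i> * (\<integral>x. (2 + Im (Z x)) *\<^sub>R h (u x) \<partial>K) - (1 + \<i>) * (\<integral>x. (2 + (\<lambda>_. 0) (Z x)) *\<^sub>R h (u x) \<partial>K)"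
    proof -
      have i: "integrable K (\<lambda>x. (2 + Re (Z x)) *\<^sub>R h (u x))" "integrable K (\<lambda>x. (2 + Im (Z x)) *\<^sub>R h (u x))"
        "integrable K (\<lambda>x. (2 + (\<lambda>_. 0) (Z x)) *\<^sub>R h (u x))"
        by (rule bd; simp add: abs_Re_le_cmod abs_Im_le_cmod)+
      show ?thesis
        by (simp only: Bochner_Integration.integral_diff[OF Bochner_Integration.integrable_add[OF i(1) integrable_mult_right[OF i(2)]] integrable_mult_right[OF i(3)]]
              Bochner_Integration.integral_add[OF i(1) integrable_mult_right[OF i(2)]] integral_mult_right_zero)
    qed
    finally show ?thesis .
  qed
  have k: "(\<lambda>n. \<integral>x. (2 + Re (W n x)) *\<^sub>R h (v n x) \<partial>M) \<longlonglongrightarrow> (\<integral>x. (2 + Re (W' x)) *\<^sub>R h (v' x) \<partial>N)"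
    "(\<lambda>n. \<integral>x. (2 + Im (W n x)) *\<^sub>R h (v n x) \<partial>M) \<longlonglongrightarrow> (\<integral>x. (2 + Im (W' x)) *\<^sub>R h (v' x) \<partial>N)"
    "(\<lambda>n. \<integral>x. (2 + (\<lambda>_. 0) (W n x)) *\<^sub>R h (v n x) \<partial>M) \<longlonglongrightarrow> (\<integral>x. (2 + (\<lambda>_. 0) (W' x)) *\<^sub>R h (v' x) \<partial>N)"
    by (rule key[of Re "1/2" "1/2"] key[of Im "-\<i>/2" "\<i>/2"] key[of "\<lambda>_. 0" 0 0];
        simp add: abs_Re_le_cmod abs_Im_le_cmod complex_eq_iff)+
  show ?thesis
    unfolding split[OF M meas(1,2) bds(1)] split[OF N meas(3,4) bds(2)]
    by (intro tendsto_intros k)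
qed

text \<open>A coordinatewise substitute for the multivariate continuous mapping theorem: the factors
  \<open>exp (i a\<^sub>j V\<^sub>j)\<close> are replaced by \<open>exp (i c\<^sub>j \<bar>V\<^sub>j\<bar>)\<close> one at a time.\<close>

lemma joint_char_conv_abs:
  fixes V :: "nat \<Rightarrow> nat \<Rightarrow> 'a \<Rightarrow> real" and V' :: "nat \<Rightarrow> 'b \<Rightarrow> real"
  assumes M: "prob_space M" and N: "prob_space N"
    and meas [measurable]: "\<And>n j. V n j \<in> borel_measurable M" "\<And>j. V' j \<in> borel_measurable N"
    and conv: "\<And>a :: nat \<Rightarrow> real. (\<lambda>n. \<integral>x. iexp (\<Sum>j<p. a j * V n j x) \<partial>M) \<longlonglongrightarrow> (\<integral>x. iexp (\<Sum>j<p. a j * V' j x) \<partial>N)"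
  shows "(\<lambda>n. \<integral>x. iexp (\<Sum>j<p. c j * \<bar>V n j x\<bar>) \<partial>M) \<longlonglongrightarrow> (\<integral>x. iexp (\<Sum>j<p. c j * \<bar>V' j x\<bar>) \<partial>N)"
proof -
  \<comment> \<open>Hybrid exponents: the first \<open>r\<close> coordinates already carry absolute
    values, the others are still linear.\<close>
  define m where "m = (\<lambda>r a j (x::real). if j < r then c j * \<bar>x\<bar> else a j * x)" for a :: "nat \<Rightarrow> real" and r :: nat
  have [measurable]: "m r a j \<in> borel_measurable borel" for r a j
    unfolding m_def by simp
  have "r \<le> p \<longrightarrow> (\<forall>a. (\<lambda>n. \<integral>x. iexp (\<Sum>j<p. m r a j (V n j x)) \<partial>M) \<longlonglongrightarrow> (\<integral>x. iexp (\<Sum>j<p. m r a j (V' j x)) \<partial>N))" for r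
  proof (induction r)
    case 0
    show ?case using conv by (simp add: m_def)
  next
    case (Suc r)
    show ?case
    proof (intro impI allI)
      fix a assume r: "Suc r \<le> p"
      have s: "(\<Sum>j\<in>{..<p}-{r}. m (Suc r) a j (f j)) = (\<Sum>j\<in>{..<p}-{r}. m r (a(r := s)) j (f j))" for f s
        by (intro sum.cong refl) (auto simp: m_def less_Suc_eq)
      have split: "iexp (\<Sum>j<p. q j) = iexp (\<Sum>j\<in>{..<p}-{r}. q j) * iexp (q r)" for q :: "nat \<Rightarrow> real"
        using r by (subst sum.remove[of "{..<p}" r]) (auto simp: exp_add[symmetric] algebra_simps)
      \<comment> \<open>The other coordinates form a weight of modulus one. The induction hypothesis
        holds for all linear coefficients, so varying the \<open>r\<close>-th gives every frequency
        of coordinate \<open>r\<close>.\<close>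
      have IH: "(\<lambda>n. \<integral>x. iexp (\<Sum>j\<in>{..<p}-{r}. m (Suc r) a j (V n j x)) * iexp (s * V n r x) \<partial>M) \<longlonglongrightarrow>
          (\<integral>x. iexp (\<Sum>j\<in>{..<p}-{r}. m (Suc r) a j (V' j x)) * iexp (s * V' r x) \<partial>N)" for s
      proof -
        have "(\<lambda>n. \<integral>x. iexp (\<Sum>j<p. m r (a(r := s)) j (V n j x)) \<partial>M) \<longlonglongrightarrow> (\<integral>x. iexp (\<Sum>j<p. m r (a(r := s)) j (V' j x)) \<partial>N)"
          using Suc r by auto
        then show ?thesis
          unfolding split by (subst (1 2) s) (simp add: m_def)
      qed
      \<comment> \<open>A coefficient vector supported at \<open>r\<close> gives the unweighted
        convergence.\<close>
      have one: "(\<lambda>n. \<integral>x. iexp (s * V n r x) \<partial>M) \<longlonglongrightarrow> (\<integral>x. iexp (s * V' r x) \<partial>N)" for s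
      proof -
        have "(\<Sum>j<p. (if j = r then s else 0) * f j) = s * f r" for f :: "nat \<Rightarrow> real"
          using r by (subst sum.remove[of "{..<p}" r]) auto
        with conv[of "\<lambda>j. if j = r then s else 0"] show ?thesis by simp
      qed
      have "(\<lambda>n. \<integral>x. iexp (\<Sum>j\<in>{..<p}-{r}. m (Suc r) a j (V n j x)) * iexp (c r * \<bar>V n r x\<bar>) \<partial>M) \<longlonglongrightarrow>
          (\<integral>x. iexp (\<Sum>j\<in>{..<p}-{r}. m (Suc r) a j (V' j x)) * iexp (c r * \<bar>V' r x\<bar>) \<partial>N)"
        by (rule weighted_char_conv_imp_integral_conv[OF M N _ _ _ _ _ _ one IH, where h = "\<lambda>x. iexp (c r * \<bar>x\<bar>)" and B = 1])
           (auto intro!: continuous_intros)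
      then show "(\<lambda>n. \<integral>x. iexp (\<Sum>j<p. m (Suc r) a j (V n j x)) \<partial>M) \<longlonglongrightarrow> (\<integral>x. iexp (\<Sum>j<p. m (Suc r) a j (V' j x)) \<partial>N)"
        unfolding split by (simp add: m_def)
    qed
  qed
  from this[of p] show ?thesis by (simp add: m_def)
qed

section \<open>Measure preserving automorphisms and the ergodic theorem\<close>

lemma norm_integral_le_integral:
  fixes f :: "'a \<Rightarrow> 'b::{banach,second_countable_topology}"
  assumes "integrable M f" "integrable M g" "\<And>x. x \<in> space M \<Longrightarrow> norm (f x) \<le> g x"
  shows "norm (\<integral>x. f x \<partial>M) \<le> (\<integral>x. g x \<partial>M)"
  using assms by (intro order_trans[OF integral_norm_bound] integral_mono) auto

lemma Cesaro_mean_tendsto: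
  fixes d :: "nat \<Rightarrow> real"
  assumes "d \<longlonglongrightarrow> L"
  shows "(\<lambda>n. (\<Sum>i<n. d i) / real n) \<longlonglongrightarrow> L"
proof (rule LIMSEQ_I)
  fix e :: real assume e: "0 < e"
  from LIMSEQ_D[OF assms, of "e/2"] e obtain N where N: "\<And>n. n \<ge> N \<Longrightarrow> \<bar>d n - L\<bar> < e/2" by auto
  define K where "K = (\<Sum>i<N. \<bar>d i - L\<bar>)"
  obtain N' :: nat where N': "2 * K / e < real N'" using reals_Archimedean2 by blast
  show "\<exists>no. \<forall>n\<ge>no. norm ((\<Sum>i<n. d i) / real n - L) < e"
  proof (intro exI allI impI)
    fix n assume n: "n \<ge> N + N' + 1"
    have "\<bar>\<Sum>i<n. d i - L\<bar> \<le> (\<Sum>i<n. \<bar>d i - L\<bar>)" by (rule sum_abs)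
    also have "\<dots> = K + (\<Sum>i\<in>{N..<n}. \<bar>d i - L\<bar>)"
      unfolding K_def using n by (subst sum.union_disjoint[symmetric]) (auto intro!: sum.cong)
    also have "(\<Sum>i\<in>{N..<n}. \<bar>d i - L\<bar>) \<le> (\<Sum>i\<in>{N..<n}. e/2)"
      by (rule sum_mono, rule less_imp_le, rule N) simp
    also have "\<dots> \<le> real n * (e/2)" using e by (simp add: mult_right_mono)
    finally have 1: "\<bar>\<Sum>i<n. d i - L\<bar> \<le> K + real n * (e/2)" by simp
    have "2 * K < e * real N'" using N' e by (simp add: field_simps)
    also have "\<dots> \<le> e * real n" using n e by simp
    finally have "K < real n * (e/2)" by (simp add: mult.commute)
    with 1 have 2: "\<bar>\<Sum>i<n. d i - L\<bar> < real n * e" by simp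
    have "(\<Sum>i<n. d i) / real n - L = (\<Sum>i<n. d i - L) / real n"
      using n by (simp add: sum_subtractf field_simps)
    then show "norm ((\<Sum>i<n. d i) / real n - L) < e"
      using 2 n by (simp add: abs_divide field_simps)
  qed
qed

context prob_space
begin

lemma integrable_bounded:
  fixes f :: "'a \<Rightarrow> 'b::{banach, second_countable_topology}"
  assumes "f \<in> borel_measurable M" "\<And>x. norm (f x) \<le> B"
  shows "integrable M f"
  using assms by (intro integrable_const_bound[where B=B]) auto

lemma integral_abs_le_sqrt:
  fixes f :: "'a \<Rightarrow> real"
  assumes f: "integrable M f" "integrable M (\<lambda>x. (f x)\<^sup>2)"
  shows "(\<integral>x. \<bar>f x\<bar> \<partial>M) \<le> sqrt (\<integral>x. (f x)\<^sup>2 \<partial>M)"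
proof (rule real_le_rsqrt)
  have "0 \<le> variance (\<lambda>x. \<bar>f x\<bar>)" by (rule variance_positive)
  also have "\<dots> = (\<integral>x. (f x)\<^sup>2 \<partial>M) - (\<integral>x. \<bar>f x\<bar> \<partial>M)\<^sup>2"
    using f by (subst variance_eq) auto
  finally show "(\<integral>x. \<bar>f x\<bar> \<partial>M)\<^sup>2 \<le> (\<integral>x. (f x)\<^sup>2 \<partial>M)" by simp
qed

text \<open>Characteristic functions are Lipschitz for the distance in mean. The \<open>L1\<close>
  approximations below are transferred to characteristic functions in this way.\<close>

lemma norm_integral_iexp_diff_le:
  fixes f g :: "'a \<Rightarrow> real"
  assumes [measurable]: "f \<in> borel_measurable M" "g \<in> borel_measurable M"
    and i: "integrable M (\<lambda>x. f x - g x)"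
  shows "norm ((\<integral>x. iexp (f x) \<partial>M) - (\<integral>x. iexp (g x) \<partial>M)) \<le> (\<integral>x. \<bar>f x - g x\<bar> \<partial>M)"
proof -
  have j: "integrable M (\<lambda>x. iexp (f x))" "integrable M (\<lambda>x. iexp (g x))"
    by (rule integrable_bounded[where B=1]; simp)+
  have "norm (\<integral>x. iexp (f x) - iexp (g x) \<partial>M) \<le> (\<integral>x. \<bar>f x - g x\<bar> \<partial>M)"
  proof (rule norm_integral_le_integral)
    fix x
    have "norm (iexp (f x) - iexp (g x)) = norm (iexp (g x) * (iexp (f x - g x) - 1))"
      by (simp add: right_diff_distrib exp_add[symmetric] algebra_simps)
    also have "\<dots> \<le> \<bar>f x - g x\<bar>"
      using iexp_approx1[of "f x - g x" 0] by (simp add: norm_mult)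
    finally show "norm (iexp (f x) - iexp (g x)) \<le> \<bar>f x - g x\<bar>" .
  qed (use i j in auto)
  then show ?thesis using j by simp
qed

end

locale automorphism = prob_space +
  fixes T S :: "'a \<Rightarrow> 'a"
  assumes T_meas [measurable]: "T \<in> measurable M M" and S_meas [measurable]: "S \<in> measurable M M"
    and ST: "\<And>x. x \<in> space M \<Longrightarrow> S (T x) = x" and TS: "\<And>x. x \<in> space M \<Longrightarrow> T (S x) = x"
    and T_pres: "distr M M T = M"
begin

lemma funpow_T_meas [measurable]: "T ^^ k \<in> measurable M M"
  by (induction k) (auto intro: measurable_comp)

lemma funpow_S_meas [measurable]: "S ^^ k \<in> measurable M M"
  by (induction k) (auto intro: measurable_comp)

lemma funpow_in_space:
  assumes "x \<in> space M"
  shows "(T ^^ k) x \<in> space M" "(S ^^ k) x \<in> space M"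
  using measurable_space[OF funpow_T_meas assms] measurable_space[OF funpow_S_meas assms] by auto

lemma funpow_S_T:
  assumes "x \<in> space M" shows "(S ^^ k) ((T ^^ (k + j)) x) = (T ^^ j) x"
proof (induction k)
  case (Suc k)
  have "(S ^^ Suc k) ((T ^^ (Suc k + j)) x) = (S ^^ k) (S (T ((T ^^ (k + j)) x)))"
    by (simp add: funpow_swap1)
  with Suc funpow_in_space(1)[OF assms] show ?case by (simp add: ST)
qed simp

lemma funpow_T_S:
  assumes "x \<in> space M" shows "(T ^^ k) ((S ^^ (k + j)) x) = (S ^^ j) x"
proof (induction k)
  case (Suc k)
  have "(T ^^ Suc k) ((S ^^ (Suc k + j)) x) = (T ^^ k) (T (S ((S ^^ (k + j)) x)))"
    by (simp add: funpow_swap1)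
  with Suc funpow_in_space(2)[OF assms] show ?case by (simp add: TS)
qed simp

lemma distr_funpow_T: "distr M M (T ^^ k) = M"
proof (induction k)
  case 0
  then show ?case by (metis distr_id funpow_0 id_apply eq_id_iff)
next
  case (Suc k)
  have "distr M M (T ^^ Suc k) = distr (distr M M (T ^^ k)) M T"
    by (subst distr_distr) simp_all
  with Suc T_pres show ?case by (simp add: comp_def)
qed

lemma integral_funpow_T:
  fixes f :: "'a \<Rightarrow> 'b::{banach, second_countable_topology}"
  assumes "f \<in> borel_measurable M"
  shows "(\<integral>x. f ((T ^^ k) x) \<partial>M) = (\<integral>x. f x \<partial>M)"
  using integral_distr[OF funpow_T_meas assms, of k] by (simp add: distr_funpow_T)

text \<open>The shift moves to the other factor and becomes a backward one. Backward shifts will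
  preserve measurability with respect to the past, so that this identity carries the conditioning
  arguments.\<close>

lemma integral_mult_funpow_T:
  fixes f g :: "'a \<Rightarrow> 'b::{banach, second_countable_topology, real_normed_algebra}"
  assumes [measurable]: "f \<in> borel_measurable M" "g \<in> borel_measurable M"
  shows "(\<integral>x. f x * g ((T ^^ k) x) \<partial>M) = (\<integral>x. f ((S ^^ k) x) * g x \<partial>M)"
proof -
  have "(\<integral>x. f ((S ^^ k) x) * g x \<partial>M) = (\<integral>x. f ((S ^^ k) ((T ^^ k) x)) * g ((T ^^ k) x) \<partial>M)"
    by (rule integral_funpow_T[symmetric]) measurable
  also have "\<dots> = (\<integral>x. f x * g ((T ^^ k) x) \<partial>M)"
    by (intro Bochner_Integration.integral_cong refl) (use funpow_S_T[where j=0] in auto)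
  finally show ?thesis ..
qed

text \<open>Passing from \<open>n\<close> to \<open>n + 1\<close> adds the covariances of the new
  term with all earlier ones. In this form the variance divided by \<open>n\<close> is a Cesaro mean
  of partial sums of the covariance series.\<close>

lemma integral_sum_funpow_sq:
  fixes f :: "'a \<Rightarrow> real"
  assumes [measurable]: "f \<in> borel_measurable M" and B: "\<And>x. \<bar>f x\<bar> \<le> B"
  defines "c \<equiv> \<lambda>k. \<integral>x. f x * f ((T ^^ k) x) \<partial>M"
  shows "(\<integral>x. (\<Sum>k<n. f ((T ^^ k) x))\<^sup>2 \<partial>M) = (\<Sum>i<n. c 0 + 2 * (\<Sum>k<i. c (Suc k)))"
proof (induction n)
  case (Suc n)
  have B0: "0 \<le> B" using B[of undefined] by linarith
  have bp: "integrable M (\<lambda>x. f ((T ^^ i) x) * f ((T ^^ j) x))" for i j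
    by (rule integrable_bounded[where B="B * B"]) (auto simp: abs_mult intro!: mult_mono B B0)
  have cc: "(\<integral>x. f ((T ^^ i) x) * f ((T ^^ n) x) \<partial>M) = c (n - i)" if "i \<le> n" for i
  proof -
    have "(\<integral>x. f ((T ^^ i) x) * f ((T ^^ n) x) \<partial>M) = (\<integral>x. f ((T ^^ i) x) * f ((T ^^ (n - i)) ((T ^^ i) x)) \<partial>M)"
      using that by (simp add: funpow_add[symmetric, THEN fun_cong, unfolded comp_def])
    also have "\<dots> = c (n - i)" unfolding c_def by (rule integral_funpow_T) measurable
    finally show ?thesis .
  qed
  have "(\<integral>x. (\<Sum>k<Suc n. f ((T ^^ k) x))\<^sup>2 \<partial>M)
    = (\<integral>x. (\<Sum>k<n. f ((T ^^ k) x))\<^sup>2 + 2 * (\<Sum>k<n. f ((T ^^ k) x) * f ((T ^^ n) x)) + f ((T ^^ n) x) * f ((T ^^ n) x) \<partial>M)"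
    by (intro Bochner_Integration.integral_cong refl) (simp add: power2_eq_square algebra_simps sum_distrib_left sum_distrib_right)
  also have "\<dots> = (\<integral>x. (\<Sum>k<n. f ((T ^^ k) x))\<^sup>2 \<partial>M) + 2 * (\<Sum>k<n. \<integral>x. f ((T ^^ k) x) * f ((T ^^ n) x) \<partial>M)
     + (\<integral>x. f ((T ^^ n) x) * f ((T ^^ n) x) \<partial>M)"
  proof -
    have "integrable M (\<lambda>x. (\<Sum>k<n. f ((T ^^ k) x))\<^sup>2)"
      unfolding power2_eq_square sum_product by (intro Bochner_Integration.integrable_sum bp)
    moreover have "integrable M (\<lambda>x. 2 * (\<Sum>k<n. f ((T ^^ k) x) * f ((T ^^ n) x)))"
      by (intro integrable_mult_right Bochner_Integration.integrable_sum bp)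
    ultimately show ?thesis
      using bp by (simp add: Bochner_Integration.integral_sum)
  qed
  also have "\<dots> = (\<Sum>i<Suc n. c 0 + 2 * (\<Sum>k<i. c (Suc k)))"
  proof -
    have "(\<Sum>k<n. \<integral>x. f ((T ^^ k) x) * f ((T ^^ n) x) \<partial>M) = (\<Sum>k<n. c (n - k))"
      by (intro sum.cong refl cc) auto
    also have "\<dots> = (\<Sum>k<n. c (Suc k))"
      by (subst sum.nat_diff_reindex[symmetric]) (intro sum.cong refl, simp add: Suc_diff_Suc)
    finally show ?thesis using Suc.IH cc[of n] by simp
  qed
  finally show ?case .
qed simp

text \<open>Each summand of the variance formula is \<open>c 0\<close> plus twice finitely many
  further covariances; doubling the bound of \<open>c 0\<close> as well gives
  \<open>2 * suminf b\<close>, uniformly.\<close>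

lemma integral_sum_funpow_sq_le:
  fixes f :: "'a \<Rightarrow> real"
  assumes "f \<in> borel_measurable M" and "\<And>x. \<bar>f x\<bar> \<le> B"
    and le: "\<And>k. \<bar>\<integral>x. f x * f ((T ^^ k) x) \<partial>M\<bar> \<le> b k" and b: "summable b"
  shows "(\<integral>x. (\<Sum>k<n. f ((T ^^ k) x))\<^sup>2 \<partial>M) \<le> 2 * real n * suminf b"
proof -
  define c where "c k = (\<integral>x. f x * f ((T ^^ k) x) \<partial>M)" for k
  have "c 0 + 2 * (\<Sum>k<i. c (Suc k)) \<le> 2 * suminf b" for i
  proof -
    have b0: "0 \<le> b k" and cb: "c k \<le> b k" for k using le[of k] unfolding c_def by linarith+
    have "c 0 + 2 * (\<Sum>k<i. c (Suc k)) \<le> b 0 + 2 * (\<Sum>k<i. b (Suc k))"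
      by (intro add_mono mult_left_mono sum_mono cb) auto
    also have "\<dots> \<le> 2 * (\<Sum>k<Suc i. b k)"
      using b0[of 0] by (subst sum.lessThan_Suc_shift) simp
    also have "\<dots> \<le> 2 * suminf b" using sum_le_suminf[OF b, of "{..<Suc i}"] b0 by simp
    finally show ?thesis .
  qed
  then have "(\<Sum>i<n. c 0 + 2 * (\<Sum>k<i. c (Suc k))) \<le> (\<Sum>i<n. 2 * suminf b)" by (intro sum_mono)
  then show ?thesis
    unfolding integral_sum_funpow_sq[OF assms(1,2)] c_def by simp
qed

lemma integral_sum_funpow_sq_tendsto:
  fixes f :: "'a \<Rightarrow> real"
  assumes "f \<in> borel_measurable M" and "\<And>x. \<bar>f x\<bar> \<le> B"
  defines "c \<equiv> \<lambda>k. \<integral>x. f x * f ((T ^^ k) x) \<partial>M"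
  assumes c: "summable (\<lambda>k. c (Suc k))"
  shows "(\<lambda>n. (\<integral>x. (\<Sum>k<n. f ((T ^^ k) x))\<^sup>2 \<partial>M) / real n) \<longlonglongrightarrow> c 0 + 2 * (\<Sum>k. c (Suc k))"
  unfolding integral_sum_funpow_sq[OF assms(1,2)]
  using c unfolding c_def by (intro Cesaro_mean_tendsto tendsto_intros summable_LIMSEQ)

end

section \<open>The pointwise ergodic theorem for bounded functions\<close>

locale ergodic_automorphism = automorphism +
  assumes ergodic: "ergodic M T"
begin

text \<open>Garsia's argument for the maximal ergodic theorem. \<open>max_birkhoff f n\<close> is the running maximum of the Birkhoff sums,
  starting from the empty sum.\<close>

primrec max_birkhoff :: "('a \<Rightarrow> real) \<Rightarrow> nat \<Rightarrow> 'a \<Rightarrow> real" where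
  "max_birkhoff f 0 x = 0"
| "max_birkhoff f (Suc n) x = max 0 (f x + max_birkhoff f n (T x))"

lemma max_birkhoff_nonneg: "0 \<le> max_birkhoff f n x"
  by (cases n) auto

lemma max_birkhoff_mono: "max_birkhoff f n x \<le> max_birkhoff f (Suc n) x"
  by (induction n arbitrary: x) (auto intro: max.mono simp: max.coboundedI2)

lemma birkhoff_sum_le_mx: "(\<Sum>k<n. f ((T ^^ k) x)) \<le> max_birkhoff f n x"
proof (induction n arbitrary: x)
  case (Suc n)
  have "(\<Sum>k<Suc n. f ((T ^^ k) x)) = f x + (\<Sum>k<n. f ((T ^^ k) (T x)))"
    by (subst sum.lessThan_Suc_shift) (simp add: funpow_swap1)
  with Suc[of "T x"] show ?case by simp
qed simp

lemma max_birkhoff_bounded: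
  assumes "\<And>x. \<bar>f x\<bar> \<le> B"
  shows "\<bar>max_birkhoff f n x\<bar> \<le> real n * B"
proof (induction n arbitrary: x)
  case (Suc n)
  have "\<bar>max 0 (f x + max_birkhoff f n (T x))\<bar> \<le> \<bar>f x\<bar> + \<bar>max_birkhoff f n (T x)\<bar>" by linarith
  with assms[of x] Suc[of "T x"] show ?case by (simp add: algebra_simps)
qed simp

lemma max_birkhoff_meas [measurable]:
  assumes [measurable]: "f \<in> borel_measurable M"
  shows "max_birkhoff f n \<in> borel_measurable M"
proof (induction n)
  case 0
  then show ?case by (simp add: max_birkhoff.simps(1)[abs_def])
next
  case (Suc n)
  note [measurable] = Suc
  show ?case unfolding max_birkhoff.simps(2)[abs_def] by measurable
qed

text \<open>Were the running maxima unbounded almost everywhere,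
  \<open>max_birkhoff f (Suc n) x - max_birkhoff f n (T x)\<close> would tend to \<open>f x\<close>,
  although its integral is nonnegative by invariance and monotonicity; this contradicts the negative
  mean. The set of unboundedness is invariant, so ergodicity leaves only probability zero.\<close>

lemma AE_birkhoff_sums_bdd_above:
  fixes f :: "'a \<Rightarrow> real"
  assumes [measurable]: "f \<in> borel_measurable M" and B: "\<And>x. \<bar>f x\<bar> \<le> B" and neg: "(\<integral>x. f x \<partial>M) < 0"
  shows "AE x in M. \<exists>C. \<forall>n. (\<Sum>k<n. f ((T ^^ k) x)) \<le> C"
proof -
  define A where "A = {x \<in> space M. \<forall>C::nat. \<exists>n. real C < max_birkhoff f n x}"
  have A [measurable]: "A \<in> sets M" unfolding A_def by measurable
  have inv: "T x \<in> A \<longleftrightarrow> x \<in> A" if x: "x \<in> space M" for x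
  proof -
    have Tx: "T x \<in> space M" using measurable_space[OF T_meas x] .
    \<comment> \<open>Up to an index shift, one step of \<open>T\<close> changes the running maxima
      by at most \<open>B\<close>; levels are therefore shifted by an integer
      \<open>K >= B\<close>.\<close>
    obtain K :: nat where K: "B \<le> real K" using real_arch_simple by blast
    show ?thesis
    proof
      assume "T x \<in> A"
      then have *: "\<exists>n. real (C + K) < max_birkhoff f n (T x)" for C unfolding A_def by blast
      show "x \<in> A" unfolding A_def
      proof (safe intro!: x)
        fix C :: nat
        from *[of C] obtain n where "real (C + K) < max_birkhoff f n (T x)" ..
        then have "real C < max_birkhoff f (Suc n) x" using B[of x] K by simp
        then show "\<exists>n. real C < max_birkhoff f n x" ..
      qed
    next
      assume "x \<in> A"
      then have *: "\<exists>n. real (C + K) < max_birkhoff f n x" for C unfolding A_def by blast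
      show "T x \<in> A" unfolding A_def
      proof (safe intro!: Tx)
        fix C :: nat
        from *[of C] obtain n where n: "real (C + K) < max_birkhoff f n x" ..
        then have "n \<noteq> 0" by (metis max_birkhoff.simps(1) of_nat_0_le_iff not_less)
        then obtain m where "n = Suc m" by (cases n) auto
        with n have "real C < max_birkhoff f m (T x)" using B[of x] K by (auto simp: max_def split: if_splits)
        then show "\<exists>n. real C < max_birkhoff f n (T x)" ..
      qed
    qed
  qed
  have "T ` A = A"
  proof safe
    fix x assume "x \<in> A" then show "T x \<in> A" using inv[of x] by (auto simp: A_def)
  next
    fix x assume x: "x \<in> A"
    then have "x \<in> space M" by (auto simp: A_def)
    then have "S x \<in> space M" "T (S x) = x" using measurable_space[OF S_meas] TS by auto
    then show "x \<in> T ` A" using x inv[of "S x"] by (metis imageI)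
  qed
  then have "prob A = 0 \<or> prob A = 1" using ergodic A unfolding ergodic_def by blast
  moreover have "prob A \<noteq> 1"
  proof
    assume P: "prob A = 1"
    have AEA: "AE x in M. x \<in> A" using P by (simp add: AE_in_set_eq_1)
    have i: "integrable M (max_birkhoff f n)" for n
      by (rule integrable_bounded[where B="real n * B"]) (auto intro: max_birkhoff_bounded B)
    have iT: "integrable M (\<lambda>x. max_birkhoff f n (T x))" for n
      by (rule integrable_bounded[where B="real n * B"]) (auto intro: max_birkhoff_bounded B)
    have pos: "0 \<le> (\<integral>x. max_birkhoff f (Suc n) x - max_birkhoff f n (T x) \<partial>M)" for n
    proof -
      have "(\<integral>x. max_birkhoff f n (T x) \<partial>M) = (\<integral>x. max_birkhoff f n x \<partial>M)"
        using integral_funpow_T[of "max_birkhoff f n" 1] by simp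
      also have "\<dots> \<le> (\<integral>x. max_birkhoff f (Suc n) x \<partial>M)"
        by (intro integral_mono i max_birkhoff_mono)
      finally show ?thesis by (subst Bochner_Integration.integral_diff[OF i iT]) (simp del: max_birkhoff.simps)
    qed
    have "(\<lambda>n. \<integral>x. max_birkhoff f (Suc n) x - max_birkhoff f n (T x) \<partial>M) \<longlonglongrightarrow> (\<integral>x. f x \<partial>M)"
    proof (rule integral_dominated_convergence[where w="\<lambda>_. B"])
      show "AE x in M. (\<lambda>n. max_birkhoff f (Suc n) x - max_birkhoff f n (T x)) \<longlonglongrightarrow> f x"
        using AEA AE_space
      proof eventually_elim
        fix x assume "x \<in> A" "x \<in> space M"
        then have "T x \<in> A" using inv by auto
        moreover obtain K :: nat where K: "B \<le> real K" using real_arch_simple by blast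
        ultimately obtain N where N: "real K < max_birkhoff f N (T x)" unfolding A_def by blast
        have "max_birkhoff f (Suc n) x - max_birkhoff f n (T x) = f x" if "n \<ge> N" for n
        proof -
          have "incseq (\<lambda>n. max_birkhoff f n (T x))" using max_birkhoff_mono by (auto intro: incseq_SucI simp del: max_birkhoff.simps)
          then have "real K < max_birkhoff f n (T x)" using N that by (meson incseqD less_le_trans)
          then show ?thesis using B[of x] K by auto
        qed
        then show "(\<lambda>n. max_birkhoff f (Suc n) x - max_birkhoff f n (T x)) \<longlonglongrightarrow> f x"
          by (intro tendsto_eventually) (auto simp: eventually_sequentially)
      qed
      \<comment> \<open>The difference is the maximum of \<open>f x\<close> and the nonpositive
        number \<open>- max_birkhoff f n (T x)\<close>, so its modulus is at most that of
        \<open>f x\<close>.\<close>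
      show "AE x in M. norm (max_birkhoff f (Suc n) x - max_birkhoff f n (T x)) \<le> B" for n
      proof (rule AE_I2)
        fix x show "norm (max_birkhoff f (Suc n) x - max_birkhoff f n (T x)) \<le> B"
          using B[of x] max_birkhoff_nonneg[of f n "T x"] by (auto simp: max_def)
      qed
    qed auto
    then have "0 \<le> (\<integral>x. f x \<partial>M)" by (rule LIMSEQ_le_const) (use pos in blast)
    with neg show False by simp
  qed
  ultimately have "prob A = 0" by simp
  then have "AE x in M. x \<notin> A" by (simp add: prob_eq_0)
  then show ?thesis using AE_space
  proof eventually_elim
    fix x assume "x \<notin> A" "x \<in> space M"
    then obtain C :: nat where "max_birkhoff f n x \<le> real C" for n unfolding A_def by (auto simp: not_less)
    then show "\<exists>C. \<forall>n. (\<Sum>k<n. f ((T ^^ k) x)) \<le> C" using birkhoff_sum_le_mx[where f=f and x=x] order_trans by blast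
  qed
qed

text \<open>With \<open>m\<close> the mean, \<open>f - m - e\<close> has mean \<open>- e\<close>, so
  its Birkhoff sums are bounded above by some \<open>C\<close>. One \<open>e\<close> comes from this
  centring, the other from \<open>C / n\<close>.\<close>

lemma AE_birkhoff_means_upper:
  fixes f :: "'a \<Rightarrow> real"
  assumes [measurable]: "f \<in> borel_measurable M" and B: "\<And>x. \<bar>f x\<bar> \<le> B" and e: "0 < e"
  shows "AE x in M. \<forall>\<^sub>F n in sequentially. (\<Sum>k<n. f ((T ^^ k) x)) / real n \<le> (\<integral>x. f x \<partial>M) + 2 * e"
proof -
  define m where "m = (\<integral>x. f x \<partial>M)"
  have i: "integrable M f" by (rule integrable_bounded[where B=B]) (auto intro: B)
  have "AE x in M. \<exists>C. \<forall>n. (\<Sum>k<n. f ((T ^^ k) x) - m - e) \<le> C"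
  proof (rule AE_birkhoff_sums_bdd_above)
    show "\<bar>f x - m - e\<bar> \<le> B + \<bar>m\<bar> + e" for x using B[of x] e by linarith
    show "(\<integral>x. f x - m - e \<partial>M) < 0" using i e by (simp add: m_def prob_space)
  qed simp
  then show ?thesis
  proof eventually_elim
    fix x assume "\<exists>C. \<forall>n. (\<Sum>k<n. f ((T ^^ k) x) - m - e) \<le> C"
    then obtain C where C: "\<And>n. (\<Sum>k<n. f ((T ^^ k) x) - m - e) \<le> C" by blast
    obtain N :: nat where N: "C / e \<le> real N" using real_arch_simple by blast
    have "(\<Sum>k<n. f ((T ^^ k) x)) / real n \<le> m + 2 * e" if n: "n \<ge> Suc N" for n
    proof -
      have "C \<le> real N * e" using N e by (simp add: field_simps)
      also have "\<dots> \<le> real n * e" using n e by simp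
      finally have "(\<Sum>k<n. f ((T ^^ k) x)) \<le> real n * (m + e) + real n * e"
        using C[of n] by (simp add: sum_subtractf algebra_simps)
      then show ?thesis using n by (simp add: field_simps)
    qed
    then show "\<forall>\<^sub>F n in sequentially. (\<Sum>k<n. f ((T ^^ k) x)) / real n \<le> (\<integral>x. f x \<partial>M) + 2 * e"
      unfolding m_def[symmetric] eventually_sequentially by blast
  qed
qed

text \<open>Upper bounds for \<open>f\<close> and for \<open>- f\<close>, along countably many
  tolerances so that the exceptional sets can be united.\<close>

theorem AE_birkhoff_means_tendsto:
  fixes f :: "'a \<Rightarrow> real"
  assumes [measurable]: "f \<in> borel_measurable M" and B: "\<And>x. \<bar>f x\<bar> \<le> B"
  shows "AE x in M. (\<lambda>n. (\<Sum>k<n. f ((T ^^ k) x)) / real n) \<longlonglongrightarrow> (\<integral>x. f x \<partial>M)"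
proof -
  define e where "e j = inverse (real (Suc j))" for j
  have e: "0 < e j" for j by (simp add: e_def)
  have "AE x in M. \<forall>j. \<forall>\<^sub>F n in sequentially. (\<Sum>k<n. f ((T ^^ k) x)) / real n \<le> (\<integral>x. f x \<partial>M) + 2 * e j"
    unfolding AE_all_countable by (intro allI AE_birkhoff_means_upper[OF _ B e]) simp
  moreover have "AE x in M. \<forall>j. \<forall>\<^sub>F n in sequentially. (\<Sum>k<n. - f ((T ^^ k) x)) / real n \<le> (\<integral>x. - f x \<partial>M) + 2 * e j"
    unfolding AE_all_countable by (intro allI AE_birkhoff_means_upper[OF _ _ e, of "\<lambda>x. - f x" B]) (auto simp: B)
  ultimately show ?thesis
  proof eventually_elim
    fix x
    let ?s = "\<lambda>n. (\<Sum>k<n. f ((T ^^ k) x)) / real n"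
    assume 1: "\<forall>j. \<forall>\<^sub>F n in sequentially. ?s n \<le> (\<integral>x. f x \<partial>M) + 2 * e j"
      and 2: "\<forall>j. \<forall>\<^sub>F n in sequentially. (\<Sum>k<n. - f ((T ^^ k) x)) / real n \<le> (\<integral>x. - f x \<partial>M) + 2 * e j"
    show "?s \<longlonglongrightarrow> (\<integral>x. f x \<partial>M)"
    proof (rule tendstoI)
      fix d :: real assume "0 < d"
      then obtain j where j: "e j < d / 2" using reals_Archimedean[of "d/2"] unfolding e_def by auto
      from 1[rule_format, of j] 2[rule_format, of j]
      show "\<forall>\<^sub>F n in sequentially. dist (?s n) (\<integral>x. f x \<partial>M) < d"
        by eventually_elim (use j in \<open>auto simp: dist_real_def sum_negf abs_less_iff\<close>)
    qed
  qed
qed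

end

section \<open>The central limit theorem for bounded mixing functionals\<close>

text \<open>The two expressions agree up to second order in \<open>x\<close>. The Taylor remainder
  of \<open>iexp\<close> contributes \<open>1/6\<close>; the cross term \<open>\<i> x y\<close> and
  the replacement of \<open>1 - y\<close> by \<open>exp (- y)\<close> contribute
  \<open>3/4\<close>.\<close>

lemma norm_iexp_minus_factor_le:
  fixes x :: real
  assumes x: "\<bar>x\<bar> \<le> 1"
  shows "norm (iexp x - (1 + \<i> * x) * exp (- (x\<^sup>2 / 2))) \<le> \<bar>x\<bar> ^ 3"
proof -
  define y where "y = x\<^sup>2 / 2"
  have y: "0 \<le> y" by (simp add: y_def)
  have e1: "1 - y \<le> exp (- y)" using exp_ge_add_one_self[of "- y"] by simp
  \<comment> \<open>The upper Taylor bound for \<open>exp (- y)\<close> follows from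
    \<open>(1 - y + y^2/2) (1 + y + y^2/2) = 1 + y^4/4 >= 1\<close>, because the second factor is at
    most \<open>exp y\<close>.\<close>
  have "exp (- y) * (1 + y + y\<^sup>2 / 2) \<le> exp (- y) * exp y"
    by (intro mult_left_mono exp_lower_Taylor_quadratic y) simp
  also have "\<dots> = 1" by (simp add: exp_minus)
  also have "1 \<le> 1 + y ^ 4 / 4" by simp
  also have "\<dots> = (1 - y + y\<^sup>2 / 2) * (1 + y + y\<^sup>2 / 2)"
    by (simp add: field_simps power2_eq_square power4_eq_xxxx)
  finally have e2: "exp (- y) \<le> 1 - y + y\<^sup>2 / 2"
    by (rule mult_right_le_imp_le) (simp add: y add_pos_nonneg)
  define r where "r = exp (- y) - (1 - y)"
  have r: "\<bar>r\<bar> \<le> y\<^sup>2 / 2" using e1 e2 by (simp add: r_def)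
  have "norm (iexp x - (\<Sum>k\<le>2. (\<i> * x) ^ k / fact k)) \<le> \<bar>x\<bar> ^ 3 / fact 3"
    using iexp_approx1[of x 2] by (simp add: eval_nat_numeral)
  also have "(\<Sum>k\<le>2. (\<i> * x) ^ k / fact k) = 1 + \<i> * x - y"
  proof -
    have "\<i> * complex_of_real x * (\<i> * complex_of_real x) = - (complex_of_real x * complex_of_real x)"
      by (simp add: complex_eq_iff)
    then show ?thesis by (simp add: y_def numeral_2_eq_2)
  qed
  finally have 1: "norm (iexp x - (1 + \<i> * x - y)) \<le> \<bar>x\<bar> ^ 3 / 6"
    by (simp add: fact_numeral)
  have "norm ((1 + \<i> * x - y) - (1 + \<i> * x) * exp (- y)) = norm (\<i> * x * y - (1 + \<i> * x) * r)"
    by (rule arg_cong[where f=norm]) (simp add: r_def algebra_simps)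
  also have "\<dots> \<le> norm (\<i> * x * y) + norm (1 + \<i> * x) * norm (complex_of_real r)"
    by (metis norm_triangle_ineq4 norm_mult)
  also have "\<dots> \<le> \<bar>x\<bar> * y + (1 + \<bar>x\<bar>) * (y\<^sup>2 / 2)"
    using r y by (intro add_mono mult_mono) (auto simp: norm_mult intro: order_trans[OF norm_triangle_ineq])
  also have "\<dots> = \<bar>x\<bar> ^ 3 / 2 + (1 + \<bar>x\<bar>) * (\<bar>x\<bar> ^ 3 * \<bar>x\<bar> / 8)"
  proof -
    have "x\<^sup>2 = \<bar>x\<bar> * \<bar>x\<bar>" by (simp add: power2_eq_square)
    then show ?thesis by (simp add: y_def power2_eq_square power3_eq_cube)
  qed
  also have "\<dots> \<le> \<bar>x\<bar> ^ 3 / 2 + 2 * (\<bar>x\<bar> ^ 3 * 1 / 8)"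
    using x by (intro add_mono mult_mono divide_right_mono) auto
  finally have 2: "norm ((1 + \<i> * x - y) - (1 + \<i> * x) * exp (- y)) \<le> \<bar>x\<bar> ^ 3 * (3 / 4)" by simp
  have "norm (iexp x - (1 + \<i> * x) * exp (- y)) \<le> \<bar>x\<bar> ^ 3 / 6 + \<bar>x\<bar> ^ 3 * (3 / 4)"
    by (rule norm_diff_triangle_le[OF 1 2])
  also have "\<dots> \<le> \<bar>x\<bar> ^ 3" by simp
  finally show ?thesis by (simp add: y_def exp_of_real)
qed

text \<open>It serves twice: for bounding the McLeish products, and for seeing that
  \<open>(1 + \<i> x) exp (- x^2 / 2)\<close> has modulus at most one.\<close>

lemma norm_factor_le:
  fixes x :: real
  shows "norm (1 + \<i> * x) \<le> exp (x\<^sup>2 / 2)"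
proof (rule power2_le_imp_le)
  have "(norm (1 + \<i> * x))\<^sup>2 = 1 + x\<^sup>2" by (simp add: cmod_power2)
  also have "\<dots> \<le> exp (x\<^sup>2)" by (rule exp_ge_add_one_self)
  also have "\<dots> = (exp (x\<^sup>2 / 2))\<^sup>2" by (simp add: exp_double[symmetric])
  finally show "(norm (1 + \<i> * x))\<^sup>2 \<le> (exp (x\<^sup>2 / 2))\<^sup>2" .
qed simp

text \<open>\<open>F0\<close> is the past. Measurability of the backward shift for \<open>F0\<close>
  expresses that \<open>F0\<close> is contained in its preimage under \<open>T\<close>; it makes
  earlier values of an \<open>F0\<close>-measurable process \<open>F0\<close>-measurable.\<close>

locale filtered_automorphism = ergodic_automorphism +
  fixes F0 :: "'a measure"
  assumes subalg: "subalgebra M F0" and S_F0 [measurable]: "S \<in> measurable F0 F0"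
begin

lemma F0_meas [measurable (raw)]: "f \<in> measurable F0 N \<Longrightarrow> f \<in> measurable M N"
  by (rule measurable_from_subalg[OF subalg])

lemma space_F0: "space F0 = space M"
  using subalg by (simp add: subalgebra_def)

lemma funpow_S_F0: "S ^^ k \<in> measurable F0 F0"
  by (induction k) (auto intro: measurable_comp S_F0)

sublocale finite_measure_subalgebra M F0
  by standard (rule subalg)

text \<open>McLeish's argument: \<open>\<Prod>(1 + i a D\<^sub>k)\<close> has expectation \<open>1\<close>, and multiplying it by
  \<open>exp (- a\<^sup>2 \<Sum> D\<^sub>k\<^sup>2 / 2)\<close>, which is nearly constant by the ergodic theorem, nearly gives
  \<open>exp (i a \<Sum> D\<^sub>k)\<close>.\<close>

context
  fixes D :: "'a \<Rightarrow> real" and B :: real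
  assumes D_meas [measurable]: "D \<in> borel_measurable M"
    and D_bound: "\<And>x. \<bar>D x\<bar> \<le> B"
    and D_S [measurable]: "(\<lambda>x. D (S x)) \<in> borel_measurable F0"
    and D_orth: "\<And>\<xi> C. \<xi> \<in> borel_measurable F0 \<Longrightarrow> (\<And>x. \<bar>\<xi> x\<bar> \<le> C) \<Longrightarrow> (\<integral>x. \<xi> x * D x \<partial>M) = 0"
begin

lemma B_nonneg: "0 \<le> B" using D_bound[of undefined] by linarith

lemma D_orth_complex:
  fixes \<xi> :: "'a \<Rightarrow> complex"
  assumes \<xi> [measurable]: "\<xi> \<in> borel_measurable F0" and C: "\<And>x. norm (\<xi> x) \<le> C"
  shows "(\<integral>x. \<xi> x * D x \<partial>M) = 0"
proof -
  have C0: "0 \<le> C" using C[of undefined] norm_ge_zero order_trans by blast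
  have "Re (\<integral>x. \<xi> x * D x \<partial>M) = (\<integral>x. Re (\<xi> x) * D x \<partial>M)" "Im (\<integral>x. \<xi> x * D x \<partial>M) = (\<integral>x. Im (\<xi> x) * D x \<partial>M)"
    by (subst integral_Re[symmetric] integral_Im[symmetric],
        auto intro!: integrable_bounded[where B="C * B"] mult_mono C C0 D_bound simp: norm_mult)+
  moreover have "(\<integral>x. Re (\<xi> x) * D x \<partial>M) = 0" "(\<integral>x. Im (\<xi> x) * D x \<partial>M) = 0"
    using C abs_Re_le_cmod abs_Im_le_cmod order_trans by (intro D_orth; fastforce)+
  ultimately show ?thesis by (simp add: complex_eq_iff)
qed

definition mcleish_prod :: "real \<Rightarrow> nat \<Rightarrow> 'a \<Rightarrow> complex" where
  "mcleish_prod a n x = (\<Prod>k<n. 1 + \<i> * (a * D ((T ^^ k) x)))"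

lemma mcleish_prod_meas [measurable]: "mcleish_prod a n \<in> borel_measurable M"
  unfolding mcleish_prod_def[abs_def] by measurable

lemma norm_pr_le: "norm (mcleish_prod a n x) \<le> exp (real n * (a * B)\<^sup>2 / 2)"
proof -
  have "norm (mcleish_prod a n x) \<le> (\<Prod>k<n. exp ((a * B)\<^sup>2 / 2))"
    unfolding mcleish_prod_def prod_norm[symmetric]
  proof (intro prod_mono conjI norm_ge_zero)
    fix k
    have "norm (1 + \<i> * (a * D ((T ^^ k) x))) \<le> exp ((a * D ((T ^^ k) x))\<^sup>2 / 2)"
      using norm_factor_le[of "a * D ((T ^^ k) x)"] by simp
    also have "\<dots> \<le> exp ((a * B)\<^sup>2 / 2)"
      using power_mono[OF D_bound, of "(T ^^ k) x" 2] by (auto simp: power_mult_distrib mult_left_mono)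
    finally show "norm (1 + \<i> * (a * D ((T ^^ k) x))) \<le> exp ((a * B)\<^sup>2 / 2)" .
  qed
  then show ?thesis by (simp add: exp_of_nat_mult[symmetric])
qed

text \<open>Shifted back by \<open>S ^^ n\<close>, the first \<open>n\<close> factors involve
  \<open>D\<close> at strictly negative times only and are \<open>F0\<close>-measurable, while the
  new factor involves \<open>D\<close>, which is orthogonal to them. The variables
  \<open>D \<circ> T^k\<close> thus behave as bounded martingale differences.\<close>

lemma integral_pr: "(\<integral>x. mcleish_prod a n x \<partial>M) = 1"
proof (induction n)
  case 0
  then show ?case by (simp add: mcleish_prod_def prob_space)
next
  case (Suc n)
  have i: "integrable M (mcleish_prod a n)"
    by (rule integrable_bounded[OF _ norm_pr_le]) simp
  have i2: "integrable M (\<lambda>x. mcleish_prod a n x * D ((T ^^ n) x))"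
    by (rule integrable_bounded[where B="exp (real n * (a * B)\<^sup>2 / 2) * B"])
       (auto simp: norm_mult intro!: mult_mono norm_pr_le D_bound)
  have "(\<integral>x. mcleish_prod a n x * D ((T ^^ n) x) \<partial>M) = (\<integral>x. mcleish_prod a n ((S ^^ n) x) * D x \<partial>M)"
    by (rule integral_mult_funpow_T[where f="mcleish_prod a n" and g="\<lambda>x. complex_of_real (D x)"]) measurable
  also have "\<dots> = 0"
  proof (rule D_orth_complex)
    have "(\<lambda>x. mcleish_prod a n ((S ^^ n) x)) \<in> borel_measurable F0 \<longleftrightarrow>
      (\<lambda>x. \<Prod>k<n. 1 + \<i> * (a * D (S ((S ^^ (n - Suc k)) x)))) \<in> borel_measurable F0"
      unfolding mcleish_prod_def
    proof (rule measurable_cong, intro prod.cong refl)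
      fix x k assume "x \<in> space F0" "k \<in> {..<n}"
      \<comment> \<open>Since \<open>k < n\<close>, at least one backward step remains, and
        \<open>D_S\<close> asks for exactly one.\<close>
      then have "(T ^^ k) ((S ^^ n) x) = S ((S ^^ (n - Suc k)) x)"
        using funpow_T_S[of x k "Suc (n - Suc k)"] by (simp add: space_F0)
      then show "1 + \<i> * (a * D ((T ^^ k) ((S ^^ n) x))) = 1 + \<i> * (a * D (S ((S ^^ (n - Suc k)) x)))" by simp
    qed
    also have "\<dots>"
      using measurable_compose[OF funpow_S_F0 D_S] by measurable
    finally show "(\<lambda>x. mcleish_prod a n ((S ^^ n) x)) \<in> borel_measurable F0" .
  qed (rule norm_pr_le)
  finally have "(\<integral>x. mcleish_prod a n x * D ((T ^^ n) x) \<partial>M) = 0" .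
  moreover have "mcleish_prod a (Suc n) x = mcleish_prod a n x + \<i> * a * (mcleish_prod a n x * D ((T ^^ n) x))" for x
    by (simp add: mcleish_prod_def algebra_simps)
  ultimately show ?case using Suc i i2 by simp
qed

lemma martingale_clt:
  "(\<lambda>n. \<integral>x. iexp (u / sqrt (real n) * (\<Sum>k<n. D ((T ^^ k) x))) \<partial>M) \<longlonglongrightarrow> exp (- (u\<^sup>2 * (\<integral>x. (D x)\<^sup>2 \<partial>M) / 2))"
proof -
  define c where "c = exp (- (u\<^sup>2 * (\<integral>x. (D x)\<^sup>2 \<partial>M) / 2))"
  define a where "a n = u / sqrt (real n)" for n :: nat
  define g where "g n x = exp (- (\<Sum>k<n. (a n * D ((T ^^ k) x))\<^sup>2 / 2))" for n x
  have [measurable]: "g n \<in> borel_measurable M" for n unfolding g_def[abs_def] by measurable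
  have a2: "real n * (a n)\<^sup>2 \<le> u\<^sup>2" for n
    by (cases "n = 0") (auto simp: a_def power_divide)
  have mcleish_prod_bd: "norm (mcleish_prod (a n) n x) \<le> exp (u\<^sup>2 * B\<^sup>2 / 2)" for n x
  proof -
    have "real n * (a n * B)\<^sup>2 / 2 \<le> u\<^sup>2 * B\<^sup>2 / 2"
      using mult_right_mono[OF a2[of n], of "B\<^sup>2"] by (simp add: power_mult_distrib algebra_simps)
    then show ?thesis using norm_pr_le[of "a n" n x] by (meson exp_le_cancel_iff order_trans)
  qed
  have g01: "0 \<le> g n x" "g n x \<le> 1" for n x
    by (auto simp: g_def intro!: sum_nonneg)
  \<comment> \<open>The products are uniformly bounded and the weight \<open>g n\<close> converges
    almost everywhere by the ergodic theorem for the square of \<open>D\<close>, so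
    \<open>g n\<close> may be exchanged for its limit \<open>c\<close>.\<close>
  have "(\<lambda>n. \<integral>x. mcleish_prod (a n) n x * (g n x - c) \<partial>M) \<longlonglongrightarrow> (\<integral>x. 0 \<partial>M)"
  proof (rule integral_dominated_convergence[where w="\<lambda>_. exp (u\<^sup>2 * B\<^sup>2 / 2) * 1"])
    have "AE x in M. (\<lambda>n. (\<Sum>k<n. (D ((T ^^ k) x))\<^sup>2) / real n) \<longlonglongrightarrow> (\<integral>x. (D x)\<^sup>2 \<partial>M)"
      using power_mono[OF D_bound, of _ 2] by (intro AE_birkhoff_means_tendsto[where B="B\<^sup>2"]) auto
    then show "AE x in M. (\<lambda>n. mcleish_prod (a n) n x * (g n x - c)) \<longlonglongrightarrow> 0"
    proof eventually_elim
      fix x assume lim: "(\<lambda>n. (\<Sum>k<n. (D ((T ^^ k) x))\<^sup>2) / real n) \<longlonglongrightarrow> (\<integral>x. (D x)\<^sup>2 \<partial>M)"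
      have "g n x = exp (- (u\<^sup>2 * ((\<Sum>k<n. (D ((T ^^ k) x))\<^sup>2) / real n) / 2))" for n
        by (auto simp: g_def a_def power_mult_distrib power_divide sum_distrib_left sum_divide_distrib field_simps intro!: sum.cong)
      then have "(\<lambda>n. g n x) \<longlonglongrightarrow> c"
        unfolding c_def by (simp only:) (intro tendsto_intros lim, simp)
      then have "(\<lambda>n. exp (u\<^sup>2 * B\<^sup>2 / 2) * \<bar>g n x - c\<bar>) \<longlonglongrightarrow> exp (u\<^sup>2 * B\<^sup>2 / 2) * \<bar>c - c\<bar>"
        by (intro tendsto_intros)
      then have "(\<lambda>n. exp (u\<^sup>2 * B\<^sup>2 / 2) * \<bar>g n x - c\<bar>) \<longlonglongrightarrow> 0" by simp
      moreover have "\<forall>n. norm (mcleish_prod (a n) n x * (g n x - c)) \<le> exp (u\<^sup>2 * B\<^sup>2 / 2) * \<bar>g n x - c\<bar>"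
        unfolding norm_mult by (intro allI mult_mono mcleish_prod_bd) (auto simp flip: of_real_diff)
      ultimately show "(\<lambda>n. mcleish_prod (a n) n x * (g n x - c)) \<longlonglongrightarrow> 0"
        by (rule Lim_null_comparison[OF always_eventually, rotated])
    qed
    have c01: "0 \<le> c" "c \<le> 1" unfolding c_def by (auto intro!: mult_nonneg_nonneg)
    have "\<bar>g n x - c\<bar> \<le> 1" for n x using g01[of n x] c01 by linarith
    then have "norm (mcleish_prod (a n) n x * (complex_of_real (g n x) - c)) \<le> exp (u\<^sup>2 * B\<^sup>2 / 2) * 1" for n x
      unfolding norm_mult by (intro mult_mono mcleish_prod_bd) (auto simp flip: of_real_diff)
    then show "AE x in M. norm (mcleish_prod (a n) n x * (g n x - c)) \<le> exp (u\<^sup>2 * B\<^sup>2 / 2) * 1" for n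
      by (intro AE_I2) auto
  qed auto
  then have 1: "(\<lambda>n. \<integral>x. mcleish_prod (a n) n x * (g n x - c) \<partial>M) \<longlonglongrightarrow> 0" by simp
  have a0: "a \<longlonglongrightarrow> 0"
    unfolding a_def by (intro tendsto_divide_0[OF tendsto_const] filterlim_at_top_imp_at_infinity
        filterlim_compose[OF sqrt_at_top] filterlim_real_sequentially)
  have "\<forall>\<^sub>F n in sequentially. \<bar>a n * B\<bar> \<le> 1"
  proof -
    have "(\<lambda>n. \<bar>a n * B\<bar>) \<longlonglongrightarrow> \<bar>0 * B\<bar>" by (intro tendsto_intros a0)
    then have "\<forall>\<^sub>F n in sequentially. \<bar>a n * B\<bar> < 1" by (rule order_tendstoD) simp
    then show ?thesis by eventually_elim simp
  qed
  \<comment> \<open>Errors of size \<open>|a n B|^3\<close> from \<open>n\<close> factors add up to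
    order \<open>|a n|\<close>, because \<open>n (a n)^2 <= u^2\<close>.\<close>
  then have 2: "\<forall>\<^sub>F n in sequentially. norm ((\<integral>x. iexp (a n * (\<Sum>k<n. D ((T ^^ k) x))) \<partial>M) - (\<integral>x. mcleish_prod (a n) n x * g n x \<partial>M)) \<le> u\<^sup>2 * B ^ 3 * \<bar>a n\<bar>"
  proof eventually_elim
    fix n assume n: "\<bar>a n * B\<bar> \<le> 1"
    have pw: "norm (iexp (a n * (\<Sum>k<n. D ((T ^^ k) x))) - mcleish_prod (a n) n x * g n x) \<le> u\<^sup>2 * B ^ 3 * \<bar>a n\<bar>" for x
    proof -
      define z where "z k = a n * D ((T ^^ k) x)" for k
      have zB: "\<bar>z k\<bar> \<le> \<bar>a n * B\<bar>" for k
        using D_bound[of "(T ^^ k) x"] B_nonneg by (simp add: z_def abs_mult mult_left_mono)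
      have e: "iexp (a n * (\<Sum>k<n. D ((T ^^ k) x))) = (\<Prod>k<n. iexp (z k))"
        by (simp add: z_def sum_distrib_left exp_sum[symmetric])
      have p: "mcleish_prod (a n) n x * g n x = (\<Prod>k<n. (1 + \<i> * z k) * exp (- ((z k)\<^sup>2 / 2)))"
        by (simp add: mcleish_prod_def g_def z_def prod.distrib exp_sum sum_negf[symmetric])
      \<comment> \<open>Products of factors of modulus at most one differ by at most the sum of the
        differences of the factors. For this reason each linear factor is paired with its share of
        the Gaussian weight.\<close>
      have "norm ((\<Prod>k<n. iexp (z k)) - (\<Prod>k<n. (1 + \<i> * z k) * exp (- ((z k)\<^sup>2 / 2))))
        \<le> (\<Sum>k<n. norm (iexp (z k) - (1 + \<i> * z k) * exp (- ((z k)\<^sup>2 / 2))))"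
      proof (rule norm_prod_diff)
        fix k
        show "norm ((1 + \<i> * complex_of_real (z k)) * complex_of_real (exp (- ((z k)\<^sup>2 / 2)))) \<le> 1"
          using mult_right_mono[OF norm_factor_le[of "z k"], of "exp (- ((z k)\<^sup>2 / 2))"]
          by (simp add: norm_mult mult_exp_exp)
      qed simp
      also have "\<dots> \<le> (\<Sum>k<n. \<bar>a n * B\<bar> ^ 3)"
        using zB n by (intro sum_mono order_trans[OF norm_iexp_minus_factor_le] power_mono) (auto intro: order_trans)
      also have "\<dots> = (real n * (a n)\<^sup>2) * (B ^ 3 * \<bar>a n\<bar>)"
        using B_nonneg by (simp add: abs_mult power_mult_distrib power3_eq_cube power2_eq_square)
      also have "\<dots> \<le> u\<^sup>2 * (B ^ 3 * \<bar>a n\<bar>)"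
        using B_nonneg by (intro mult_right_mono a2) auto
      finally show ?thesis by (simp only: e p mult.assoc)
    qed
    have i: "integrable M (\<lambda>x. iexp (a n * (\<Sum>k<n. D ((T ^^ k) x))))"
      by (rule integrable_bounded[where B=1]) auto
    have j: "integrable M (\<lambda>x. mcleish_prod (a n) n x * g n x)"
      by (rule integrable_bounded[where B="exp (u\<^sup>2 * B\<^sup>2 / 2) * 1"])
         (use g01 in \<open>auto simp: norm_mult intro!: mult_mono mcleish_prod_bd simp del: mult_1_right\<close>)
    have "norm (\<integral>x. iexp (a n * (\<Sum>k<n. D ((T ^^ k) x))) - mcleish_prod (a n) n x * g n x \<partial>M) \<le> (\<integral>x. u\<^sup>2 * B ^ 3 * \<bar>a n\<bar> \<partial>M)"
      by (rule norm_integral_le_integral) (use i j pw in auto)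
    then show "norm ((\<integral>x. iexp (a n * (\<Sum>k<n. D ((T ^^ k) x))) \<partial>M) - (\<integral>x. mcleish_prod (a n) n x * g n x \<partial>M)) \<le> u\<^sup>2 * B ^ 3 * \<bar>a n\<bar>"
      using i j by (simp add: prob_space)
  qed
  have "(\<lambda>n. u\<^sup>2 * B ^ 3 * \<bar>a n\<bar>) \<longlonglongrightarrow> 0"
    using tendsto_mult_right_zero[OF tendsto_rabs_zero[OF a0]] .
  then have 3: "(\<lambda>n. (\<integral>x. iexp (a n * (\<Sum>k<n. D ((T ^^ k) x))) \<partial>M) - (\<integral>x. mcleish_prod (a n) n x * g n x \<partial>M)) \<longlonglongrightarrow> 0"
    by (rule Lim_null_comparison[OF 2])
  \<comment> \<open>The product has mean one, so the constant part of the weight contributes exactly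
    \<open>c\<close>.\<close>
  have "(\<integral>x. mcleish_prod (a n) n x * g n x \<partial>M) = (\<integral>x. mcleish_prod (a n) n x * (g n x - c) \<partial>M) + c" for n
  proof -
    have i: "integrable M (\<lambda>x. mcleish_prod (a n) n x)"
      by (rule integrable_bounded[OF _ mcleish_prod_bd]) simp
    have j: "integrable M (\<lambda>x. mcleish_prod (a n) n x * g n x)"
      by (rule integrable_bounded[where B="exp (u\<^sup>2 * B\<^sup>2 / 2) * 1"])
         (use g01 in \<open>auto simp: norm_mult intro!: mult_mono mcleish_prod_bd simp del: mult_1_right\<close>)
    show ?thesis using i j by (simp add: right_diff_distrib integral_pr)
  qed
  with tendsto_add[OF tendsto_add[OF 3 1] tendsto_const[of "complex_of_real c"]] show ?thesis
    by (simp add: a_def c_def)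
qed

end

end

section \<open>From martingale differences to mixing functionals\<close>

context filtered_automorphism
begin

text \<open>The conditional expectation is clipped to \<open>[- B, B]\<close>. This changes it on a
  null set only and turns the almost sure bound into one at every point, the form in which test
  functions are bounded here.\<close>

lemma bounded_cond_exp:
  fixes f :: "'a \<Rightarrow> real"
  assumes [measurable]: "f \<in> borel_measurable M" and B: "\<And>x. \<bar>f x\<bar> \<le> B"
  obtains e where "e \<in> borel_measurable F0" "\<And>x. \<bar>e x\<bar> \<le> B"
    "\<And>\<xi> C. \<xi> \<in> borel_measurable F0 \<Longrightarrow> (\<And>x. \<bar>\<xi> x\<bar> \<le> C) \<Longrightarrow> (\<integral>x. \<xi> x * e x \<partial>M) = (\<integral>x. \<xi> x * f x \<partial>M)"
proof
  define e where "e x = max (- B) (min B (real_cond_exp M F0 f x))" for x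
  have B0: "0 \<le> B" using B[of undefined] by linarith
  have f: "integrable M f" by (rule integrable_bounded[where B=B]) (auto intro: B)
  show [measurable]: "e \<in> borel_measurable F0" unfolding e_def[abs_def] by measurable
  show "\<bar>e x\<bar> \<le> B" for x unfolding e_def using B0 by (auto simp: max_def min_def)
  have "AE x in M. real_cond_exp M F0 f x \<le> B"
    by (rule real_cond_exp_le_c[OF f]) (use B in \<open>auto simp: abs_le_iff\<close>)
  moreover have "AE x in M. real_cond_exp M F0 f x \<ge> - B"
  proof (rule real_cond_exp_ge_c[OF f])
    show "AE x in M. - B \<le> f x" using B by (intro AE_I2) (smt (verit))
  qed
  ultimately have ae: "AE x in M. e x = real_cond_exp M F0 f x"
    by eventually_elim (auto simp: e_def)
  fix \<xi> :: "'a \<Rightarrow> real" and C assume [measurable]: "\<xi> \<in> borel_measurable F0" and C: "\<And>x. \<bar>\<xi> x\<bar> \<le> C"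
  have C0: "0 \<le> C" using C[of undefined] by linarith
  have "(\<integral>x. \<xi> x * e x \<partial>M) = (\<integral>x. \<xi> x * real_cond_exp M F0 f x \<partial>M)"
    using ae by (intro integral_cong_AE) auto
  also have "\<dots> = (\<integral>x. \<xi> x * f x \<partial>M)"
  proof (rule real_cond_exp_intg(2))
    show "integrable M (\<lambda>x. \<xi> x * f x)"
      by (rule integrable_bounded[where B="C * B"]) (auto simp: abs_mult intro!: mult_mono B C C0)
  qed auto
  finally show "(\<integral>x. \<xi> x * e x \<partial>M) = (\<integral>x. \<xi> x * f x \<partial>M)" .
qed

text \<open>Gordin's decomposition with finite horizon \<open>m\<close>: up to the coboundary of \<open>Z\<close> and a remainder \<open>R\<close>
  of small variance, \<open>Y\<close> is a martingale difference \<open>D\<close>.\<close>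

lemma gordin_decomposition:
  fixes Y :: "'a \<Rightarrow> real"
  assumes Y [measurable]: "Y \<in> borel_measurable F0" and B: "\<And>x. \<bar>Y x\<bar> \<le> B"
    and mix: "\<And>\<xi> C k. \<xi> \<in> borel_measurable F0 \<Longrightarrow> (\<And>x. \<bar>\<xi> x\<bar> \<le> C) \<Longrightarrow> \<bar>\<integral>x. \<xi> x * Y ((T ^^ k) x) \<partial>M\<bar> \<le> C * b k"
  obtains Z R D where
    "Z \<in> borel_measurable M" "R \<in> borel_measurable M" "D \<in> borel_measurable M"
    "\<And>x. Y x = D x + Z x - Z (T x) + R x"
    "\<And>x. \<bar>Z x\<bar> \<le> real m * B" "\<And>x. \<bar>R x\<bar> \<le> B" "\<And>x. \<bar>D x\<bar> \<le> 2 * (real m + 1) * B"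
    "(\<lambda>x. D (S x)) \<in> borel_measurable F0"
    "\<And>\<xi> C. \<xi> \<in> borel_measurable F0 \<Longrightarrow> (\<And>x. \<bar>\<xi> x\<bar> \<le> C) \<Longrightarrow> (\<integral>x. \<xi> x * D x \<partial>M) = 0"
    "\<And>k. \<bar>\<integral>x. R x * R ((T ^^ k) x) \<partial>M\<bar> \<le> B * b (k + m)"
proof -
  define P where "P k e \<longleftrightarrow> e \<in> borel_measurable F0 \<and> (\<forall>x. \<bar>e x\<bar> \<le> B) \<and>
    (\<forall>\<xi> C. \<xi> \<in> borel_measurable F0 \<longrightarrow> (\<forall>x. \<bar>\<xi> x\<bar> \<le> C) \<longrightarrow> (\<integral>x. \<xi> x * e x \<partial>M) = (\<integral>x. \<xi> x * Y ((T ^^ k) x) \<partial>M))" for k e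
  have "\<exists>e. P k e" for k
  proof -
    have "(\<lambda>x. Y ((T ^^ k) x)) \<in> borel_measurable M"
      by (rule measurable_compose[OF funpow_T_meas F0_meas[OF Y]])
    then show ?thesis
    proof (rule bounded_cond_exp[OF _ B])
      fix e assume "e \<in> borel_measurable F0" "\<And>x. \<bar>e x\<bar> \<le> B"
        "\<And>\<xi> C. \<xi> \<in> borel_measurable F0 \<Longrightarrow> (\<And>x. \<bar>\<xi> x\<bar> \<le> C) \<Longrightarrow> (\<integral>x. \<xi> x * e x \<partial>M) = (\<integral>x. \<xi> x * Y ((T ^^ k) x) \<partial>M)"
      then have "P k e" unfolding P_def by blast
      then show "\<exists>e. P k e" by blast
    qed
  qed
  then obtain e' where e': "P k (e' k)" for k by metis
  \<comment> \<open>At horizon \<open>0\<close> the version \<open>Y\<close> itself is chosen, so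
    that the telescoping identity holds at every point and not just almost everywhere.\<close>
  define e where "e k = (if k = 0 then Y else e' k)" for k
  have "P 0 Y" using B by (simp add: P_def)
  with e' have Pe: "P k (e k)" for k by (simp add: e_def)
  then have e_meas [measurable]: "e k \<in> borel_measurable F0" and e_bd: "\<bar>e k x\<bar> \<le> B"
    and e_int: "\<xi> \<in> borel_measurable F0 \<Longrightarrow> (\<And>x. \<bar>\<xi> x\<bar> \<le> C) \<Longrightarrow> (\<integral>x. \<xi> x * e k x \<partial>M) = (\<integral>x. \<xi> x * Y ((T ^^ k) x) \<partial>M)" for k x \<xi> C
    unfolding P_def by blast+
  have e0: "e 0 = Y" by (simp add: e_def)
  define Z where "Z x = (\<Sum>j<m. e j x)" for x
  define R where "R = e m"
  define D where "D x = Z (T x) - Z x + Y x - R x" for x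
  have ZF0 [measurable]: "Z \<in> borel_measurable F0" and RF0 [measurable]: "R \<in> borel_measurable F0"
    unfolding Z_def[abs_def] R_def by measurable
  have Zb: "\<bar>Z x\<bar> \<le> real m * B" for x
    unfolding Z_def using sum_mono[of "{..<m}" "\<lambda>j. \<bar>e j x\<bar>" "\<lambda>_. B"] e_bd by (intro order_trans[OF sum_abs]) simp
  have Rb: "\<bar>R x\<bar> \<le> B" for x by (simp add: R_def e_bd)
  \<comment> \<open>Here \<open>D\<close> is a sum of differences of \<open>e j \<circ> T\<close>
    and \<open>e (Suc j)\<close>. The second is a conditional expectation of the first by the tower
    property, which is \<open>eq\<close> below; hence \<open>D\<close> is orthogonal to the
    past.\<close>
  have D_alt: "D x = (\<Sum>j<m. e j (T x)) - (\<Sum>j<m. e (Suc j) x)" for x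
    using sum.lessThan_Suc_shift[of "\<lambda>j. e j x" m] by (simp add: D_def Z_def R_def e0)
  have D_meas: "D \<in> borel_measurable M"
    unfolding D_def[abs_def]
    by (intro borel_measurable_add borel_measurable_diff measurable_compose[OF T_meas F0_meas[OF ZF0]] F0_meas ZF0 RF0 Y)
  show thesis
  proof (rule that[of Z R D])
    show "Y x = D x + Z x - Z (T x) + R x" for x by (simp add: D_def)
    show "\<bar>D x\<bar> \<le> 2 * (real m + 1) * B" for x
      using Zb[of x] Zb[of "T x"] Rb[of x] B[of x] by (simp add: D_def algebra_simps)
    show "(\<lambda>x. D (S x)) \<in> borel_measurable F0"
    proof -
      have "(\<lambda>x. Z x - Z (S x) + Y (S x) - R (S x)) \<in> borel_measurable F0" by measurable
      then show ?thesis
        by (rule measurable_cong[THEN iffD1, rotated]) (simp add: D_def space_F0 TS)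
    qed
    show "(\<integral>x. \<xi> x * D x \<partial>M) = 0" if [measurable]: "\<xi> \<in> borel_measurable F0" and C: "\<And>x. \<bar>\<xi> x\<bar> \<le> C" for \<xi> C
    proof -
      have C0: "0 \<le> C" using C[of undefined] by linarith
      have eT: "(\<lambda>x. e j (T x)) \<in> borel_measurable M" for j
        by (rule measurable_compose[OF T_meas F0_meas[OF e_meas]])
      have i: "integrable M (\<lambda>x. \<xi> x * e j (T x))" for j
        by (rule integrable_bounded[where B="C * B"])
           (auto simp: abs_mult intro!: mult_mono C e_bd C0 borel_measurable_times eT)
      have i': "integrable M (\<lambda>x. \<xi> x * e j x)" for j
        by (rule integrable_bounded[where B="C * B"]) (auto simp: abs_mult intro!: mult_mono C e_bd C0)
      have eq: "(\<integral>x. \<xi> x * e j (T x) \<partial>M) = (\<integral>x. \<xi> x * e (Suc j) x \<partial>M)" for j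
      proof -
        have "(\<integral>x. \<xi> x * e j (T x) \<partial>M) = (\<integral>x. \<xi> (S x) * e j x \<partial>M)"
          using integral_mult_funpow_T[of \<xi> "e j" 1] by simp
        also have "\<dots> = (\<integral>x. \<xi> (S x) * Y ((T ^^ j) x) \<partial>M)"
          by (rule e_int[of _ C]) (auto intro: C)
        also have "\<dots> = (\<integral>x. \<xi> x * Y ((T ^^ Suc j) x) \<partial>M)"
          using integral_mult_funpow_T[of \<xi> "\<lambda>x. Y ((T ^^ j) x)" 1] measurable_compose[OF funpow_T_meas F0_meas[OF Y]]
          by (simp add: funpow_swap1)
        also have "\<dots> = (\<integral>x. \<xi> x * e (Suc j) x \<partial>M)"
          by (rule e_int[of _ C, symmetric]) (auto intro: C)
        finally show ?thesis .
      qed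
      have "(\<integral>x. \<xi> x * D x \<partial>M) = (\<integral>x. (\<Sum>j<m. \<xi> x * e j (T x)) - (\<Sum>j<m. \<xi> x * e (Suc j) x) \<partial>M)"
        by (simp add: D_alt right_diff_distrib sum_distrib_left)
      also have "\<dots> = (\<Sum>j<m. \<integral>x. \<xi> x * e j (T x) \<partial>M) - (\<Sum>j<m. \<integral>x. \<xi> x * e (Suc j) x \<partial>M)"
        using i i' by (simp add: Bochner_Integration.integral_sum)
      also have "\<dots> = 0" by (simp add: eq)
      finally show ?thesis .
    qed
    \<comment> \<open>Shifting back puts the second \<open>R\<close> at time \<open>0\<close> and
      the first into the past, where it is a test function; so the second may be replaced by
      \<open>Y \<circ> T^m\<close>. Shifting forward again leaves a mixing bound at distance
      \<open>k + m\<close>.\<close>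
    show "\<bar>\<integral>x. R x * R ((T ^^ k) x) \<partial>M\<bar> \<le> B * b (k + m)" for k
    proof -
      have RS: "(\<lambda>x. R ((S ^^ k) x)) \<in> borel_measurable F0"
        by (rule measurable_compose[OF funpow_S_F0 RF0])
      have "(\<integral>x. R x * R ((T ^^ k) x) \<partial>M) = (\<integral>x. R ((S ^^ k) x) * R x \<partial>M)"
        by (rule integral_mult_funpow_T[OF F0_meas[OF RF0] F0_meas[OF RF0]])
      also have "\<dots> = (\<integral>x. R ((S ^^ k) x) * Y ((T ^^ m) x) \<partial>M)"
        using e_int[OF RS Rb, of m] by (simp add: R_def)
      also have "\<dots> = (\<integral>x. R x * Y ((T ^^ m) ((T ^^ k) x)) \<partial>M)"
        by (rule integral_mult_funpow_T[OF F0_meas[OF RF0] measurable_compose[OF funpow_T_meas F0_meas[OF Y]], symmetric])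
      also have "\<dots> = (\<integral>x. R x * Y ((T ^^ (k + m)) x) \<partial>M)"
        by (simp add: funpow_add add.commute[of k m])
      finally show ?thesis using mix[OF RF0 Rb, of "k + m"] by simp
    qed
  qed (use Zb Rb D_meas in auto)
qed

text \<open>For each horizon \<open>m\<close> the partial sums of \<open>Y\<close> and of
  \<open>D\<close> differ by a coboundary, negligible for large \<open>n\<close>, and by sums of
  \<open>R\<close>, whose variance per step is controlled by the tail \<open>t m\<close>. So
  \<open>n\<close> tends to infinity first and \<open>m\<close> afterwards.\<close>

lemma bounded_clt:
  fixes Y :: "'a \<Rightarrow> real" and u :: real
  assumes Y: "Y \<in> borel_measurable F0" and B: "\<And>x. \<bar>Y x\<bar> \<le> B"
    and mix: "\<And>\<xi> C k. \<xi> \<in> borel_measurable F0 \<Longrightarrow> (\<And>x. \<bar>\<xi> x\<bar> \<le> C) \<Longrightarrow> \<bar>\<integral>x. \<xi> x * Y ((T ^^ k) x) \<partial>M\<bar> \<le> C * b k"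
    and b: "summable b"
  defines "c \<equiv> \<lambda>k. \<integral>x. Y x * Y ((T ^^ k) x) \<partial>M"
  shows "(\<lambda>n. \<integral>x. iexp (u / sqrt (real n) * (\<Sum>k<n. Y ((T ^^ k) x))) \<partial>M)
     \<longlonglongrightarrow> exp (- (u\<^sup>2 * (c 0 + 2 * (\<Sum>k. c (Suc k))) / 2))"
proof -
  have [measurable]: "Y \<in> borel_measurable M" using Y by (rule F0_meas)
  define \<sigma>2 where "\<sigma>2 = c 0 + 2 * (\<Sum>k. c (Suc k))"
  have b0: "0 \<le> b k" for k using mix[of "\<lambda>_. 1" 1 k] by simp
  have cb: "\<bar>c k\<bar> \<le> B * b k" for k unfolding c_def using mix[OF Y B, of k] by simp
  have "summable (\<lambda>k. c (Suc k))"
    by (rule summable_comparison_test'[where g="\<lambda>k. B * b (Suc k)"])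
       (use cb b in \<open>auto simp: summable_Suc_iff intro!: summable_mult\<close>)
  then have s_lim: "(\<lambda>n. (\<integral>x. (\<Sum>k<n. Y ((T ^^ k) x))\<^sup>2 \<partial>M) / real n) \<longlonglongrightarrow> \<sigma>2"
    unfolding \<sigma>2_def c_def by (intro integral_sum_funpow_sq_tendsto[OF _ B]) auto
  define t where "t m = (\<Sum>k. b (k + m))" for m
  have t_lim: "t \<longlonglongrightarrow> 0"
    unfolding t_def by (rule suminf_exist_split2[OF b])
  define \<phi> where "\<phi> n = (\<integral>x. iexp (u / sqrt (real n) * (\<Sum>k<n. Y ((T ^^ k) x))) \<partial>M)" for n :: nat
  \<comment> \<open>Mean square error per step: the coboundary is at most \<open>2 m B\<close>, the
    sums of \<open>R\<close> have second moment at most \<open>2 n B t m\<close>, and squaring a sum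
    of two terms doubles both squares.\<close>
  define q where "q m n = 8 * (real m * B)\<^sup>2 / real n + 4 * B * t m" for m n
  have q_lim: "q m \<longlonglongrightarrow> 4 * B * t m" for m
  proof -
    have "(\<lambda>n. 8 * (real m * B)\<^sup>2 / real n + 4 * B * t m) \<longlonglongrightarrow> 0 + 4 * B * t m"
      by (intro tendsto_intros tendsto_divide_0[OF tendsto_const] filterlim_at_top_imp_at_infinity filterlim_real_sequentially)
    then show ?thesis unfolding q_def by simp
  qed
  \<comment> \<open>The variance \<open>v\<close> of \<open>D\<close> depends on \<open>m\<close>.
    It is compared with \<open>\<sigma>2\<close> through a free weight \<open>\<eta>\<close>, which
    is fixed before the tail \<open>t m\<close> is made small.\<close>
  have step: "\<exists>v\<ge>0. (\<forall>\<eta>>0. \<sigma>2 \<le> (1 + \<eta>) * v + (1 + 1 / \<eta>) * (4 * B * t m) \<and> v \<le> (1 + \<eta>) * \<sigma>2 + (1 + 1 / \<eta>) * (4 * B * t m))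
     \<and> (\<exists>\<psi>. \<psi> \<longlonglongrightarrow> complex_of_real (exp (- (u\<^sup>2 * v / 2))) \<and> (\<forall>n>0. norm (\<phi> n - \<psi> n) \<le> \<bar>u\<bar> * sqrt (q m n)))" for m
  proof -
    obtain Z R D where ZRD [measurable]: "Z \<in> borel_measurable M" "R \<in> borel_measurable M" "D \<in> borel_measurable M"
      and dec: "\<And>x. Y x = D x + Z x - Z (T x) + R x"
      and bd: "\<And>x. \<bar>Z x\<bar> \<le> real m * B" "\<And>x. \<bar>R x\<bar> \<le> B" "\<And>x. \<bar>D x\<bar> \<le> 2 * (real m + 1) * B"
      and DS: "(\<lambda>x. D (S x)) \<in> borel_measurable F0"
      and orth: "\<And>\<xi> C. \<xi> \<in> borel_measurable F0 \<Longrightarrow> (\<And>x. \<bar>\<xi> x\<bar> \<le> C) \<Longrightarrow> (\<integral>x. \<xi> x * D x \<partial>M) = 0"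
      and R2: "\<And>k. \<bar>\<integral>x. R x * R ((T ^^ k) x) \<partial>M\<bar> \<le> B * b (k + m)"
      using gordin_decomposition[OF Y B mix, of m] by blast
    define v where "v = (\<integral>x. (D x)\<^sup>2 \<partial>M)"
    define SY where "SY n x = (\<Sum>k<n. Y ((T ^^ k) x))" for n x
    define SD where "SD n x = (\<Sum>k<n. D ((T ^^ k) x))" for n x
    define SR where "SR n x = (\<Sum>k<n. R ((T ^^ k) x))" for n x
    have [measurable]: "SY n \<in> borel_measurable M" "SD n \<in> borel_measurable M" "SR n \<in> borel_measurable M" for n
      unfolding SY_def[abs_def] SD_def[abs_def] SR_def[abs_def] by measurable
    have sums_bd: "\<bar>\<Sum>k<n. f ((T ^^ k) x)\<bar> \<le> real n * C" if "\<And>x. \<bar>f x\<bar> \<le> C" for f :: "'a \<Rightarrow> real" and C n x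
      using sum_bounded_above[of "{..<n}" "\<lambda>k. \<bar>f ((T ^^ k) x)\<bar>" C] that by (intro order_trans[OF sum_abs]) auto
    have sq_int: "integrable M (\<lambda>x. (f x)\<^sup>2)" if [measurable]: "f \<in> borel_measurable M" and "\<And>x. \<bar>f x\<bar> \<le> C" for f :: "'a \<Rightarrow> real" and C
      by (rule integrable_bounded[where B="C\<^sup>2"]) (use power_mono[OF that(2), of _ 2] in auto)
    have intY: "integrable M (\<lambda>x. (SY n x)\<^sup>2)" and intD: "integrable M (\<lambda>x. (SD n x)\<^sup>2)" and intR: "integrable M (\<lambda>x. (SR n x)\<^sup>2)" for n
      by (rule sq_int; auto simp: SY_def[abs_def] SD_def[abs_def] SR_def[abs_def] intro: sums_bd B bd)+
    have diff: "SY n x - SD n x = Z x - Z ((T ^^ n) x) + SR n x" for n x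
    proof (induction n)
      case (Suc n)
      then show ?case using dec[of "(T ^^ n) x"] by (simp add: SY_def SD_def SR_def algebra_simps)
    qed (simp add: SY_def SD_def SR_def)
    have diff_le: "(SY n x - SD n x)\<^sup>2 \<le> 8 * (real m * B)\<^sup>2 + 2 * (SR n x)\<^sup>2" for n x
    proof -
      have "\<bar>Z x - Z ((T ^^ n) x)\<bar> \<le> 2 * (real m * B)" using bd(1)[of x] bd(1)[of "(T ^^ n) x"] by linarith
      then have "(Z x - Z ((T ^^ n) x))\<^sup>2 \<le> (2 * (real m * B))\<^sup>2"
        by (metis abs_ge_zero power2_abs power_mono)
      moreover have "(a + r)\<^sup>2 \<le> 2 * a\<^sup>2 + 2 * r\<^sup>2" for a r :: real
        using zero_le_power2[of "a - r"] by (simp add: power2_eq_square algebra_simps)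
      ultimately show ?thesis unfolding diff by (smt (verit, ccfv_threshold) power_mult_distrib power2_eq_square)
    qed
    have SR_le: "(\<integral>x. (SR n x)\<^sup>2 \<partial>M) \<le> 2 * real n * (B * t m)" for n
    proof -
      have "(\<integral>x. (SR n x)\<^sup>2 \<partial>M) \<le> 2 * real n * (\<Sum>k. B * b (k + m))"
        unfolding SR_def by (rule integral_sum_funpow_sq_le[OF _ bd(2) R2])
           (auto intro!: summable_mult summable_ignore_initial_segment b)
      also have "(\<Sum>k. B * b (k + m)) = B * t m"
        unfolding t_def by (rule suminf_mult[OF summable_ignore_initial_segment[OF b]])
      finally show ?thesis .
    qed
    have intd: "integrable M (\<lambda>x. (SY n x - SD n x)\<^sup>2)" for n
    proof (rule Bochner_Integration.integrable_bound)
      show "integrable M (\<lambda>x. 8 * (real m * B)\<^sup>2 + 2 * (SR n x)\<^sup>2)" using intR by simp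
      show "AE x in M. norm ((SY n x - SD n x)\<^sup>2) \<le> norm (8 * (real m * B)\<^sup>2 + 2 * (SR n x)\<^sup>2)"
        using diff_le by (intro AE_I2) auto
    qed simp
    have q_le: "(\<integral>x. (SY n x - SD n x)\<^sup>2 \<partial>M) \<le> real n * q m n" if "n > 0" for n
    proof -
      have "(\<integral>x. (SY n x - SD n x)\<^sup>2 \<partial>M) \<le> (\<integral>x. 8 * (real m * B)\<^sup>2 + 2 * (SR n x)\<^sup>2 \<partial>M)"
        using intd intR diff_le by (intro integral_mono) auto
      also have "\<dots> = 8 * (real m * B)\<^sup>2 + 2 * (\<integral>x. (SR n x)\<^sup>2 \<partial>M)"
        using intR by (simp add: prob_space)
      also have "\<dots> \<le> 8 * (real m * B)\<^sup>2 + 2 * (2 * real n * (B * t m))"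
        using SR_le by (intro add_left_mono mult_left_mono) auto
      also have "\<dots> = real n * q m n" using that by (simp add: q_def field_simps)
      finally show ?thesis .
    qed
    have SD_eq: "(\<integral>x. (SD n x)\<^sup>2 \<partial>M) = real n * v" for n
    proof -
      have "(\<integral>x. D x * D ((T ^^ Suc k) x) \<partial>M) = 0" for k
      proof -
        have "(\<integral>x. D x * D ((T ^^ Suc k) x) \<partial>M) = (\<integral>x. D ((S ^^ Suc k) x) * D x \<partial>M)"
          by (rule integral_mult_funpow_T) measurable
        also have "\<dots> = (\<integral>x. D (S ((S ^^ k) x)) * D x \<partial>M)" by simp
        also have "\<dots> = 0"
          using measurable_compose[OF funpow_S_F0 DS] bd(3) by (intro orth) auto
        finally show ?thesis .
      qed
      then show ?thesis
        unfolding SD_def integral_sum_funpow_sq[OF ZRD(3) bd(3)] by (simp add: v_def power2_eq_square del: funpow.simps)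
    qed
    \<comment> \<open>Young's inequality with weight \<open>\<eta>\<close>; used in both directions,
      it bounds each of the two variances by the other.\<close>
    have young: "(\<integral>x. (f x)\<^sup>2 \<partial>M) \<le> (1 + \<eta>) * (\<integral>x. (g x)\<^sup>2 \<partial>M) + (1 + 1 / \<eta>) * (\<integral>x. (f x - g x)\<^sup>2 \<partial>M)"
      if "\<eta> > 0" and i: "integrable M (\<lambda>x. (f x)\<^sup>2)" "integrable M (\<lambda>x. (g x)\<^sup>2)" "integrable M (\<lambda>x. (f x - g x)\<^sup>2)"
      for \<eta> and f g :: "'a \<Rightarrow> real"
    proof -
      have "(\<integral>x. (f x)\<^sup>2 \<partial>M) \<le> (\<integral>x. (1 + \<eta>) * (g x)\<^sup>2 + (1 + 1 / \<eta>) * (f x - g x)\<^sup>2 \<partial>M)"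
      proof (rule integral_mono)
        fix x
        have "0 \<le> (\<eta> * g x - (f x - g x))\<^sup>2 / \<eta>" using that by simp
        also have "\<dots> = (1 + \<eta>) * (g x)\<^sup>2 + (1 + 1 / \<eta>) * (f x - g x)\<^sup>2 - (f x)\<^sup>2"
          using that by (simp add: field_simps power2_eq_square)
        finally show "(f x)\<^sup>2 \<le> (1 + \<eta>) * (g x)\<^sup>2 + (1 + 1 / \<eta>) * (f x - g x)\<^sup>2" by simp
      qed (use i in auto)
      then show ?thesis using i by simp
    qed
    have v0: "0 \<le> v" by (simp add: v_def)
    have eta: "\<sigma>2 \<le> (1 + \<eta>) * v + (1 + 1 / \<eta>) * (4 * B * t m) \<and> v \<le> (1 + \<eta>) * \<sigma>2 + (1 + 1 / \<eta>) * (4 * B * t m)"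
      if \<eta>: "\<eta> > 0" for \<eta>
    proof
      have "(\<integral>x. (SY n x)\<^sup>2 \<partial>M) / real n \<le> (1 + \<eta>) * v + (1 + 1 / \<eta>) * q m n" if n: "n \<ge> 1" for n
      proof -
        have "(\<integral>x. (SY n x)\<^sup>2 \<partial>M) \<le> (1 + \<eta>) * (\<integral>x. (SD n x)\<^sup>2 \<partial>M) + (1 + 1 / \<eta>) * (\<integral>x. (SY n x - SD n x)\<^sup>2 \<partial>M)"
          by (rule young[OF \<eta> intY intD intd])
        also have "\<dots> \<le> (1 + \<eta>) * (real n * v) + (1 + 1 / \<eta>) * (real n * q m n)"
          unfolding SD_eq using q_le[of n] n \<eta> by (intro add_left_mono mult_left_mono) auto
        finally have "(\<integral>x. (SY n x)\<^sup>2 \<partial>M) \<le> ((1 + \<eta>) * v + (1 + 1 / \<eta>) * q m n) * real n" by (simp add: algebra_simps)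
        then show ?thesis using n by (simp add: pos_divide_le_eq)
      qed
      then show "\<sigma>2 \<le> (1 + \<eta>) * v + (1 + 1 / \<eta>) * (4 * B * t m)"
        by (intro LIMSEQ_le[OF s_lim[folded SY_def] tendsto_add[OF tendsto_const tendsto_mult[OF tendsto_const q_lim]]]) blast
      have "v \<le> (1 + \<eta>) * ((\<integral>x. (SY n x)\<^sup>2 \<partial>M) / real n) + (1 + 1 / \<eta>) * q m n" if n: "n \<ge> 1" for n
      proof -
        have sw: "(\<lambda>x. (SD n x - SY n x)\<^sup>2) = (\<lambda>x. (SY n x - SD n x)\<^sup>2)" by (simp add: power2_commute)
        have "real n * v \<le> (1 + \<eta>) * (\<integral>x. (SY n x)\<^sup>2 \<partial>M) + (1 + 1 / \<eta>) * (\<integral>x. (SD n x - SY n x)\<^sup>2 \<partial>M)"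
          unfolding SD_eq[symmetric] by (rule young[OF \<eta> intD intY]) (simp add: sw intd)
        also have "\<dots> \<le> (1 + \<eta>) * (\<integral>x. (SY n x)\<^sup>2 \<partial>M) + (1 + 1 / \<eta>) * (real n * q m n)"
          unfolding sw using q_le[of n] n \<eta> by (intro add_left_mono mult_left_mono) auto
        also have "\<dots> = real n * ((1 + \<eta>) * ((\<integral>x. (SY n x)\<^sup>2 \<partial>M) / real n) + (1 + 1 / \<eta>) * q m n)"
          using n by (simp add: field_simps)
        finally show ?thesis using n by simp
      qed
      then show "v \<le> (1 + \<eta>) * \<sigma>2 + (1 + 1 / \<eta>) * (4 * B * t m)"
        by (intro LIMSEQ_le[OF tendsto_const tendsto_add[OF tendsto_mult[OF tendsto_const s_lim[folded SY_def]] tendsto_mult[OF tendsto_const q_lim]]]) blast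
    qed
    define \<psi> where "\<psi> n = (\<integral>x. iexp (u / sqrt (real n) * SD n x) \<partial>M)" for n :: nat
    have "\<psi> \<longlonglongrightarrow> complex_of_real (exp (- (u\<^sup>2 * v / 2)))"
      unfolding \<psi>_def SD_def v_def by (rule martingale_clt[OF ZRD(3) bd(3) DS orth])
    moreover have "norm (\<phi> n - \<psi> n) \<le> \<bar>u\<bar> * sqrt (q m n)" if n: "n > 0" for n
    proof -
      have i1: "integrable M (\<lambda>x. SY n x - SD n x)"
        by (rule square_integrable_imp_integrable[OF _ intd]) simp
      have "norm (\<phi> n - \<psi> n) \<le> (\<integral>x. \<bar>u / sqrt (real n) * SY n x - u / sqrt (real n) * SD n x\<bar> \<partial>M)"
        unfolding \<phi>_def \<psi>_def SY_def[symmetric]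
        by (rule norm_integral_iexp_diff_le) (use integrable_mult_right[OF i1, of "u / sqrt (real n)"] in \<open>auto simp: right_diff_distrib\<close>)
      also have "\<dots> = \<bar>u\<bar> / sqrt (real n) * (\<integral>x. \<bar>SY n x - SD n x\<bar> \<partial>M)"
        by (simp only: right_diff_distrib[symmetric] abs_mult abs_divide integral_mult_right_zero) simp
      also have "\<dots> \<le> \<bar>u\<bar> / sqrt (real n) * sqrt (real n * q m n)"
        using q_le[OF n] by (intro mult_left_mono order_trans[OF integral_abs_le_sqrt[OF i1 intd]]) auto
      also have "\<dots> = \<bar>u\<bar> * sqrt (q m n)" using n by (simp add: real_sqrt_mult)
      finally show ?thesis .
    qed
    ultimately show ?thesis using v0 eta by blast
  qed
  have "\<phi> \<longlonglongrightarrow> complex_of_real (exp (- (u\<^sup>2 * \<sigma>2 / 2)))"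
  proof -
    from step obtain v \<psi> where v0: "\<And>m. 0 \<le> v m"
      and eta: "\<And>m \<eta>. 0 < \<eta> \<Longrightarrow> \<sigma>2 \<le> (1 + \<eta>) * v m + (1 + 1 / \<eta>) * (4 * B * t m) \<and> v m \<le> (1 + \<eta>) * \<sigma>2 + (1 + 1 / \<eta>) * (4 * B * t m)"
      and \<psi>: "\<And>m. \<psi> m \<longlonglongrightarrow> complex_of_real (exp (- (u\<^sup>2 * v m / 2)))"
      and \<phi>\<psi>: "\<And>m n. n > 0 \<Longrightarrow> norm (\<phi> n - \<psi> m n) \<le> \<bar>u\<bar> * sqrt (q m n)" by metis
    have bt: "(\<lambda>m. 4 * B * t m) \<longlonglongrightarrow> 0" using tendsto_mult_right_zero[OF t_lim] .
    have \<sigma>0: "0 \<le> \<sigma>2"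
      by (rule LIMSEQ_le_const[OF s_lim]) auto
    have v_lim: "v \<longlonglongrightarrow> \<sigma>2"
    proof (rule LIMSEQ_I)
      fix \<epsilon> :: real assume \<epsilon>: "0 < \<epsilon>"
      \<comment> \<open>This keeps \<open>\<eta> * \<sigma>2\<close> below a fraction of
        \<open>\<epsilon>\<close>; the summand \<open>1\<close> covers
        \<open>\<sigma>2 = 0\<close>.\<close>
      define \<eta> where "\<eta> = min 1 (\<epsilon> / (8 * (\<sigma>2 + 1)))"
      have \<eta>: "0 < \<eta>" "\<eta> \<le> 1" "\<eta> * (\<sigma>2 + 1) \<le> \<epsilon> / 8"
      proof -
        show "0 < \<eta>" "\<eta> \<le> 1" using \<epsilon> \<sigma>0 by (auto simp: \<eta>_def)
        have "\<eta> * (\<sigma>2 + 1) \<le> \<epsilon> / (8 * (\<sigma>2 + 1)) * (\<sigma>2 + 1)"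
          using \<sigma>0 by (intro mult_right_mono) (auto simp: \<eta>_def)
        also have "\<dots> = \<epsilon> / 8" 
        proof -
          have "\<epsilon> / (8 * s) * s = \<epsilon> / 8" if "0 < s" for s using that by simp
          from this[of "\<sigma>2 + 1"] show ?thesis using \<sigma>0 by linarith
        qed
        finally show "\<eta> * (\<sigma>2 + 1) \<le> \<epsilon> / 8" .
      qed
      have "(\<lambda>m. (1 + 1 / \<eta>) * (4 * B * t m)) \<longlonglongrightarrow> (1 + 1 / \<eta>) * 0" by (intro tendsto_intros bt)
      then have "(\<lambda>m. (1 + 1 / \<eta>) * (4 * B * t m)) \<longlonglongrightarrow> 0" by simp
      from LIMSEQ_D[OF this, of "\<epsilon> / 8"] \<epsilon> obtain N where N: "\<And>m. m \<ge> N \<Longrightarrow> \<bar>(1 + 1 / \<eta>) * (4 * B * t m)\<bar> < \<epsilon> / 8" by auto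
      show "\<exists>no. \<forall>m\<ge>no. norm (v m - \<sigma>2) < \<epsilon>"
      proof (intro exI allI impI)
        fix m assume "m \<ge> N"
        then have r: "(1 + 1 / \<eta>) * (4 * B * t m) < \<epsilon> / 8" using N[of m] by linarith
        define r' where "r' = (1 + 1 / \<eta>) * (4 * B * t m)"
        have e: "\<sigma>2 \<le> v m + \<eta> * v m + r'" "v m \<le> \<sigma>2 + \<eta> * \<sigma>2 + r'"
          using eta[OF \<eta>(1), of m] unfolding r'_def[symmetric] by (simp_all add: distrib_right)
        note r = r[folded r'_def]
        have \<eta>3: "\<eta> * \<sigma>2 + \<eta> \<le> \<epsilon> / 8" using \<eta>(3) by (simp add: distrib_left)
        have up: "v m \<le> \<sigma>2 + \<epsilon> / 4" using e(2) r \<eta>(1) \<eta>3 by linarith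
        have "\<eta> * v m \<le> \<eta> * \<sigma>2 + \<epsilon> / 4"
        proof -
          have "\<eta> * v m \<le> \<eta> * \<sigma>2 + \<eta> * (\<epsilon> / 4)"
            using mult_left_mono[OF up, of \<eta>] \<eta>(1) by (simp only: distrib_left less_imp_le)
          moreover have "\<eta> * (\<epsilon> / 4) \<le> 1 * (\<epsilon> / 4)" using \<eta>(2) \<epsilon> by (intro mult_right_mono) auto
          ultimately show ?thesis by linarith
        qed
        then have "\<sigma>2 \<le> v m + \<epsilon> / 2" using e(1) r \<eta>(1) \<eta>3 \<epsilon> by linarith
        with up \<epsilon> show "norm (v m - \<sigma>2) < \<epsilon>" by (simp add: abs_less_iff)
      qed
    qed
    show ?thesis
    proof (rule LIMSEQ_I)
      fix \<epsilon> :: real assume \<epsilon>: "0 < \<epsilon>"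
      have "(\<lambda>m. complex_of_real (exp (- (u\<^sup>2 * v m / 2)))) \<longlonglongrightarrow> complex_of_real (exp (- (u\<^sup>2 * \<sigma>2 / 2)))"
        by (intro tendsto_intros v_lim) simp
      from LIMSEQ_D[OF this, of "\<epsilon>/4"] \<epsilon> obtain N1 where
        N1: "\<And>m. m \<ge> N1 \<Longrightarrow> norm (complex_of_real (exp (- (u\<^sup>2 * v m / 2))) - exp (- (u\<^sup>2 * \<sigma>2 / 2))) < \<epsilon>/4" by auto
      have "(\<lambda>m. \<bar>u\<bar> * sqrt (4 * B * t m)) \<longlonglongrightarrow> \<bar>u\<bar> * sqrt 0" by (intro tendsto_intros bt)
      then have "\<forall>\<^sub>F m in sequentially. \<bar>u\<bar> * sqrt (4 * B * t m) < \<epsilon>/4" using \<epsilon> by (intro order_tendstoD) auto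
      then obtain N2 where N2: "\<And>m. m \<ge> N2 \<Longrightarrow> \<bar>u\<bar> * sqrt (4 * B * t m) < \<epsilon>/4" by (auto simp: eventually_sequentially)
      \<comment> \<open>The horizon is frozen here; only then does \<open>n\<close> tend to
        infinity.\<close>
      define m where "m = max N1 N2"
      have "(\<lambda>n. \<bar>u\<bar> * sqrt (q m n)) \<longlonglongrightarrow> \<bar>u\<bar> * sqrt (4 * B * t m)" by (intro tendsto_intros q_lim)
      then have "\<forall>\<^sub>F n in sequentially. \<bar>u\<bar> * sqrt (q m n) < \<epsilon>/4"
        by (rule order_tendstoD) (rule N2, simp add: m_def)
      moreover have "\<forall>\<^sub>F n in sequentially. norm (\<psi> m n - exp (- (u\<^sup>2 * v m / 2))) < \<epsilon>/4"
        using tendstoD[OF \<psi>[of m], of "\<epsilon>/4"] \<epsilon> unfolding dist_norm by linarith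
      moreover have "\<forall>\<^sub>F n in sequentially. n > 0" by (rule eventually_gt_at_top)
      ultimately have "\<forall>\<^sub>F n in sequentially. norm (\<phi> n - exp (- (u\<^sup>2 * \<sigma>2 / 2))) < \<epsilon>"
      proof eventually_elim
        fix n :: nat assume *: "\<bar>u\<bar> * sqrt (q m n) < \<epsilon>/4" "norm (\<psi> m n - exp (- (u\<^sup>2 * v m / 2))) < \<epsilon>/4" "n > 0"
        have "norm (\<phi> n - \<psi> m n) \<le> \<epsilon>/4" using \<phi>\<psi>[OF *(3), of m] *(1) by linarith
        from norm_diff_triangle_le[OF norm_diff_triangle_le[OF this less_imp_le[OF *(2)]] less_imp_le[OF N1[of m]]] \<epsilon>
        show "norm (\<phi> n - exp (- (u\<^sup>2 * \<sigma>2 / 2))) < \<epsilon>" by (simp add: m_def)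
      qed
      then show "\<exists>no. \<forall>n\<ge>no. norm (\<phi> n - exp (- (u\<^sup>2 * \<sigma>2 / 2))) < \<epsilon>" by (simp add: eventually_sequentially)
    qed
  qed
  then show ?thesis unfolding \<phi>_def[abs_def] \<sigma>2_def .
qed

end

section \<open>Gram--Schmidt orthogonalisation of a kernel\<close>

definition psd_kernel :: "('a \<Rightarrow> 'a \<Rightarrow> real) \<Rightarrow> bool" where
  "psd_kernel K \<longleftrightarrow> (\<forall>s t. K s t = K t s) \<and>
     (\<forall>n (x :: nat \<Rightarrow> 'a) a. 0 \<le> (\<Sum>i<n. \<Sum>j<n. a i * a j * K (x i) (x j)))"

lemma psd_kernel_sym: "psd_kernel K \<Longrightarrow> K s t = K t s"
  by (simp add: psd_kernel_def)

lemma psd_kernel_sum_nonneg: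
  fixes n :: nat
  shows "psd_kernel K \<Longrightarrow> 0 \<le> (\<Sum>i<n. \<Sum>j<n. a i * a j * K (x i) (x j))"
  by (simp add: psd_kernel_def)

lemma psd_kernel_two:
  assumes "psd_kernel K"
  shows "0 \<le> a\<^sup>2 * K s s + 2 * a * b * K s t + b\<^sup>2 * K t t"
  using psd_kernel_sum_nonneg[OF assms, where n=2 and a="\<lambda>i. if i = 0 then a else b" and x="\<lambda>i. if i = 0 then s else t"]
    psd_kernel_sym[OF assms, of s t]
  by (simp add: numeral_2_eq_2 power2_eq_square algebra_simps)

lemma psd_kernel_diag: "psd_kernel K \<Longrightarrow> 0 \<le> K t t"
  using psd_kernel_two[of K 1 t 0 t] by simp

text \<open>A degenerate point is orthogonal to all others, since otherwise a suitable multiple of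
  it would make the form negative. This justifies division by zero in the orthogonalisation.\<close>

lemma psd_kernel_zero:
  assumes K: "psd_kernel K" and t: "K t t = 0"
  shows "K s t = 0"
proof (rule ccontr)
  assume ne: "K s t \<noteq> 0"
  \<comment> \<open>Chosen so that the form takes the value \<open>-1\<close>.\<close>
  define b where "b = - (K s s + 1) / (2 * K s t)"
  have "0 \<le> K s s + 2 * b * K s t"
    using psd_kernel_two[OF K, of 1 s b t] t by simp
  moreover have "2 * b * K s t = - (K s s + 1)" using ne by (simp add: b_def)
  ultimately show False by simp
qed

text \<open>Gram--Schmidt orthogonalisation along the sequence \<open>q\<close>, expressed on the kernel:
  \<open>resid_kernel K q k\<close> is the kernel of the components orthogonal to \<open>q 0, \<dots>, q (k - 1)\<close>. If
  \<open>q k\<close> is degenerate then division by \<open>0\<close> gives \<open>0\<close>, as it should.\<close>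

primrec resid_kernel :: "('a \<Rightarrow> 'a \<Rightarrow> real) \<Rightarrow> (nat \<Rightarrow> 'a) \<Rightarrow> nat \<Rightarrow> 'a \<Rightarrow> 'a \<Rightarrow> real" where
  "resid_kernel K q 0 s t = K s t"
| "resid_kernel K q (Suc k) s t = resid_kernel K q k s t
     - resid_kernel K q k s (q k) * resid_kernel K q k t (q k) / resid_kernel K q k (q k) (q k)"

text \<open>With the kernel read as an inner product, this is the coordinate of \<open>t\<close>
  along the \<open>k\<close>-th orthonormal vector; it vanishes when that vector
  degenerates.\<close>

definition gs_coeff :: "('a \<Rightarrow> 'a \<Rightarrow> real) \<Rightarrow> (nat \<Rightarrow> 'a) \<Rightarrow> nat \<Rightarrow> 'a \<Rightarrow> real" where
  "gs_coeff K q k t = resid_kernel K q k t (q k) / sqrt (resid_kernel K q k (q k) (q k))"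

context
  fixes K :: "'a \<Rightarrow> 'a \<Rightarrow> real" and q :: "nat \<Rightarrow> 'a"
  assumes K: "psd_kernel K"
begin

text \<open>The new kernel is a Schur complement. Adjoining the point \<open>q k\<close> with weight
  \<open>- A / d\<close> minimises the old form over that weight, and the minimum is the new
  form.\<close>

lemma psd_resid_kernel: "psd_kernel (resid_kernel K q k)"
proof (induction k)
  case 0
  then show ?case using K by (simp add: psd_kernel_def)
next
  case (Suc k)
  define R where "R = resid_kernel K q k"
  have R: "psd_kernel R" using Suc by (simp add: R_def)
  define d where "d = R (q k) (q k)"
  have S: "resid_kernel K q (Suc k) s t = R s t - R s (q k) * R t (q k) / d" for s t
    by (simp add: R_def d_def)
  show ?case
    unfolding psd_kernel_def
  proof (intro conjI allI)
    show "resid_kernel K q (Suc k) s t = resid_kernel K q (Suc k) t s" for s t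
      by (simp only: S psd_kernel_sym[OF R, of s t] mult.commute)
    fix n :: nat and x :: "nat \<Rightarrow> 'a" and a :: "nat \<Rightarrow> real"
    define A where "A = (\<Sum>i<n. a i * R (x i) (q k))"
    define Q where "Q = (\<Sum>i<n. \<Sum>j<n. a i * a j * R (x i) (x j))"
    have "(\<Sum>i<n. \<Sum>j<n. a i * a j * resid_kernel K q (Suc k) (x i) (x j)) = Q - A\<^sup>2 / d"
    proof -
      have "A\<^sup>2 / d = (\<Sum>i<n. \<Sum>j<n. a i * a j * (R (x i) (q k) * R (x j) (q k) / d))"
        by (simp add: A_def power2_eq_square sum_product sum_divide_distrib field_simps)
      then show ?thesis
        unfolding S Q_def by (simp add: right_diff_distrib sum_subtractf)
    qed
    moreover have "0 \<le> Q - A\<^sup>2 / d"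
    proof (cases "d = 0")
      case True
      then show ?thesis using psd_kernel_sum_nonneg[OF R] by (simp add: Q_def)
    next
      case False
      then have d: "0 < d" using psd_kernel_diag[OF R, of "q k"] by (simp add: d_def)
      have "0 \<le> Q + 2 * (- A / d) * A + (- A / d)\<^sup>2 * d"
      proof -
        define a' where "a' i = (if i < n then a i else - A / d)" for i
        define x' where "x' i = (if i < n then x i else q k)" for i
        have "0 \<le> (\<Sum>i<Suc n. \<Sum>j<Suc n. a' i * a' j * R (x' i) (x' j))"
          by (rule psd_kernel_sum_nonneg[OF R])
        also have "\<dots> = (\<Sum>i<n. \<Sum>j<n. a' i * a' j * R (x' i) (x' j)) + (\<Sum>i<n. a' i * a' n * R (x' i) (x' n))
            + (\<Sum>j<n. a' n * a' j * R (x' n) (x' j)) + a' n * a' n * R (x' n) (x' n)"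
          by (simp add: sum.distrib)
        also have "(\<Sum>i<n. \<Sum>j<n. a' i * a' j * R (x' i) (x' j)) = Q"
          unfolding Q_def by (intro sum.cong refl) (simp add: a'_def x'_def)
        also have "(\<Sum>i<n. a' i * a' n * R (x' i) (x' n)) = (- A / d) * A"
          unfolding A_def sum_distrib_left by (intro sum.cong refl) (simp add: a'_def x'_def A_def)
        also have "(\<Sum>j<n. a' n * a' j * R (x' n) (x' j)) = (- A / d) * A"
          unfolding A_def sum_distrib_left
          by (intro sum.cong refl) (simp add: a'_def x'_def A_def psd_kernel_sym[OF R, of "q k"])
        also have "a' n * a' n * R (x' n) (x' n) = (- A / d)\<^sup>2 * d"
          by (simp add: a'_def x'_def d_def power2_eq_square)
        finally show ?thesis by simp
      qed
      also have "\<dots> = Q - A\<^sup>2 / d" using d by (simp add: power2_eq_square field_simps)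
      finally show ?thesis .
    qed
    ultimately show "0 \<le> (\<Sum>i<n. \<Sum>j<n. a i * a j * resid_kernel K q (Suc k) (x i) (x j))" by simp
  qed
qed

lemma resid_kernel_eq: "resid_kernel K q n s t = K s t - (\<Sum>k<n. gs_coeff K q k s * gs_coeff K q k t)"
proof (induction n)
  case (Suc n)
  have "sqrt (resid_kernel K q n (q n) (q n)) * sqrt (resid_kernel K q n (q n) (q n)) = resid_kernel K q n (q n) (q n)"
    using psd_kernel_diag[OF psd_resid_kernel] by simp
  then show ?case using Suc by (simp add: gs_coeff_def)
qed simp

text \<open>Eliminating a point gives it zero residual, and it keeps it: all later corrections are
  multiples of its vanishing entries.\<close>

lemma resid_kernel_q: "j < n \<Longrightarrow> resid_kernel K q n s (q j) = 0"
proof (induction n arbitrary: s)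
  case (Suc n)
  note sym = psd_kernel_sym[OF psd_resid_kernel]
  show ?case
  proof (cases "j = n")
    case True
    then show ?thesis
      using psd_kernel_zero[OF psd_resid_kernel, of n "q n" s] by simp
  next
    case False
    then have "j < n" using Suc.prems by simp
    then show ?thesis using Suc.IH[of s] Suc.IH[of "q n"] sym[of n "q n" "q j"] by simp
  qed
qed simp

text \<open>For \<open>j < n\<close> the vector of \<open>q j\<close> lies in the span of the first
  \<open>n\<close> directions, so the expansion stops exactly.\<close>

lemma kernel_eq_gs_sum:
  assumes "j < n" shows "K s (q j) = (\<Sum>k<n. gs_coeff K q k s * gs_coeff K q k (q j))"
  using resid_kernel_q[OF assms, of s] by (simp add: resid_kernel_eq)

lemma sum_gs_coeff_sq_le: "(\<Sum>k<n. (gs_coeff K q k s)\<^sup>2) \<le> K s s"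
  using psd_kernel_diag[OF psd_resid_kernel, of n s] by (simp add: resid_kernel_eq power2_eq_square)

lemma sum_gs_coeff_diff_sq_le: "(\<Sum>k<n. (gs_coeff K q k s - gs_coeff K q k t)\<^sup>2) \<le> K s s - 2 * K s t + K t t"
proof -
  have "(\<Sum>k<n. (gs_coeff K q k s - gs_coeff K q k t)\<^sup>2) = (\<Sum>k<n. gs_coeff K q k s * gs_coeff K q k s)
      - 2 * (\<Sum>k<n. gs_coeff K q k s * gs_coeff K q k t) + (\<Sum>k<n. gs_coeff K q k t * gs_coeff K q k t)"
    by (simp add: power2_eq_square algebra_simps sum.distrib sum_subtractf sum_distrib_left)
  moreover have "0 \<le> resid_kernel K q n s s - 2 * resid_kernel K q n s t + resid_kernel K q n t t"
    using psd_kernel_two[OF psd_resid_kernel, of 1 n s "-1" t] by simp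
  ultimately show ?thesis by (simp add: resid_kernel_eq)
qed

lemma abs_sum_gs_coeff_le: "\<bar>\<Sum>k<n. gs_coeff K q k s * gs_coeff K q k t\<bar> \<le> sqrt (K s s) * sqrt (K t t)"
proof -
  have "\<bar>\<Sum>k<n. gs_coeff K q k s * gs_coeff K q k t\<bar> \<le> (\<Sum>k<n. \<bar>gs_coeff K q k s\<bar> * \<bar>gs_coeff K q k t\<bar>)"
    by (rule order_trans[OF sum_abs]) (simp add: abs_mult)
  also have "\<dots> \<le> sqrt (\<Sum>k<n. (gs_coeff K q k s)\<^sup>2) * sqrt (\<Sum>k<n. (gs_coeff K q k t)\<^sup>2)"
    using L2_set_mult_ineq[of "\<lambda>k. gs_coeff K q k s" "\<lambda>k. gs_coeff K q k t" "{..<n}"] by (simp add: L2_set_def)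
  also have "\<dots> \<le> sqrt (K s s) * sqrt (K t t)"
    using psd_kernel_diag[OF K] by (intro mult_mono) (auto simp: sum_gs_coeff_sq_le sum_nonneg)
  finally show ?thesis .
qed

text \<open>\<open>dense\<close> says that the sequence approximates \<open>s\<close> in the
  pseudometric of the kernel. For \<open>n > j\<close> the residual variance at \<open>s\<close> is
  at most the squared distance from \<open>s\<close> to \<open>q j\<close>; Cauchy-Schwarz for the
  residual kernel then reaches every \<open>t\<close>.\<close>

lemma gs_coeff_sums:
  assumes dense: "\<And>e. 0 < e \<Longrightarrow> \<exists>j. K s s - 2 * K s (q j) + K (q j) (q j) < e"
  shows "(\<lambda>k. gs_coeff K q k s * gs_coeff K q k t) sums K s t"
proof -
  define r where "r n u = resid_kernel K q n u u" for n u
  have r0: "0 \<le> r n u" for n u unfolding r_def by (rule psd_kernel_diag[OF psd_resid_kernel])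
  have diag: "(\<lambda>n. r n s) \<longlonglongrightarrow> 0"
  proof (rule LIMSEQ_I)
    fix e :: real assume "0 < e"
    then obtain j where j: "K s s - 2 * K s (q j) + K (q j) (q j) < e" using dense by blast
    show "\<exists>no. \<forall>n\<ge>no. norm (r n s - 0) < e"
    proof (intro exI allI impI)
      fix n assume n: "n \<ge> Suc j"
      have "(\<Sum>k<n. (gs_coeff K q k s)\<^sup>2) - 2 * K s (q j) + K (q j) (q j) = (\<Sum>k<n. (gs_coeff K q k s - gs_coeff K q k (q j))\<^sup>2)"
        using n by (subst (1 2) kernel_eq_gs_sum[of j n])
          (auto simp: power2_eq_square algebra_simps sum.distrib sum_subtractf sum_distrib_left)
      also have "\<dots> \<ge> 0" by (simp add: sum_nonneg)
      finally have "r n s \<le> K s s - 2 * K s (q j) + K (q j) (q j)"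
        by (simp add: r_def resid_kernel_eq power2_eq_square)
      with j r0[of n s] show "norm (r n s - 0) < e" by simp
    qed
  qed
  have bd: "\<bar>resid_kernel K q n s t\<bar> \<le> sqrt (r n s) * sqrt (K t t)" for n
  proof -
    define R where "R = resid_kernel K q n"
    have R: "psd_kernel R" by (simp add: R_def psd_resid_kernel)
    have "(R s t)\<^sup>2 \<le> R s s * R t t"
    proof (cases "R t t = 0")
      case True
      then show ?thesis using psd_kernel_zero[OF R True, of s] by simp
    next
      case False
      then have p: "0 < R t t" using psd_kernel_diag[OF R, of t] by simp
      have "0 \<le> R t t * (R s s * R t t - (R s t)\<^sup>2)"
        using psd_kernel_two[OF R, of "R t t" s "- R s t" t] by (simp add: power2_eq_square algebra_simps)
      then show ?thesis using p by (simp add: zero_le_mult_iff)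
    qed
    also have "\<dots> \<le> r n s * K t t"
      using psd_kernel_diag[OF R] sum_nonneg[of "{..<n}" "\<lambda>k. (gs_coeff K q k t)\<^sup>2"]
      unfolding r_def R_def by (intro mult_mono) (auto simp: resid_kernel_eq power2_eq_square)
    finally show ?thesis unfolding R_def real_sqrt_mult[symmetric] by (intro real_le_rsqrt) simp
  qed
  have "(\<lambda>n. sqrt (r n s) * sqrt (K t t)) \<longlonglongrightarrow> sqrt 0 * sqrt (K t t)"
    by (intro tendsto_intros diag)
  then have "(\<lambda>n. sqrt (r n s) * sqrt (K t t)) \<longlonglongrightarrow> 0" by simp
  then have "(\<lambda>n. resid_kernel K q n s t) \<longlonglongrightarrow> 0"
    by (rule Lim_null_comparison[rotated]) (use bd in auto)
  then have "(\<lambda>n. K s t - resid_kernel K q n s t) \<longlonglongrightarrow> K s t - 0"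
    by (intro tendsto_intros)
  then show ?thesis by (simp add: sums_def resid_kernel_eq)
qed

end

section \<open>Gaussian random elements of the space of integrable functions\<close>

text \<open>Writing the law as an image of the standard normal law treats the degenerate case
  \<open>s = 0\<close> together with the others.\<close>

lemma (in prob_space) distr_eq_scaled_normal:
  assumes [measurable]: "U \<in> borel_measurable M" and s: "0 \<le> s"
    and ch: "\<And>u. (\<integral>x. iexp (u * U x) \<partial>M) = exp (- (u\<^sup>2 * s / 2))"
  shows "distr M borel U = distr std_normal_distribution borel (\<lambda>x. sqrt s * x)"
proof (rule Levy_uniqueness)
  interpret S: real_distribution std_normal_distribution by (rule real_dist_normal_dist)
  show "real_distribution (distr M borel U)" by (rule real_distribution_distr) simp
  show "real_distribution (distr std_normal_distribution borel (\<lambda>x. sqrt s * x))"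
    by (rule S.real_distribution_distr) simp
  show "char (distr M borel U) = char (distr std_normal_distribution borel (\<lambda>x. sqrt s * x))"
  proof
    fix u
    have "char (distr M borel U) u = exp (- (u\<^sup>2 * s / 2))"
      unfolding char_def ch[of u, symmetric] by (rule integral_distr) auto
    also have "\<dots> = char std_normal_distribution (u * sqrt s)"
      unfolding char_std_normal_distribution using s by (simp add: power_mult_distrib)
    also have "\<dots> = char (distr std_normal_distribution borel (\<lambda>x. sqrt s * x)) u"
      unfolding char_def by (subst integral_distr) (auto simp: mult.assoc)
    finally show "char (distr M borel U) u = \<dots>" .
  qed
qed

lemma gaussian_law_scaled_normal:
  assumes "0 \<le> s"
  shows "gaussian_law (distr std_normal_distribution borel (\<lambda>x. sqrt s * x))"
proof -
  interpret S: real_distribution std_normal_distribution by (rule real_dist_normal_dist)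
  show ?thesis
  proof (cases "s = 0")
    case True
    moreover have "distr std_normal_distribution borel (\<lambda>_. 0 :: real) = return borel 0"
      by (rule S.distr_const) simp
    moreover have "(\<lambda>x :: real. sqrt 0 * x) = (\<lambda>_. 0)" by auto
    ultimately show ?thesis unfolding gaussian_law_def by metis
  next
    case False
    with assms have s: "0 < sqrt s" by simp
    have "distributed std_normal_distribution lborel (\<lambda>x. x) (normal_density 0 1)"
      unfolding distributed_def by (auto simp: distr_id2)
    from S.normal_density_affine[OF this, of "sqrt s" 0] s
    have "distributed std_normal_distribution lborel (\<lambda>x. sqrt s * x) (normal_density 0 (sqrt s))" by simp
    then have "distr std_normal_distribution lborel (\<lambda>x. sqrt s * x) = density lborel (normal_density 0 (sqrt s))"
      by (rule distributed_distr_eq_density)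
    moreover have "distr std_normal_distribution lborel (\<lambda>x. sqrt s * x) = distr std_normal_distribution borel (\<lambda>x. sqrt s * x)"
      by (rule distr_cong) auto
    ultimately show ?thesis unfolding gaussian_law_def using s by metis
  qed
qed

lemma (in prob_space) scaled_normal_moments:
  assumes [measurable]: "U \<in> borel_measurable M" and s: "0 \<le> s"
    and d: "distr M borel U = distr std_normal_distribution borel (\<lambda>x. sqrt s * x)"
  shows "integrable M U" "integrable M (\<lambda>x. (U x)\<^sup>2)" "(\<integral>x. U x \<partial>M) = 0" "(\<integral>x. (U x)\<^sup>2 \<partial>M) = s"
    "(\<integral>x. \<bar>U x\<bar> \<partial>M) \<le> sqrt s"
proof -
  interpret S: real_distribution std_normal_distribution by (rule real_dist_normal_dist)
  have tr: "(\<integral>x. h (U x) \<partial>M) = (\<integral>x. h (sqrt s * x) \<partial>std_normal_distribution)"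
    if [measurable]: "h \<in> borel_measurable borel" for h :: "real \<Rightarrow> real"
  proof -
    have "(\<integral>x. h (U x) \<partial>M) = integral\<^sup>L (distr M borel U) h" by (rule integral_distr[symmetric]) auto
    also have "\<dots> = (\<integral>x. h (sqrt s * x) \<partial>std_normal_distribution)" unfolding d by (rule integral_distr) auto
    finally show ?thesis .
  qed
  have m1: "(\<integral>x. x \<partial>std_normal_distribution) = 0"
    using integral_std_normal_distribution_moment_odd[of 1] by simp
  have m2: "(\<integral>x. x\<^sup>2 \<partial>std_normal_distribution) = 1"
    using std_normal_distribution_even_moments(1)[of 1] by simp
  show 2: "integrable M (\<lambda>x. (U x)\<^sup>2)"
  proof -
    have "integrable (distr M borel U) (\<lambda>x. x\<^sup>2)"
      unfolding d using std_normal_distribution_even_moments(2)[of 1]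
      by (subst integrable_distr_eq) (auto simp: power_mult_distrib)
    then show ?thesis by (subst (asm) integrable_distr_eq) auto
  qed
  show 1: "integrable M U" by (rule square_integrable_imp_integrable[OF _ 2]) simp
  show "(\<integral>x. U x \<partial>M) = 0" using tr[of "\<lambda>x. x"] m1 by simp
  show 3: "(\<integral>x. (U x)\<^sup>2 \<partial>M) = s" using tr[of "\<lambda>x. x\<^sup>2"] m2 s by (simp add: power_mult_distrib)
  show "(\<integral>x. \<bar>U x\<bar> \<partial>M) \<le> sqrt s" using integral_abs_le_sqrt[OF 1 2] 3 by simp
qed

section \<open>Independent standard normal variables\<close>

definition gauss_seq :: "(nat \<Rightarrow> real) measure" where
  "gauss_seq = (\<Pi>\<^sub>M k\<in>UNIV. std_normal_distribution)"

lemma prob_space_gauss_seq: "prob_space gauss_seq"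
  unfolding gauss_seq_def by (intro prob_space_PiM prob_space_normal_density) simp

lemma gauss_seq_coord [measurable]: "(\<lambda>w. w k) \<in> borel_measurable gauss_seq"
proof -
  have "(\<lambda>w. w k) \<in> measurable gauss_seq std_normal_distribution"
    unfolding gauss_seq_def by measurable
  then show ?thesis by simp
qed

interpretation gauss_seq: prob_space gauss_seq
  by (rule prob_space_gauss_seq)

lemma char_gauss_seq:
  "(\<integral>w. iexp (u * (\<Sum>k<n. a k * w k)) \<partial>gauss_seq) = exp (- (u\<^sup>2 * (\<Sum>k<n. (a k)\<^sup>2) / 2))"
proof -
  have dist: "distr gauss_seq borel (\<lambda>w. w k) = std_normal_distribution" for k
  proof -
    have "distr gauss_seq borel (\<lambda>w. w k) = distr gauss_seq std_normal_distribution (\<lambda>w. w k)"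
      by (rule distr_cong) auto
    also have "\<dots> = std_normal_distribution"
      unfolding gauss_seq_def by (rule distr_PiM_component) (auto intro: prob_space_normal_density)
    finally show ?thesis .
  qed
  have "gauss_seq.indep_vars (\<lambda>_. borel) (\<lambda>k w. w k) UNIV"
  proof (subst gauss_seq.indep_vars_iff_distr_eq_PiM)
    have "distr gauss_seq (PiM UNIV (\<lambda>_. borel)) (\<lambda>x. restrict (\<lambda>k. x k) UNIV) = distr gauss_seq gauss_seq (\<lambda>x. x)"
      by (rule distr_cong) (auto simp: gauss_seq_def intro!: sets_PiM_cong)
    also have "\<dots> = gauss_seq" by (rule distr_id)
    also have "\<dots> = (\<Pi>\<^sub>M i\<in>UNIV. distr gauss_seq borel (\<lambda>w. w i))"
      unfolding dist by (simp add: gauss_seq_def)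
    finally show "distr gauss_seq (\<Pi>\<^sub>M i\<in>UNIV. borel) (\<lambda>x. \<lambda>i\<in>UNIV. x i) = (\<Pi>\<^sub>M i\<in>UNIV. distr gauss_seq borel (\<lambda>w. w i))" .
  qed auto
  then have "gauss_seq.indep_vars (\<lambda>_. borel) (\<lambda>k w. w k) {..<n}"
    by (rule gauss_seq.indep_vars_subset) auto
  then have ind: "gauss_seq.indep_vars (\<lambda>_. borel) (\<lambda>k w. a k * w k) {..<n}"
    by (rule gauss_seq.indep_vars_compose2) auto
  have "(\<integral>w. iexp (u * (\<Sum>k<n. a k * w k)) \<partial>gauss_seq) = char (distr gauss_seq borel (\<lambda>w. \<Sum>k<n. a k * w k)) u"
    unfolding char_def by (rule integral_distr[symmetric]) auto
  also have "\<dots> = (\<Prod>k<n. char (distr gauss_seq borel (\<lambda>w. a k * w k)) u)"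
    by (rule gauss_seq.char_distr_sum[OF ind])
  also have "\<dots> = (\<Prod>k<n. complex_of_real (exp (- (u\<^sup>2 * (a k)\<^sup>2 / 2))))"
  proof (intro prod.cong refl)
    fix k
    have "char (distr gauss_seq borel (\<lambda>w. a k * w k)) u = (\<integral>w. iexp (u * a k * w k) \<partial>gauss_seq)"
      unfolding char_def by (subst integral_distr) (auto simp: mult.assoc)
    also have "\<dots> = char (distr gauss_seq borel (\<lambda>w. w k)) (u * a k)"
      unfolding char_def by (rule integral_distr[symmetric]) auto
    also have "\<dots> = complex_of_real (exp (- (u\<^sup>2 * (a k)\<^sup>2 / 2)))"
      unfolding dist char_std_normal_distribution by (simp add: power_mult_distrib)
    finally show "char (distr gauss_seq borel (\<lambda>w. a k * w k)) u = \<dots>" .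
  qed
  also have "\<dots> = exp (- (u\<^sup>2 * (\<Sum>k<n. (a k)\<^sup>2) / 2))"
    by (simp add: of_real_prod[symmetric] exp_sum[symmetric] sum_negf sum_distrib_left sum_divide_distrib del: of_real_prod)
  finally show ?thesis .
qed

lemma integrable_gauss_sum: "integrable gauss_seq (\<lambda>w. \<Sum>k<n. a k * w k)"
  and integral_abs_gauss_sum_le: "(\<integral>w. \<bar>\<Sum>k<n. a k * w k\<bar> \<partial>gauss_seq) \<le> sqrt (\<Sum>k<n. (a k)\<^sup>2)"
proof -
  have s: "0 \<le> (\<Sum>k<n. (a k)\<^sup>2)" by (simp add: sum_nonneg)
  have m: "(\<lambda>w. \<Sum>k<n. a k * w k) \<in> borel_measurable gauss_seq" by measurable
  note d = gauss_seq.distr_eq_scaled_normal[OF m s char_gauss_seq]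
  show "integrable gauss_seq (\<lambda>w. \<Sum>k<n. a k * w k)"
    "(\<integral>w. \<bar>\<Sum>k<n. a k * w k\<bar> \<partial>gauss_seq) \<le> sqrt (\<Sum>k<n. (a k)\<^sup>2)"
    using gauss_seq.scaled_normal_moments[OF m s d] by auto
qed

section \<open>Measurability for the seminorm topology of integrable functions\<close>

lemma L1_borel_sets: "L1_open U \<Longrightarrow> U \<in> sets L1_borel"
  and space_L1_borel: "space L1_borel = {f. integrable lborel f}"
proof -
  have *: "{U. L1_open U} \<subseteq> Pow {f. integrable lborel f}" by (auto simp: L1_open_def)
  show "L1_open U \<Longrightarrow> U \<in> sets L1_borel" unfolding L1_borel_def using * by (simp add: sigma_sets.Basic)
  show "space L1_borel = {f. integrable lborel f}" unfolding L1_borel_def using * by (rule space_measure_of)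
qed

lemma L1_openE:
  assumes "L1_open U" "f \<in> U"
  obtains e where "e > 0" "\<And>g. integrable lborel g \<Longrightarrow> (\<integral>t. \<bar>g t - f t\<bar> \<partial>lborel) < e \<Longrightarrow> g \<in> U"
  using assms unfolding L1_open_def by blast

lemma measurable_L1_borelI:
  assumes "\<And>w. w \<in> space M \<Longrightarrow> integrable lborel (W w)"
    and "\<And>U. L1_open U \<Longrightarrow> W -` U \<inter> space M \<in> sets M"
  shows "W \<in> measurable M L1_borel"
  unfolding L1_borel_def using assms
  by (intro measurable_measure_of) (auto simp: L1_open_def)

text \<open>Preimages of open sets are open for the seminorm, hence generators of
  \<open>L1_borel\<close>. The radius is taken with \<open>|C| + 1\<close> so that it is positive
  for every \<open>C\<close>.\<close>

lemma L1_lipschitz_measurable: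
  fixes \<Phi> :: "(real \<Rightarrow> real) \<Rightarrow> real"
  assumes lip: "\<And>g h. integrable lborel g \<Longrightarrow> integrable lborel h \<Longrightarrow> \<bar>\<Phi> g - \<Phi> h\<bar> \<le> C * (\<integral>t. \<bar>g t - h t\<bar> \<partial>lborel)"
  shows "\<Phi> \<in> borel_measurable L1_borel"
proof (rule borel_measurableI)
  fix V :: "real set" assume V: "open V"
  have "L1_open (\<Phi> -` V \<inter> {f. integrable lborel f})"
    unfolding L1_open_def
  proof safe
    fix f assume f: "\<Phi> f \<in> V" "integrable lborel f"
    obtain e where e: "e > 0" "\<And>y. \<bar>y - \<Phi> f\<bar> < e \<Longrightarrow> y \<in> V"
      using V f(1) by (metis dist_real_def open_dist)
    show "\<exists>e>0. \<forall>g. integrable lborel g \<longrightarrow> (\<integral>t. \<bar>g t - f t\<bar> \<partial>lborel) < e \<longrightarrow> g \<in> \<Phi> -` V \<inter> {f. integrable lborel f}"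
    proof (intro exI conjI allI impI)
      show "0 < e / (\<bar>C\<bar> + 1)" using e by simp
      fix g assume g: "integrable lborel g" "(\<integral>t. \<bar>g t - f t\<bar> \<partial>lborel) < e / (\<bar>C\<bar> + 1)"
      have "\<bar>\<Phi> g - \<Phi> f\<bar> \<le> C * (\<integral>t. \<bar>g t - f t\<bar> \<partial>lborel)" by (rule lip[OF g(1) f(2)])
      also have "\<dots> \<le> (\<bar>C\<bar> + 1) * (\<integral>t. \<bar>g t - f t\<bar> \<partial>lborel)" by (intro mult_right_mono) auto
      also have "\<dots> < (\<bar>C\<bar> + 1) * (e / (\<bar>C\<bar> + 1))" by (intro mult_strict_left_mono g) simp
      also have "\<dots> = e" by simp
      finally show "g \<in> \<Phi> -` V \<inter> {f. integrable lborel f}" using e(2) g(1) by auto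
    qed
  qed
  then show "\<Phi> -` V \<inter> space L1_borel \<in> sets L1_borel"
    unfolding space_L1_borel by (rule L1_borel_sets)
qed

lemma L1_norm_measurable: "(\<lambda>g. \<integral>t. \<bar>g t\<bar> \<partial>lborel) \<in> borel_measurable L1_borel"
proof (rule L1_lipschitz_measurable[where C=1])
  fix g h :: "real \<Rightarrow> real" assume gh: "integrable lborel g" "integrable lborel h"
  have "\<bar>(\<integral>t. \<bar>g t\<bar> \<partial>lborel) - (\<integral>t. \<bar>h t\<bar> \<partial>lborel)\<bar> = \<bar>\<integral>t. \<bar>g t\<bar> - \<bar>h t\<bar> \<partial>lborel\<bar>" using gh by simp
  also have "\<dots> \<le> (\<integral>t. \<bar>g t - h t\<bar> \<partial>lborel)"
    using gh norm_integral_le_integral[of lborel "\<lambda>t. \<bar>g t\<bar> - \<bar>h t\<bar>" "\<lambda>t. \<bar>g t - h t\<bar>"] by auto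
  finally show "\<bar>(\<integral>t. \<bar>g t\<bar> \<partial>lborel) - (\<integral>t. \<bar>h t\<bar> \<partial>lborel)\<bar> \<le> 1 * (\<integral>t. \<bar>g t - h t\<bar> \<partial>lborel)" by simp
qed

lemma LinftyE:
  assumes "f \<in> Linfty"
  obtains C where "0 \<le> C" "AE t in lborel. \<bar>f t\<bar> \<le> C"
proof -
  from assms obtain C where "AE t in lborel. \<bar>f t\<bar> \<le> C" by (auto simp: Linfty_def)
  then have "AE t in lborel. \<bar>f t\<bar> \<le> \<bar>C\<bar>" by eventually_elim linarith
  with that[of "\<bar>C\<bar>"] show ?thesis by simp
qed

lemma Linfty_measurable [measurable_dest]: "f \<in> Linfty \<Longrightarrow> f \<in> borel_measurable borel"
  by (simp add: Linfty_def)

lemma integrable_Linfty_mult: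
  assumes f: "f \<in> Linfty" and g: "integrable lborel g"
  shows "integrable lborel (\<lambda>t. f t * g t)"
proof -
  obtain C where C: "0 \<le> C" "AE t in lborel. \<bar>f t\<bar> \<le> C" using LinftyE[OF f] .
  have [measurable]: "f \<in> borel_measurable borel" using f by (rule Linfty_measurable)
  have [measurable]: "g \<in> borel_measurable borel" using borel_measurable_integrable[OF g] by simp
  show ?thesis
  proof (rule Bochner_Integration.integrable_bound[OF integrable_mult_right[OF g, of C]])
    show "AE t in lborel. norm (f t * g t) \<le> norm (C * g t)"
      using C(2) by eventually_elim (use C(1) in \<open>auto simp: abs_mult intro: mult_right_mono\<close>)
  qed simp
qed

lemma abs_integral_Linfty_mult_le:
  assumes f: "f \<in> Linfty" and C: "0 \<le> C" "AE t in lborel. \<bar>f t\<bar> \<le> C" and g: "integrable lborel g"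
  shows "\<bar>\<integral>t. f t * g t \<partial>lborel\<bar> \<le> C * (\<integral>t. \<bar>g t\<bar> \<partial>lborel)"
proof -
  have "\<bar>\<integral>t. f t * g t \<partial>lborel\<bar> \<le> (\<integral>t. \<bar>f t * g t\<bar> \<partial>lborel)" by (rule integral_abs_bound)
  also have "\<dots> \<le> (\<integral>t. C * \<bar>g t\<bar> \<partial>lborel)"
  proof (rule integral_mono_AE)
    show "AE t in lborel. \<bar>f t * g t\<bar> \<le> C * \<bar>g t\<bar>"
      using C(2) by eventually_elim (auto simp: abs_mult intro: mult_right_mono)
  qed (use integrable_Linfty_mult[OF f g] g in auto)
  finally show ?thesis by simp
qed

lemma Linfty_functional_measurable:
  assumes f: "f \<in> Linfty"
  shows "(\<lambda>g. \<integral>t. f t * g t \<partial>lborel) \<in> borel_measurable L1_borel"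
proof -
  obtain C where C: "0 \<le> C" "AE t in lborel. \<bar>f t\<bar> \<le> C" using LinftyE[OF f] .
  show ?thesis
  proof (rule L1_lipschitz_measurable[where C=C])
    fix g h :: "real \<Rightarrow> real" assume gh: "integrable lborel g" "integrable lborel h"
    have "(\<integral>t. f t * g t \<partial>lborel) - (\<integral>t. f t * h t \<partial>lborel) = (\<integral>t. f t * (g t - h t) \<partial>lborel)"
      using integrable_Linfty_mult[OF f gh(1)] integrable_Linfty_mult[OF f gh(2)] by (simp add: right_diff_distrib)
    with abs_integral_Linfty_mult_le[OF f C, of "\<lambda>t. g t - h t"] gh
    show "\<bar>(\<integral>t. f t * g t \<partial>lborel) - (\<integral>t. f t * h t \<partial>lborel)\<bar> \<le> C * (\<integral>t. \<bar>g t - h t\<bar> \<partial>lborel)" by simp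
  qed
qed

lemma Linfty_add: "f \<in> Linfty \<Longrightarrow> g \<in> Linfty \<Longrightarrow> (\<lambda>t. f t + g t) \<in> Linfty"
  and Linfty_diff: "f \<in> Linfty \<Longrightarrow> g \<in> Linfty \<Longrightarrow> (\<lambda>t. f t - g t) \<in> Linfty"
proof -
  assume fg: "f \<in> Linfty" "g \<in> Linfty"
  then have m: "f \<in> borel_measurable borel" "g \<in> borel_measurable borel" by (auto intro: Linfty_measurable)
  from fg obtain C D where "AE t in lborel. \<bar>f t\<bar> \<le> C" "AE t in lborel. \<bar>g t\<bar> \<le> D" by (auto simp: Linfty_def)
  then have "AE t in lborel. \<bar>f t + g t\<bar> \<le> C + D" "AE t in lborel. \<bar>f t - g t\<bar> \<le> C + D"
    by (eventually_elim, linarith)+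
  then show "(\<lambda>t. f t + g t) \<in> Linfty" "(\<lambda>t. f t - g t) \<in> Linfty"
    unfolding Linfty_def by (blast intro: borel_measurable_add borel_measurable_diff m)+
qed

text \<open>The map factors through real sequences: sending \<open>y\<close> to the combination of
  the \<open>g k\<close> with coefficients \<open>y k\<close> is continuous for the product
  topology, and coordinatewise measurability gives measurability into its Borel sets.\<close>

lemma measurable_L1_borel_sum:
  assumes c [measurable]: "\<And>k. c k \<in> borel_measurable M" and g: "\<And>k. integrable lborel (g k)"
  shows "(\<lambda>w t. \<Sum>k<n::nat. c k w * g k t) \<in> measurable M L1_borel"
proof (rule measurable_L1_borelI)
  show "integrable lborel (\<lambda>t. \<Sum>k<n. c k w * g k t)" for w using g by simp
  fix U assume U: "L1_open U"
  define O' where "O' = {y :: nat \<Rightarrow> real. (\<lambda>t. \<Sum>k<n. y k * g k t) \<in> U}"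
  have "open O'"
  proof (subst open_subopen, intro ballI)
    fix y assume "y \<in> O'"
    then have "(\<lambda>t. \<Sum>k<n. y k * g k t) \<in> U" by (simp add: O'_def)
    from L1_openE[OF U this] obtain e where e: "e > 0" "\<And>h. integrable lborel h \<Longrightarrow> (\<integral>t. \<bar>h t - (\<Sum>k<n. y k * g k t)\<bar> \<partial>lborel) < e \<Longrightarrow> h \<in> U"
      by metis
    define Q where "Q = {z :: nat \<Rightarrow> real. (\<Sum>k<n. \<bar>z k - y k\<bar> * (\<integral>t. \<bar>g k t\<bar> \<partial>lborel)) < e}"
    have "open Q" unfolding Q_def
      by (intro open_Collect_less continuous_intros) (auto intro!: continuous_on_product_coordinates)
    moreover have "y \<in> Q" using e by (simp add: Q_def)
    moreover have "Q \<subseteq> O'"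
    proof
      fix z assume z: "z \<in> Q"
      have "(\<integral>t. \<bar>(\<Sum>k<n. z k * g k t) - (\<Sum>k<n. y k * g k t)\<bar> \<partial>lborel) \<le> (\<integral>t. (\<Sum>k<n. \<bar>z k - y k\<bar> * \<bar>g k t\<bar>) \<partial>lborel)"
      proof (rule integral_mono)
        fix t
        have "(\<Sum>k<n. z k * g k t) - (\<Sum>k<n. y k * g k t) = (\<Sum>k<n. (z k - y k) * g k t)"
          by (simp add: sum_subtractf left_diff_distrib)
        also have "\<bar>\<dots>\<bar> \<le> (\<Sum>k<n. \<bar>z k - y k\<bar> * \<bar>g k t\<bar>)"
          by (rule order_trans[OF sum_abs]) (simp add: abs_mult)
        finally show "\<bar>(\<Sum>k<n. z k * g k t) - (\<Sum>k<n. y k * g k t)\<bar> \<le> (\<Sum>k<n. \<bar>z k - y k\<bar> * \<bar>g k t\<bar>)" .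
      qed (use g in auto)
      also have "\<dots> = (\<Sum>k<n. \<bar>z k - y k\<bar> * (\<integral>t. \<bar>g k t\<bar> \<partial>lborel))"
        using g by (simp add: Bochner_Integration.integral_sum)
      also have "\<dots> < e" using z by (simp add: Q_def)
      finally show "z \<in> O'" unfolding O'_def using g by (simp add: e(2))
    qed
    ultimately show "\<exists>T. open T \<and> y \<in> T \<and> T \<subseteq> O'" by blast
  qed
  moreover have "(\<lambda>w k. c k w) \<in> borel_measurable M"
    by (rule measurable_coordinatewise_then_product) simp
  ultimately have "(\<lambda>w k. c k w) -` O' \<inter> space M \<in> sets M" by (intro measurable_sets) auto
  then show "(\<lambda>w t. \<Sum>k<n. c k w * g k t) -` U \<inter> space M \<in> sets M"
    by (simp add: O'_def vimage_def)
qed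

text \<open>\<open>B m\<close> collects the points of \<open>U\<close> that have a ball of radius
  more than \<open>1 / (m + 1)\<close> inside \<open>U\<close>. The limit lies in \<open>U\<close>
  iff, for some \<open>m\<close>, the approximations are eventually in \<open>B m\<close>, which is
  a countable expression.\<close>

lemma measurable_L1_borel_limit:
  assumes V: "\<And>i. V i \<in> measurable M L1_borel" and W: "\<And>w. w \<in> space M \<Longrightarrow> integrable lborel (W w)"
    and lim: "\<And>w. w \<in> space M \<Longrightarrow> (\<lambda>i. \<integral>t. \<bar>V i w t - W w t\<bar> \<partial>lborel) \<longlonglongrightarrow> 0"
  shows "W \<in> measurable M L1_borel"
proof (rule measurable_L1_borelI[OF W])
  fix U assume U: "L1_open U"
  \<comment> \<open>The strict bound on the radius leaves room to move the centre, which makes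
    \<open>B m\<close> itself open.\<close>
  define B where "B m = {f \<in> U. \<exists>e > inverse (real (Suc m)). \<forall>g. integrable lborel g \<longrightarrow> (\<integral>t. \<bar>g t - f t\<bar> \<partial>lborel) < e \<longrightarrow> g \<in> U}" for m
  have tri: "(\<integral>t. \<bar>g t - f t\<bar> \<partial>lborel) \<le> (\<integral>t. \<bar>g t - h t\<bar> \<partial>lborel) + (\<integral>t. \<bar>h t - f t\<bar> \<partial>lborel)"
    if "integrable lborel f" "integrable lborel g" "integrable lborel h" for f g h :: "real \<Rightarrow> real"
  proof -
    have "(\<integral>t. \<bar>g t - f t\<bar> \<partial>lborel) \<le> (\<integral>t. \<bar>g t - h t\<bar> + \<bar>h t - f t\<bar> \<partial>lborel)"
      using that by (intro integral_mono) auto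
    then show ?thesis using that by simp
  qed
  have Vint: "integrable lborel (V i w)" if "w \<in> space M" for i w
    using measurable_space[OF V that] by (simp add: space_L1_borel)
  have "L1_open (B m)" for m
    unfolding L1_open_def
  proof safe
    fix f assume f: "f \<in> B m"
    then show fi: "integrable lborel f" using U by (auto simp: B_def L1_open_def)
    from f obtain e where e: "e > inverse (real (Suc m))" "\<And>g. integrable lborel g \<Longrightarrow> (\<integral>t. \<bar>g t - f t\<bar> \<partial>lborel) < e \<Longrightarrow> g \<in> U"
      unfolding B_def by blast
    define d where "d = (e - inverse (real (Suc m))) / 2"
    have d: "d > 0" "e - d > inverse (real (Suc m))" 
    proof -
      have "0 < (e - c) / 2 \<and> e - (e - c) / 2 > c" if "e > c" for c :: real using that by (simp add: field_simps)
      from this[OF e(1)] show "d > 0" "e - d > inverse (real (Suc m))" unfolding d_def by auto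
    qed
    show "\<exists>e>0. \<forall>g. integrable lborel g \<longrightarrow> (\<integral>t. \<bar>g t - f t\<bar> \<partial>lborel) < e \<longrightarrow> g \<in> B m"
    proof (intro exI[of _ d] conjI allI impI d)
      fix g assume g: "integrable lborel g" "(\<integral>t. \<bar>g t - f t\<bar> \<partial>lborel) < d"
      have pos: "0 < inverse (real (Suc m))" by simp
      then have de: "d < e" using d(2) by linarith
      have "h \<in> U" if h: "integrable lborel h" "(\<integral>t. \<bar>h t - g t\<bar> \<partial>lborel) < e - d" for h
        using e(2)[OF h(1)] tri[OF fi h(1) g(1)] h(2) g(2) by linarith
      moreover have "g \<in> U" using e(2)[OF g(1)] g(2) de by linarith
      ultimately show "g \<in> B m" unfolding B_def using d(2) by blast
    qed
  qed
  then have [measurable]: "B m \<in> sets L1_borel" for m by (rule L1_borel_sets)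
  note [measurable] = V
  have "W -` U \<inter> space M = {w \<in> space M. \<exists>m. \<exists>J. \<forall>i\<in>{J..}. V i w \<in> B m}"
  proof (intro set_eqI iffI)
    fix w assume "w \<in> W -` U \<inter> space M"
    then have w: "w \<in> space M" "W w \<in> U" by auto
    obtain e where e: "e > 0" "\<And>g. integrable lborel g \<Longrightarrow> (\<integral>t. \<bar>g t - W w t\<bar> \<partial>lborel) < e \<Longrightarrow> g \<in> U"
      using L1_openE[OF U w(2)] by metis
    obtain m where m: "inverse (real (Suc m)) < e / 2" using reals_Archimedean[of "e/2"] e(1) by auto
    obtain J where J: "\<And>i. i \<ge> J \<Longrightarrow> \<bar>\<integral>t. \<bar>V i w t - W w t\<bar> \<partial>lborel\<bar> < e / 2"
      using LIMSEQ_D[OF lim[OF w(1)], of "e/2"] e(1) by auto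
    have "V i w \<in> B m" if i: "i \<ge> J" for i
    proof -
      have n: "(\<integral>t. \<bar>V i w t - W w t\<bar> \<partial>lborel) < e / 2" using J[OF i] by linarith
      then have "V i w \<in> U" using e Vint[OF w(1)] by simp
      moreover have "g \<in> U" if "integrable lborel g" "(\<integral>t. \<bar>g t - V i w t\<bar> \<partial>lborel) < e / 2" for g
        using e(2)[OF that(1)] tri[OF W[OF w(1)] that(1) Vint[OF w(1), of i]] that(2) n by linarith
      ultimately show ?thesis unfolding B_def using m by blast
    qed
    then show "w \<in> {w \<in> space M. \<exists>m. \<exists>J. \<forall>i\<in>{J..}. V i w \<in> B m}" using w by auto
  next
    fix w assume "w \<in> {w \<in> space M. \<exists>m. \<exists>J. \<forall>i\<in>{J..}. V i w \<in> B m}"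
    then obtain m J where w: "w \<in> space M" and B: "\<forall>i\<in>{J..}. V i w \<in> B m" by auto
    obtain J' where J': "\<And>i. i \<ge> J' \<Longrightarrow> \<bar>\<integral>t. \<bar>V i w t - W w t\<bar> \<partial>lborel\<bar> < inverse (real (Suc m))"
      using LIMSEQ_D[OF lim[OF w], of "inverse (real (Suc m))"] by auto
    define i where "i = max J J'"
    have "V i w \<in> B m" using B by (auto simp: i_def)
    then obtain e where e: "e > inverse (real (Suc m))" "\<And>g. integrable lborel g \<Longrightarrow> (\<integral>t. \<bar>g t - V i w t\<bar> \<partial>lborel) < e \<Longrightarrow> g \<in> U"
      unfolding B_def by blast
    have "(\<integral>t. \<bar>W w t - V i w t\<bar> \<partial>lborel) < e"
      using J'[of i] e(1) by (simp add: i_def abs_minus_commute abs_less_iff)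
    then show "w \<in> W -` U \<inter> space M" using e(2)[OF W[OF w]] w by blast
  qed
  also have "\<dots> = (\<Union>m. \<Union>J. \<Inter>i\<in>{J..}. V i -` B m \<inter> space M)" by auto
  also have "\<dots> \<in> sets M"
  proof -
    have "V i -` B m \<inter> space M \<in> sets M" for i m by (rule measurable_sets[OF V]) measurable
    then show ?thesis by (intro sets.countable_UN' sets.countable_INT') auto
  qed
  finally show "W -` U \<inter> space M \<in> sets M" .
qed

section \<open>The Gaussian series of a kernel\<close>

interpretation gauss_lborel: pair_sigma_finite gauss_seq lborel ..

text \<open>The root of the diagonal is the standard deviation at \<open>t\<close>. Its
  integrability makes the series converge in mean in \<open>L1\<close>, and \<open>K_dense\<close>
  makes the series recover the whole of \<open>K\<close>.\<close>

locale gaussian_series =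
  fixes K :: "real \<Rightarrow> real \<Rightarrow> real" and q :: "nat \<Rightarrow> real"
  assumes K: "psd_kernel K"
    and K_meas [measurable]: "\<And>t. (\<lambda>s. K s t) \<in> borel_measurable borel"
    and K_int: "integrable lborel (\<lambda>t. sqrt (K t t))"
    and K_dense: "\<And>s e. 0 < e \<Longrightarrow> \<exists>j. K s s - 2 * K s (q j) + K (q j) (q j) < e"
begin

abbreviation L :: "nat \<Rightarrow> real \<Rightarrow> real" where
  "L \<equiv> gs_coeff K q"

lemma L_meas [measurable]: "L k \<in> borel_measurable borel"
proof -
  have "(\<lambda>s. resid_kernel K q n s t) \<in> borel_measurable borel" for n t
  proof (induction n arbitrary: t)
    case (Suc n)
    note [measurable] = Suc
    show ?case by simp
  qed simp
  then show ?thesis unfolding gs_coeff_def[abs_def] by simp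
qed

lemma L_sums: "(\<lambda>k. L k s * L k t) sums K s t"
  by (rule gs_coeff_sums[OF K K_dense])

lemma L_sq_sums: "(\<lambda>k. (L k t)\<^sup>2) sums K t t"
  using L_sums[of t t] by (simp add: power2_eq_square)

lemma K_diag_nonneg: "0 \<le> K t t"
  by (rule psd_kernel_diag[OF K])

lemma K_diag_meas [measurable]: "(\<lambda>t. K t t) \<in> borel_measurable borel"
  by (rule borel_measurable_LIMSEQ_real[OF L_sq_sums[unfolded sums_def]]) measurable

lemma abs_L_le: "\<bar>L k t\<bar> \<le> sqrt (K t t)"
proof (rule real_le_rsqrt)
  have "(L k t)\<^sup>2 \<le> (\<Sum>j<Suc k. (L j t)\<^sup>2)" by (simp add: sum_nonneg)
  also have "\<dots> \<le> K t t" by (rule sum_gs_coeff_sq_le[OF K])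
  finally show "\<bar>L k t\<bar>\<^sup>2 \<le> K t t" by simp
qed

lemma L_int: "integrable lborel (L k)"
  by (rule Bochner_Integration.integrable_bound[OF K_int]) (auto simp: abs_L_le K_diag_nonneg)

definition G :: "nat \<Rightarrow> (nat \<Rightarrow> real) \<Rightarrow> real \<Rightarrow> real" where
  "G n w t = (\<Sum>k<n. L k t * w k)"

text \<open>Bound for the expected \<open>L1\<close> norm of the tail: the mean modulus of a centred
  normal variable is at most its standard deviation, here that of the tail at
  \<open>t\<close>.\<close>

definition \<rho> :: "nat \<Rightarrow> real" where
  "\<rho> n = (\<integral>t. sqrt (K t t - (\<Sum>k<n. (L k t)\<^sup>2)) \<partial>lborel)"

lemma resid_int: "integrable lborel (\<lambda>t. sqrt (K t t - (\<Sum>k<n. (L k t)\<^sup>2)))"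
  by (rule Bochner_Integration.integrable_bound[OF K_int])
     (auto simp: sum_gs_coeff_sq_le[OF K] sum_nonneg K_diag_nonneg)

lemma \<rho>_tendsto: "\<rho> \<longlonglongrightarrow> 0"
proof -
  have "(\<lambda>n. \<integral>t. sqrt (K t t - (\<Sum>k<n. (L k t)\<^sup>2)) \<partial>lborel) \<longlonglongrightarrow> (\<integral>t. 0 \<partial>(lborel :: real measure))"
  proof (rule integral_dominated_convergence[where w="\<lambda>t. sqrt (K t t)"])
    show "AE t in lborel. (\<lambda>n. sqrt (K t t - (\<Sum>k<n. (L k t)\<^sup>2))) \<longlonglongrightarrow> 0"
    proof (rule AE_I2)
      fix t
      have "(\<lambda>n. sqrt (K t t - (\<Sum>k<n. (L k t)\<^sup>2))) \<longlonglongrightarrow> sqrt (K t t - K t t)"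
        by (intro tendsto_intros L_sq_sums[unfolded sums_def])
      then show "(\<lambda>n. sqrt (K t t - (\<Sum>k<n. (L k t)\<^sup>2))) \<longlonglongrightarrow> 0" by simp
    qed
  qed (auto simp: sum_gs_coeff_sq_le[OF K] sum_nonneg K_int)
  then show ?thesis unfolding \<rho>_def by simp
qed

lemma G_meas [measurable]: "(\<lambda>(w, t). G n w t) \<in> borel_measurable (gauss_seq \<Otimes>\<^sub>M lborel)"
proof -
  have [measurable]: "(\<lambda>x. fst x k) \<in> borel_measurable (gauss_seq \<Otimes>\<^sub>M lborel)" for k
    by (rule measurable_compose[OF measurable_fst gauss_seq_coord])
  show ?thesis unfolding G_def split_beta' by measurable
qed

lemma G_int: "integrable (gauss_seq \<Otimes>\<^sub>M lborel) (\<lambda>(w, t). G n w t)"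
  and G_diff_int: "m \<le> n \<Longrightarrow> (\<integral>\<^sup>+x. ennreal \<bar>(\<lambda>(w, t). G n w t) x - (\<lambda>(w, t). G m w t) x\<bar> \<partial>(gauss_seq \<Otimes>\<^sub>M lborel)) \<le> ennreal (\<rho> m)"
proof -
  have *: "(\<integral>\<^sup>+x. ennreal \<bar>(\<lambda>(w, t). G n w t) x - (\<lambda>(w, t). G m w t) x\<bar> \<partial>(gauss_seq \<Otimes>\<^sub>M lborel)) \<le> ennreal (\<rho> m)"
    if "m \<le> n" for m n
  proof -
    have split: "(\<Sum>k<n. f k) = (\<Sum>k<m. f k) + (\<Sum>k\<in>{m..<n}. f k)" for f :: "nat \<Rightarrow> real"
    proof -
      have "{..<n} = {..<m} \<union> {m..<n}" using that by auto
      then have "sum f {..<n} = sum f ({..<m} \<union> {m..<n})" by (rule arg_cong)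
      also have "\<dots> = sum f {..<m} + sum f {m..<n}" by (rule sum.union_disjoint) auto
      finally show ?thesis .
    qed
    have "(\<integral>\<^sup>+x. ennreal \<bar>(\<lambda>(w, t). G n w t) x - (\<lambda>(w, t). G m w t) x\<bar> \<partial>(gauss_seq \<Otimes>\<^sub>M lborel))
       = (\<integral>\<^sup>+t. \<integral>\<^sup>+w. ennreal \<bar>G n w t - G m w t\<bar> \<partial>gauss_seq \<partial>lborel)"
      by (subst gauss_lborel.nn_integral_snd[symmetric]) auto
    also have "\<dots> \<le> (\<integral>\<^sup>+t. ennreal (sqrt (K t t - (\<Sum>k<m. (L k t)\<^sup>2))) \<partial>lborel)"
    proof (rule nn_integral_mono)
      fix t
      define a where "a k = (if k < m then 0 else L k t)" for k
      have e: "G n w t - G m w t = (\<Sum>k<n. a k * w k)" for w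
      proof -
        show ?thesis unfolding G_def split by (simp add: a_def)
      qed
      have "(\<integral>\<^sup>+w. ennreal \<bar>G n w t - G m w t\<bar> \<partial>gauss_seq) = ennreal (\<integral>w. \<bar>\<Sum>k<n. a k * w k\<bar> \<partial>gauss_seq)"
        unfolding e by (intro nn_integral_eq_integral integrable_abs integrable_gauss_sum) auto
      also have "\<dots> \<le> ennreal (sqrt (\<Sum>k<n. (a k)\<^sup>2))"
        by (intro ennreal_leI integral_abs_gauss_sum_le)
      also have "(\<Sum>k<n. (a k)\<^sup>2) \<le> K t t - (\<Sum>k<m. (L k t)\<^sup>2)"
      proof -
        have "(\<Sum>k<n. (a k)\<^sup>2) + (\<Sum>k<m. (L k t)\<^sup>2) = (\<Sum>k<n. (L k t)\<^sup>2)"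
          unfolding split by (simp add: a_def)
        then show ?thesis using sum_gs_coeff_sq_le[OF K, where n=n and q=q and s=t] by linarith
      qed
      then have "ennreal (sqrt (\<Sum>k<n. (a k)\<^sup>2)) \<le> ennreal (sqrt (K t t - (\<Sum>k<m. (L k t)\<^sup>2)))"
        by (intro ennreal_leI) simp
      finally show "(\<integral>\<^sup>+w. ennreal \<bar>G n w t - G m w t\<bar> \<partial>gauss_seq) \<le> ennreal (sqrt (K t t - (\<Sum>k<m. (L k t)\<^sup>2)))" .
    qed
    also have "\<dots> = ennreal (\<rho> m)"
      unfolding \<rho>_def by (rule nn_integral_eq_integral[OF resid_int]) (auto simp: sum_gs_coeff_sq_le[OF K])
    finally show ?thesis .
  qed
  show "m \<le> n \<Longrightarrow> (\<integral>\<^sup>+x. ennreal \<bar>(\<lambda>(w, t). G n w t) x - (\<lambda>(w, t). G m w t) x\<bar> \<partial>(gauss_seq \<Otimes>\<^sub>M lborel)) \<le> ennreal (\<rho> m)"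
    by (rule *)
  have "(\<integral>\<^sup>+x. ennreal \<bar>(\<lambda>(w, t). G n w t) x\<bar> \<partial>(gauss_seq \<Otimes>\<^sub>M lborel)) \<le> ennreal (\<rho> 0)"
    using *[of 0 n] by (simp add: G_def split_beta')
  then show "integrable (gauss_seq \<Otimes>\<^sub>M lborel) (\<lambda>(w, t). G n w t)"
    by (intro integrableI_bounded) (auto simp: real_norm_def intro: le_less_trans)
qed

lemma \<rho>_nonneg: "0 \<le> \<rho> n"
  unfolding \<rho>_def by (intro integral_nonneg_AE AE_I2) (simp add: sum_gs_coeff_sq_le[OF K])

text \<open>The partial sums are Cauchy in mean on the product space. The limit is taken pointwise
  along an almost everywhere convergent subsequence, and Fatou's lemma preserves the explicit bound
  \<open>\<rho> n\<close>.\<close>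

lemma G_L1_limit:
  obtains H where "integrable (gauss_seq \<Otimes>\<^sub>M lborel) H"
    "\<And>n. (\<integral>x. \<bar>(\<lambda>(w, t). G n w t) x - H x\<bar> \<partial>(gauss_seq \<Otimes>\<^sub>M lborel)) \<le> \<rho> n"
proof -
  let ?P = "gauss_seq \<Otimes>\<^sub>M (lborel :: real measure)"
  let ?g = "\<lambda>n. \<lambda>(w, t). G n w t"
  have le: "(LINT x|?P. norm (?g i x - ?g j x)) \<le> \<rho> m" if "m \<le> i" "i \<le> j" for i j m
  proof -
    have d: "decseq \<rho>"
      unfolding decseq_Suc_iff \<rho>_def
      by (intro allI integral_mono resid_int real_sqrt_le_mono) auto
    have "ennreal (LINT x|?P. norm (?g i x - ?g j x)) = (\<integral>\<^sup>+x. ennreal (norm (?g i x - ?g j x)) \<partial>?P)"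
      by (rule nn_integral_eq_integral[symmetric]) (intro integrable_norm Bochner_Integration.integrable_diff G_int, simp)
    also have "\<dots> = (\<integral>\<^sup>+x. ennreal \<bar>?g j x - ?g i x\<bar> \<partial>?P)"
      unfolding real_norm_def by (rule nn_integral_cong, rule arg_cong[where f=ennreal], rule abs_minus_commute)
    also have "\<dots> \<le> ennreal (\<rho> i)" by (rule G_diff_int[OF that(2)])
    also have "\<dots> \<le> ennreal (\<rho> m)" using d that(1) by (intro ennreal_leI) (auto simp: decseq_def)
    finally show ?thesis by (subst (asm) ennreal_le_iff) (auto simp: \<rho>_nonneg)
  qed
  have cauchy: "\<exists>N. \<forall>i\<ge>N. \<forall>j\<ge>N. (LINT x|?P. norm (?g i x - ?g j x)) < e" if e: "e > 0" for e
  proof -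
    have "\<forall>\<^sub>F n in sequentially. \<rho> n < e" using \<rho>_tendsto e by (rule order_tendstoD)
    then obtain N where N: "\<rho> N < e" by (auto simp: eventually_sequentially)
    have "(LINT x|?P. norm (?g i x - ?g j x)) < e" if "i \<ge> N" "j \<ge> N" for i j
    proof (cases "i \<le> j")
      case True
      then show ?thesis using le[OF that(1) True] N by linarith
    next
      case False
      have "(LINT x|?P. norm (?g i x - ?g j x)) = (LINT x|?P. norm (?g j x - ?g i x))"
        by (rule Bochner_Integration.integral_cong[OF refl norm_minus_commute])
      then show ?thesis using le[OF that(2), of i] False N by linarith
    qed
    then show ?thesis by blast
  qed
  obtain r where r: "strict_mono r" and ae: "AE x in ?P. Cauchy (\<lambda>i. ?g (r i) x)"
    using cauchy_L1_AE_cauchy_subseq[OF G_int cauchy] by blast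
  define H where "H x = lim (\<lambda>i. ?g (r i) x)" for x
  have H_meas [measurable]: "H \<in> borel_measurable ?P"
    unfolding H_def by (rule borel_measurable_lim_metric) measurable
  have nn: "(\<integral>\<^sup>+x. ennreal \<bar>?g n x - H x\<bar> \<partial>?P) \<le> ennreal (\<rho> n)" for n
  proof -
    have "(\<integral>\<^sup>+x. ennreal \<bar>?g n x - H x\<bar> \<partial>?P) = (\<integral>\<^sup>+x. liminf (\<lambda>i. ennreal \<bar>?g (r i) x - ?g n x\<bar>) \<partial>?P)"
    proof (rule nn_integral_cong_AE)
      show "AE x in ?P. ennreal \<bar>?g n x - H x\<bar> = liminf (\<lambda>i. ennreal \<bar>?g (r i) x - ?g n x\<bar>)"
        using ae
      proof eventually_elim
        fix x assume "Cauchy (\<lambda>i. ?g (r i) x)"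
        then have "(\<lambda>i. ?g (r i) x) \<longlonglongrightarrow> H x"
          unfolding H_def by (intro convergent_LIMSEQ_iff[THEN iffD1] Cauchy_convergent)
        then have "(\<lambda>i. ennreal \<bar>?g (r i) x - ?g n x\<bar>) \<longlonglongrightarrow> ennreal \<bar>H x - ?g n x\<bar>"
          by (intro tendsto_intros tendsto_ennrealI)
        then show "ennreal \<bar>?g n x - H x\<bar> = liminf (\<lambda>i. ennreal \<bar>?g (r i) x - ?g n x\<bar>)"
          by (subst lim_imp_Liminf) (auto simp: abs_minus_commute)
      qed
    qed
    also have "\<dots> \<le> liminf (\<lambda>i. \<integral>\<^sup>+x. ennreal \<bar>?g (r i) x - ?g n x\<bar> \<partial>?P)"
      by (rule nn_integral_liminf) measurable
    also have "\<dots> \<le> limsup (\<lambda>i. \<integral>\<^sup>+x. ennreal \<bar>?g (r i) x - ?g n x\<bar> \<partial>?P)"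
      by (rule Liminf_le_Limsup) simp
    also have "\<dots> \<le> ennreal (\<rho> n)"
    proof (rule Limsup_bounded)
      have "n \<le> r i" if "n \<le> i" for i using seq_suble[OF r, of i] that by simp
      then show "\<forall>\<^sub>F i in sequentially. (\<integral>\<^sup>+x. ennreal \<bar>?g (r i) x - ?g n x\<bar> \<partial>?P) \<le> ennreal (\<rho> n)"
        unfolding eventually_sequentially using G_diff_int by blast
    qed
    finally show ?thesis .
  qed
  have i: "integrable ?P (\<lambda>x. ?g n x - H x)" for n
    using nn[of n] by (intro integrableI_bounded) (auto simp: real_norm_def intro: le_less_trans)
  have "integrable ?P (\<lambda>x. ?g 0 x - (?g 0 x - H x))"
    by (intro Bochner_Integration.integrable_diff G_int i)
  then have "integrable ?P H" by simp
  moreover have "(\<integral>x. \<bar>?g n x - H x\<bar> \<partial>?P) \<le> \<rho> n" for n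
  proof -
    have "ennreal (\<integral>x. \<bar>?g n x - H x\<bar> \<partial>?P) = (\<integral>\<^sup>+x. ennreal \<bar>?g n x - H x\<bar> \<partial>?P)"
      using i[of n] by (intro nn_integral_eq_integral[symmetric]) auto
    also note nn[of n]
    finally show ?thesis by (subst (asm) ennreal_le_iff) (auto simp: \<rho>_nonneg)
  qed
  ultimately show thesis by (rule that)
qed

lemma G_section_int: "integrable lborel (G n w)"
  unfolding G_def using L_int by simp

text \<open>Only outside a null set \<open>Z\<close> are the sections of the product limit known to
  be integrable and to be \<open>L1\<close> limits along a subsequence. On \<open>Z\<close> the
  value of \<open>W\<close> is the zero function, so that \<open>W\<close> takes its values in the
  space everywhere.\<close>

lemma G_L1_valued_limit:
  obtains W where "W \<in> measurable gauss_seq L1_borel"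
    "\<And>n. integrable gauss_seq (\<lambda>w. \<integral>t. \<bar>G n w t - W w t\<bar> \<partial>lborel)"
    "\<And>n. (\<integral>w. \<integral>t. \<bar>G n w t - W w t\<bar> \<partial>lborel \<partial>gauss_seq) \<le> \<rho> n"
proof -
  let ?P = "gauss_seq \<Otimes>\<^sub>M (lborel :: real measure)"
  obtain H where Hi: "integrable ?P H"
    and Hd: "\<And>n. (\<integral>x. \<bar>(\<lambda>(w, t). G n w t) x - H x\<bar> \<partial>?P) \<le> \<rho> n" using G_L1_limit by blast
  define u where "u n w = (\<integral>t. \<bar>G n w t - H (w, t)\<bar> \<partial>lborel)" for n w
  have di: "integrable ?P (\<lambda>(w, t). \<bar>G n w t - H (w, t)\<bar>)" for n
    using integrable_abs[OF Bochner_Integration.integrable_diff[OF G_int[of n] Hi]] by (simp add: split_beta')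
  have ui: "integrable gauss_seq (u n)" for n
    unfolding u_def by (rule gauss_lborel.integrable_fst[OF di])
  have ule: "(\<integral>w. u n w \<partial>gauss_seq) \<le> \<rho> n" for n
    unfolding u_def using gauss_lborel.integral_fst[OF di, of n] Hd[of n] by (simp add: split_beta')
  have u0: "0 \<le> u n w" for n w unfolding u_def by simp
  have "(\<lambda>n. \<integral>w. norm (u n w) \<partial>gauss_seq) \<longlonglongrightarrow> 0"
    by (rule tendsto_sandwich[OF _ _ tendsto_const \<rho>_tendsto]) (auto simp: u0 ule intro!: always_eventually)
  from tendsto_L1_AE_subseq[OF ui this] obtain r where r: "strict_mono r" "AE w in gauss_seq. (\<lambda>n. u (r n) w) \<longlonglongrightarrow> 0" by blast
  have "AE w in gauss_seq. integrable lborel (\<lambda>t. H (w, t))"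
    by (rule gauss_lborel.AE_integrable_fst'[OF Hi])
  with r(2) have "AE w in gauss_seq. (\<lambda>n. u (r n) w) \<longlonglongrightarrow> 0 \<and> integrable lborel (\<lambda>t. H (w, t))"
    by eventually_elim simp
  then obtain Z where Z: "Z \<in> null_sets gauss_seq"
    "\<And>w. w \<in> space gauss_seq \<Longrightarrow> w \<notin> Z \<Longrightarrow> (\<lambda>n. u (r n) w) \<longlonglongrightarrow> 0 \<and> integrable lborel (\<lambda>t. H (w, t))"
  proof (rule AE_E)
    fix N assume "{w \<in> space gauss_seq. \<not> ((\<lambda>n. u (r n) w) \<longlonglongrightarrow> 0 \<and> integrable lborel (\<lambda>t. H (w, t)))} \<subseteq> N"
      "emeasure gauss_seq N = 0" "N \<in> sets gauss_seq"
    then show thesis using that[of N] by blast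
  qed
  define W where "W w = (if w \<in> Z then (\<lambda>_. 0) else (\<lambda>t. H (w, t)))" for w
  have ZM [measurable]: "Z \<in> sets gauss_seq" using Z(1) by auto
  have W_meas: "W \<in> measurable gauss_seq L1_borel"
  proof (rule measurable_L1_borel_limit)
    \<comment> \<open>Killing the coefficients on \<open>Z\<close> makes these finite sums converge
      to \<open>W\<close> there as well.\<close>
    show "(\<lambda>w t. \<Sum>k<r i. (indicator (- Z) w * w k) * L k t) \<in> measurable gauss_seq L1_borel" for i
    proof (rule measurable_L1_borel_sum[OF _ L_int])
      show "(\<lambda>w. indicator (- Z) w * w k) \<in> borel_measurable gauss_seq" for k
      proof -
        have "(\<lambda>w. (1 - indicator Z w) * w k) \<in> borel_measurable gauss_seq" by measurable
        then show ?thesis by (simp add: indicator_compl)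
      qed
    qed
    show "integrable lborel (W w)" if "w \<in> space gauss_seq" for w
      using Z(2)[OF that] by (auto simp: W_def)
    show "(\<lambda>i. \<integral>t. \<bar>(\<Sum>k<r i. indicator (- Z) w * w k * L k t) - W w t\<bar> \<partial>lborel) \<longlonglongrightarrow> 0"
      if "w \<in> space gauss_seq" for w
      using Z(2)[OF that] by (cases "w \<in> Z") (auto simp: W_def u_def G_def mult.commute)
  qed
  have AEW: "AE w in gauss_seq. (\<integral>t. \<bar>G n w t - W w t\<bar> \<partial>lborel) = u n w" for n
    using AE_not_in[OF Z(1)] by eventually_elim (simp add: W_def u_def)
  have mW: "(\<lambda>w. \<integral>t. \<bar>G n w t - W w t\<bar> \<partial>lborel) \<in> borel_measurable gauss_seq" for n
  proof -
    have "(\<lambda>w. indicator (- Z) w * u n w + indicator Z w * (\<integral>t. \<bar>G n w t\<bar> \<partial>lborel)) \<in> borel_measurable gauss_seq"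
    proof -
      have "(\<lambda>w. (1 - indicator Z w) * u n w + indicator Z w * (\<integral>t. \<bar>G n w t\<bar> \<partial>lborel)) \<in> borel_measurable gauss_seq"
        using borel_measurable_integrable[OF ui[of n]] by measurable
      then show ?thesis by (simp add: indicator_compl)
    qed
    moreover have "indicator (- Z) w * u n w + indicator Z w * (\<integral>t. \<bar>G n w t\<bar> \<partial>lborel) = (\<integral>t. \<bar>G n w t - W w t\<bar> \<partial>lborel)" for w
      by (cases "w \<in> Z") (auto simp: W_def u_def)
    ultimately show ?thesis by simp
  qed
  show thesis
  proof (rule that[OF W_meas])
    show "integrable gauss_seq (\<lambda>w. \<integral>t. \<bar>G n w t - W w t\<bar> \<partial>lborel)" for n
      using integrable_cong_AE[OF mW borel_measurable_integrable[OF ui] AEW] ui by blast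
    show "(\<integral>w. \<integral>t. \<bar>G n w t - W w t\<bar> \<partial>lborel \<partial>gauss_seq) \<le> \<rho> n" for n
      using integral_cong_AE[OF mW borel_measurable_integrable[OF ui] AEW] ule[of n] by simp
  qed
qed

end

section \<open>Covariance form and law of the limit\<close>

lemma lborel_pair_product:
  fixes F G :: "real \<Rightarrow> real"
  assumes F: "integrable lborel F" and G: "integrable lborel G"
  shows "integrable (lborel \<Otimes>\<^sub>M lborel) (\<lambda>x. F (fst x) * G (snd x))"
    and "(\<integral>x. F (fst x) * G (snd x) \<partial>(lborel \<Otimes>\<^sub>M lborel)) = (\<integral>t. F t \<partial>lborel) * (\<integral>t. G t \<partial>lborel)"
proof -
  have [measurable]: "F \<in> borel_measurable borel" "G \<in> borel_measurable borel"
    using borel_measurable_integrable[OF F] borel_measurable_integrable[OF G] by auto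
  show i: "integrable (lborel \<Otimes>\<^sub>M lborel) (\<lambda>x. F (fst x) * G (snd x))"
  proof (rule lborel_pair.Fubini_integrable)
    have "integrable lborel (\<lambda>x. \<bar>F x\<bar> * (\<integral>t. \<bar>G t\<bar> \<partial>lborel))"
      by (intro integrable_mult_left integrable_abs F)
    then show "integrable lborel (\<lambda>x. \<integral>y. norm (F (fst (x, y)) * G (snd (x, y))) \<partial>lborel)"
      by (simp add: abs_mult)
    show "AE x in lborel. integrable lborel (\<lambda>y. F (fst (x, y)) * G (snd (x, y)))"
      using G by (intro AE_I2) simp
  qed simp
  show "(\<integral>x. F (fst x) * G (snd x) \<partial>(lborel \<Otimes>\<^sub>M lborel)) = (\<integral>t. F t \<partial>lborel) * (\<integral>t. G t \<partial>lborel)"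
    using lborel_pair.integral_fst'[OF i] by simp
qed

context gaussian_series
begin

definition coef :: "(real \<Rightarrow> real) \<Rightarrow> nat \<Rightarrow> real" where
  "coef f k = (\<integral>t. f t * L k t \<partial>lborel)"

definition Q :: "(real \<Rightarrow> real) \<Rightarrow> (real \<Rightarrow> real) \<Rightarrow> real" where
  "Q f g = (\<integral>x. f (fst x) * g (snd x) * K (fst x) (snd x) \<partial>(lborel \<Otimes>\<^sub>M lborel))"

text \<open>Measurability of \<open>K\<close> is assumed in the first variable for fixed second one;
  the series of products of one-variable functions gives it jointly.\<close>

lemma K_meas2 [measurable]: "(\<lambda>x. K (fst x) (snd x)) \<in> borel_measurable (lborel \<Otimes>\<^sub>M lborel)"
  by (rule borel_measurable_LIMSEQ_real[OF L_sums[unfolded sums_def]]) measurable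

text \<open>Partial sums of the kernel series are dominated by
  \<open>sqrt (K s s) * sqrt (K t t)\<close>, a product of integrable functions of one variable, so
  summation and integration commute.\<close>

lemma coef_sums_Q:
  assumes f: "f \<in> Linfty" and g: "g \<in> Linfty"
  shows "(\<lambda>k. coef f k * coef g k) sums Q f g"
proof -
  have [measurable]: "f \<in> borel_measurable borel" "g \<in> borel_measurable borel"
    using f g by (auto intro: Linfty_measurable)
  have fL: "integrable lborel (\<lambda>t. f t * L k t)" "integrable lborel (\<lambda>t. g t * L k t)" for k
    by (intro integrable_Linfty_mult f g L_int)+
  have fK: "integrable lborel (\<lambda>t. \<bar>f t * sqrt (K t t)\<bar>)" "integrable lborel (\<lambda>t. \<bar>g t * sqrt (K t t)\<bar>)"
    by (intro integrable_abs integrable_Linfty_mult f g K_int)+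
  have "(\<Sum>k<n. coef f k * coef g k) = (\<integral>x. f (fst x) * g (snd x) * (\<Sum>k<n. L k (fst x) * L k (snd x)) \<partial>(lborel \<Otimes>\<^sub>M lborel))" for n
  proof -
    have "(\<Sum>k<n. coef f k * coef g k) = (\<Sum>k<n. \<integral>x. (f (fst x) * L k (fst x)) * (g (snd x) * L k (snd x)) \<partial>(lborel \<Otimes>\<^sub>M lborel))"
      unfolding coef_def lborel_pair_product(2)[OF fL] ..
    also have "\<dots> = (\<integral>x. (\<Sum>k<n. (f (fst x) * L k (fst x)) * (g (snd x) * L k (snd x))) \<partial>(lborel \<Otimes>\<^sub>M lborel))"
      by (rule Bochner_Integration.integral_sum[symmetric]) (rule lborel_pair_product(1)[OF fL])
    finally show ?thesis by (simp add: sum_distrib_left mult_ac)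
  qed
  moreover have "(\<lambda>n. \<integral>x. f (fst x) * g (snd x) * (\<Sum>k<n. L k (fst x) * L k (snd x)) \<partial>(lborel \<Otimes>\<^sub>M lborel)) \<longlonglongrightarrow> Q f g"
    unfolding Q_def
  proof (rule integral_dominated_convergence[where w="\<lambda>x. \<bar>f (fst x) * sqrt (K (fst x) (fst x))\<bar> * \<bar>g (snd x) * sqrt (K (snd x) (snd x))\<bar>"])
    show "integrable (lborel \<Otimes>\<^sub>M lborel) (\<lambda>x. \<bar>f (fst x) * sqrt (K (fst x) (fst x))\<bar> * \<bar>g (snd x) * sqrt (K (snd x) (snd x))\<bar>)"
      by (rule lborel_pair_product(1)[OF fK])
    show "AE x in lborel \<Otimes>\<^sub>M lborel. (\<lambda>n. f (fst x) * g (snd x) * (\<Sum>k<n. L k (fst x) * L k (snd x)))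
        \<longlonglongrightarrow> f (fst x) * g (snd x) * K (fst x) (snd x)"
      by (intro AE_I2 tendsto_intros L_sums[unfolded sums_def])
    show "AE x in lborel \<Otimes>\<^sub>M lborel. norm (f (fst x) * g (snd x) * (\<Sum>k<n. L k (fst x) * L k (snd x)))
      \<le> \<bar>f (fst x) * sqrt (K (fst x) (fst x))\<bar> * \<bar>g (snd x) * sqrt (K (snd x) (snd x))\<bar>" for n
    proof (rule AE_I2)
      fix x
      have "\<bar>f (fst x) * g (snd x)\<bar> * \<bar>\<Sum>k<n. L k (fst x) * L k (snd x)\<bar>
        \<le> \<bar>f (fst x) * g (snd x)\<bar> * (sqrt (K (fst x) (fst x)) * sqrt (K (snd x) (snd x)))"
        by (intro mult_left_mono abs_sum_gs_coeff_le[OF K]) simp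
      then show "norm (f (fst x) * g (snd x) * (\<Sum>k<n. L k (fst x) * L k (snd x)))
        \<le> \<bar>f (fst x) * sqrt (K (fst x) (fst x))\<bar> * \<bar>g (snd x) * sqrt (K (snd x) (snd x))\<bar>"
        using K_diag_nonneg by (simp add: abs_mult mult_ac)
    qed
  qed measurable
  ultimately show ?thesis unfolding sums_def by simp
qed

lemma integral_Linfty_G:
  assumes f: "f \<in> Linfty"
  shows "(\<integral>t. f t * G n w t \<partial>lborel) = (\<Sum>k<n. coef f k * w k)"
proof -
  have "(\<integral>t. f t * G n w t \<partial>lborel) = (\<integral>t. (\<Sum>k<n. f t * L k t * w k) \<partial>lborel)"
    by (simp add: G_def sum_distrib_left mult.assoc)
  also have "\<dots> = (\<Sum>k<n. (\<integral>t. f t * L k t * w k \<partial>lborel))"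
    by (intro Bochner_Integration.integral_sum integrable_mult_left integrable_Linfty_mult f L_int)
  finally show ?thesis by (simp add: coef_def)
qed

text \<open>\<open>N\<close> is the law of the \<open>L1\<close>-valued limit. Each functional is a
  limit in mean of finite Gaussian sums, hence normal with variance \<open>Q f f\<close>. The last
  clause allows the law of the norm to be computed on partial sums.\<close>

theorem gaussian_L1_law:
  obtains N :: "(real \<Rightarrow> real) measure" where "prob_space N" "sets N = sets L1_borel"
    "centered_gaussian_L1 N (\<lambda>w. w)"
    "\<And>f g. f \<in> Linfty \<Longrightarrow> g \<in> Linfty \<Longrightarrow>
       covariance N (\<lambda>w. \<integral>t. f t * w t \<partial>lborel) (\<lambda>w. \<integral>t. g t * w t \<partial>lborel) = Q f g"
    "\<And>u n. norm ((\<integral>w. iexp (u * (\<integral>t. \<bar>w t\<bar> \<partial>lborel)) \<partial>N) - (\<integral>w. iexp (u * (\<integral>t. \<bar>G n w t\<bar> \<partial>lborel)) \<partial>gauss_seq)) \<le> \<bar>u\<bar> * \<rho> n"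
proof -
  obtain W where W [measurable]: "W \<in> measurable gauss_seq L1_borel"
    and di: "\<And>n. integrable gauss_seq (\<lambda>w. \<integral>t. \<bar>G n w t - W w t\<bar> \<partial>lborel)"
    and dle: "\<And>n. (\<integral>w. \<integral>t. \<bar>G n w t - W w t\<bar> \<partial>lborel \<partial>gauss_seq) \<le> \<rho> n"
    using G_L1_valued_limit by blast
  define N where "N = distr gauss_seq L1_borel W"
  have Wi: "integrable lborel (W w)" if "w \<in> space gauss_seq" for w
    using measurable_space[OF W that] by (simp add: space_L1_borel)
  have tr: "(\<integral>w. h w \<partial>N) = (\<integral>w. h (W w) \<partial>gauss_seq)" if "h \<in> borel_measurable L1_borel"
    for h :: "(real \<Rightarrow> real) \<Rightarrow> 'c::{banach,second_countable_topology}"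
    unfolding N_def by (rule integral_distr[OF W that])
  interpret N: prob_space N unfolding N_def by (rule gauss_seq.prob_space_distr[OF W])
  have setsN: "sets N = sets L1_borel" by (simp add: N_def)
  define U where "U f w = (\<integral>t. f t * W w t \<partial>lborel)" for f w
  have U_meas: "U f \<in> borel_measurable gauss_seq" if "f \<in> Linfty" for f
    unfolding U_def by (rule measurable_compose[OF W Linfty_functional_measurable[OF that]])
  have ch: "(\<integral>w. iexp (u * U f w) \<partial>gauss_seq) = exp (- (u\<^sup>2 * Q f f / 2))" if f: "f \<in> Linfty" for f u
  proof (rule LIMSEQ_unique)
    obtain C where C: "0 \<le> C" "AE t in lborel. \<bar>f t\<bar> \<le> C" using LinftyE[OF f] .
    have "(\<lambda>n. complex_of_real (exp (- (u\<^sup>2 * (\<Sum>k<n. (coef f k)\<^sup>2) / 2)))) \<longlonglongrightarrow> complex_of_real (exp (- (u\<^sup>2 * Q f f / 2)))"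
      using coef_sums_Q[OF f f] unfolding sums_def power2_eq_square[of "coef f _"]
      by (intro tendsto_intros) auto
    then show "(\<lambda>n. (\<integral>w. iexp (u * (\<Sum>k<n. coef f k * w k)) \<partial>gauss_seq)) \<longlonglongrightarrow> complex_of_real (exp (- (u\<^sup>2 * Q f f / 2)))"
      unfolding char_gauss_seq .
    have bd: "norm ((\<integral>w. iexp (u * (\<Sum>k<n. coef f k * w k)) \<partial>gauss_seq) - (\<integral>w. iexp (u * U f w) \<partial>gauss_seq)) \<le> \<bar>u\<bar> * C * \<rho> n" for n
    proof -
      have pw: "\<bar>u * (\<Sum>k<n. coef f k * w k) - u * U f w\<bar> \<le> \<bar>u\<bar> * C * (\<integral>t. \<bar>G n w t - W w t\<bar> \<partial>lborel)"
        if w: "w \<in> space gauss_seq" for w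
      proof -
        have "(\<Sum>k<n. coef f k * w k) - U f w = (\<integral>t. f t * (G n w t - W w t) \<partial>lborel)"
          unfolding integral_Linfty_G[OF f, symmetric] U_def
          using integrable_Linfty_mult[OF f G_section_int[of n w]] integrable_Linfty_mult[OF f Wi[OF w]]
          by (simp add: right_diff_distrib)
        also have "\<bar>\<dots>\<bar> \<le> C * (\<integral>t. \<bar>G n w t - W w t\<bar> \<partial>lborel)"
          using G_section_int[of n w] Wi[OF w] by (intro abs_integral_Linfty_mult_le[OF f C]) simp
        finally have "\<bar>u\<bar> * \<bar>(\<Sum>k<n. coef f k * w k) - U f w\<bar> \<le> \<bar>u\<bar> * (C * (\<integral>t. \<bar>G n w t - W w t\<bar> \<partial>lborel))"
          by (intro mult_left_mono) auto
        then show ?thesis by (simp add: abs_mult[symmetric] right_diff_distrib mult.assoc)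
      qed
      have m: "(\<lambda>w. u * (\<Sum>k<n. coef f k * w k)) \<in> borel_measurable gauss_seq" "(\<lambda>w. u * U f w) \<in> borel_measurable gauss_seq"
        using U_meas[OF f] by measurable
      have i: "integrable gauss_seq (\<lambda>w. u * (\<Sum>k<n. coef f k * w k) - u * U f w)"
        by (rule Bochner_Integration.integrable_bound[OF integrable_mult_right[OF di[of n], of "\<bar>u\<bar> * C"]])
           (use m pw C(1) in \<open>auto intro!: AE_I2 order_trans[OF pw]\<close>)
      have "norm ((\<integral>w. iexp (u * (\<Sum>k<n. coef f k * w k)) \<partial>gauss_seq) - (\<integral>w. iexp (u * U f w) \<partial>gauss_seq))
        \<le> (\<integral>w. \<bar>u * (\<Sum>k<n. coef f k * w k) - u * U f w\<bar> \<partial>gauss_seq)"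
        by (rule gauss_seq.norm_integral_iexp_diff_le[OF m i])
      also have "\<dots> \<le> (\<integral>w. \<bar>u\<bar> * C * (\<integral>t. \<bar>G n w t - W w t\<bar> \<partial>lborel) \<partial>gauss_seq)"
        by (intro integral_mono integrable_abs i integrable_mult_right di pw)
      also have "\<dots> \<le> \<bar>u\<bar> * C * \<rho> n"
        using dle[of n] C(1) by (simp add: mult_left_mono)
      finally show ?thesis .
    qed
    have "(\<lambda>n. \<bar>u\<bar> * C * \<rho> n) \<longlonglongrightarrow> 0" by (rule tendsto_mult_right_zero[OF \<rho>_tendsto])
    then have "(\<lambda>n. (\<integral>w. iexp (u * (\<Sum>k<n. coef f k * w k)) \<partial>gauss_seq) - (\<integral>w. iexp (u * U f w) \<partial>gauss_seq)) \<longlonglongrightarrow> 0"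
      by (rule Lim_null_comparison[OF always_eventually[OF allI[OF bd]]])
    then show "(\<lambda>n. (\<integral>w. iexp (u * (\<Sum>k<n. coef f k * w k)) \<partial>gauss_seq)) \<longlonglongrightarrow> (\<integral>w. iexp (u * U f w) \<partial>gauss_seq)"
      by (rule LIM_zero_cancel)
  qed
  have Q0: "0 \<le> Q f f" if "f \<in> Linfty" for f
    using coef_sums_Q[OF that that] by (rule sums_le[OF _ sums_zero, rotated]) simp
  note law = gauss_seq.distr_eq_scaled_normal[OF U_meas Q0 ch]
  note mom = gauss_seq.scaled_normal_moments[OF U_meas Q0 law]
  have dN: "distr N borel (\<lambda>w. \<integral>t. f t * w t \<partial>lborel) = distr gauss_seq borel (U f)" if "f \<in> Linfty" for f
    unfolding N_def U_def by (subst distr_distr[OF Linfty_functional_measurable[OF that] W]) (simp add: comp_def)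
  have mean: "(\<integral>w. (\<integral>t. f t * w t \<partial>lborel) \<partial>N) = 0" if "f \<in> Linfty" for f
    unfolding tr[OF Linfty_functional_measurable[OF that]] using mom(3)[OF that that that that that] by (simp add: U_def)
  show thesis
  proof (rule that[of N])
    show "prob_space N" by (rule N.prob_space_axioms)
    show "sets N = sets L1_borel" by (rule setsN)
    show "centered_gaussian_L1 N (\<lambda>w. w)"
      unfolding centered_gaussian_L1_def
    proof (intro conjI ballI)
      show "(\<lambda>w. w) \<in> measurable N L1_borel" by (simp add: N_def)
      show "gaussian_law (distr N borel (\<lambda>w. \<integral>t. f t * w t \<partial>lborel))" if f: "f \<in> Linfty" for f
        unfolding dN[OF f] law[OF f f f] by (rule gaussian_law_scaled_normal[OF Q0[OF f]])
    qed (rule mean)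
    show "covariance N (\<lambda>w. \<integral>t. f t * w t \<partial>lborel) (\<lambda>w. \<integral>t. g t * w t \<partial>lborel) = Q f g"
      if f: "f \<in> Linfty" and g: "g \<in> Linfty" for f g
    proof -
      let ?p = "\<lambda>t. f t + g t" and ?m = "\<lambda>t. f t - g t"
      have p: "?p \<in> Linfty" and m: "?m \<in> Linfty" by (rule Linfty_add[OF f g] Linfty_diff[OF f g])+
      have cf: "coef ?p k = coef f k + coef g k" "coef ?m k = coef f k - coef g k" for k
        using integrable_Linfty_mult[OF f L_int[of k]] integrable_Linfty_mult[OF g L_int[of k]]
        by (simp_all add: coef_def distrib_right left_diff_distrib)
      \<comment> \<open>So far only variances of single functionals are known; polarisation with
        \<open>f + g\<close> and \<open>f - g\<close> yields the covariance.\<close>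
      have "(\<lambda>k. coef ?p k * coef ?p k - coef ?m k * coef ?m k) sums (Q ?p ?p - Q ?m ?m)"
        by (rule sums_diff[OF coef_sums_Q[OF p p] coef_sums_Q[OF m m]])
      also have "(\<lambda>k. coef ?p k * coef ?p k - coef ?m k * coef ?m k) = (\<lambda>k. 4 * (coef f k * coef g k))"
        unfolding cf by (simp add: algebra_simps)
      finally have Qp: "Q ?p ?p - Q ?m ?m = 4 * Q f g"
        by (rule sums_unique2) (rule sums_mult[OF coef_sums_Q[OF f g]])
      have "covariance N (\<lambda>w. \<integral>t. f t * w t \<partial>lborel) (\<lambda>w. \<integral>t. g t * w t \<partial>lborel)
         = (\<integral>w. (\<integral>t. f t * w t \<partial>lborel) * (\<integral>t. g t * w t \<partial>lborel) \<partial>N)"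
        by (simp add: covariance_def mean f g)
      also have "\<dots> = (\<integral>w. U f w * U g w \<partial>gauss_seq)"
        unfolding U_def by (rule tr) (intro borel_measurable_times Linfty_functional_measurable f g)
      also have "\<dots> = (\<integral>w. ((U ?p w)\<^sup>2 - (U ?m w)\<^sup>2) / 4 \<partial>gauss_seq)"
      proof (intro Bochner_Integration.integral_cong refl)
        fix w assume w: "w \<in> space gauss_seq"
        have eqs: "U ?p w = U f w + U g w" "U ?m w = U f w - U g w"
          using integrable_Linfty_mult[OF f Wi[OF w]] integrable_Linfty_mult[OF g Wi[OF w]]
          by (simp_all add: U_def distrib_right left_diff_distrib)
        show "U f w * U g w = ((U ?p w)\<^sup>2 - (U ?m w)\<^sup>2) / 4"
          unfolding eqs by (simp add: power2_eq_square algebra_simps)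
      qed
      also have "\<dots> = (Q ?p ?p - Q ?m ?m) / 4"
        using mom(2,4)[OF p p p p p] mom(2,4)[OF m m m m m] by simp
      finally show ?thesis by (simp add: Qp)
    qed
    show "norm ((\<integral>w. iexp (u * (\<integral>t. \<bar>w t\<bar> \<partial>lborel)) \<partial>N) - (\<integral>w. iexp (u * (\<integral>t. \<bar>G n w t\<bar> \<partial>lborel)) \<partial>gauss_seq)) \<le> \<bar>u\<bar> * \<rho> n" for u n
    proof -
      note [measurable] = L1_norm_measurable
      have Gn: "(\<lambda>w. \<integral>t. \<bar>G n w t\<bar> \<partial>lborel) \<in> borel_measurable gauss_seq"
        using G_meas[of n] by (intro lborel.borel_measurable_lebesgue_integral) (simp add: split_beta')
      have Wn: "(\<lambda>w. \<integral>t. \<bar>W w t\<bar> \<partial>lborel) \<in> borel_measurable gauss_seq"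
        by (rule measurable_compose[OF W L1_norm_measurable])
      have pw: "\<bar>u * (\<integral>t. \<bar>W w t\<bar> \<partial>lborel) - u * (\<integral>t. \<bar>G n w t\<bar> \<partial>lborel)\<bar> \<le> \<bar>u\<bar> * (\<integral>t. \<bar>G n w t - W w t\<bar> \<partial>lborel)"
        if w: "w \<in> space gauss_seq" for w
      proof -
        have "\<bar>\<integral>t. \<bar>W w t\<bar> - \<bar>G n w t\<bar> \<partial>lborel\<bar> \<le> (\<integral>t. \<bar>G n w t - W w t\<bar> \<partial>lborel)"
          using norm_integral_le_integral[of lborel "\<lambda>t. \<bar>W w t\<bar> - \<bar>G n w t\<bar>" "\<lambda>t. \<bar>G n w t - W w t\<bar>"]
            G_section_int[of n w] Wi[OF w] by auto
        then have "\<bar>u\<bar> * \<bar>(\<integral>t. \<bar>W w t\<bar> \<partial>lborel) - (\<integral>t. \<bar>G n w t\<bar> \<partial>lborel)\<bar> \<le> \<bar>u\<bar> * (\<integral>t. \<bar>G n w t - W w t\<bar> \<partial>lborel)"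
          using G_section_int[of n w] Wi[OF w] by (intro mult_left_mono) auto
        then show ?thesis by (simp add: abs_mult[symmetric] right_diff_distrib)
      qed
      have m: "(\<lambda>w. u * (\<integral>t. \<bar>W w t\<bar> \<partial>lborel)) \<in> borel_measurable gauss_seq" "(\<lambda>w. u * (\<integral>t. \<bar>G n w t\<bar> \<partial>lborel)) \<in> borel_measurable gauss_seq"
        using Gn Wn by measurable
      have i: "integrable gauss_seq (\<lambda>w. u * (\<integral>t. \<bar>W w t\<bar> \<partial>lborel) - u * (\<integral>t. \<bar>G n w t\<bar> \<partial>lborel))"
        by (rule Bochner_Integration.integrable_bound[OF integrable_mult_right[OF di[of n], of "\<bar>u\<bar>"]])
           (use m pw in \<open>auto intro!: AE_I2 order_trans[OF pw]\<close>)
      have "(\<integral>w. iexp (u * (\<integral>t. \<bar>w t\<bar> \<partial>lborel)) \<partial>N) = (\<integral>w. iexp (u * (\<integral>t. \<bar>W w t\<bar> \<partial>lborel)) \<partial>gauss_seq)"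
        by (rule tr) measurable
      then have "norm ((\<integral>w. iexp (u * (\<integral>t. \<bar>w t\<bar> \<partial>lborel)) \<partial>N) - (\<integral>w. iexp (u * (\<integral>t. \<bar>G n w t\<bar> \<partial>lborel)) \<partial>gauss_seq))
         \<le> (\<integral>w. \<bar>u * (\<integral>t. \<bar>W w t\<bar> \<partial>lborel) - u * (\<integral>t. \<bar>G n w t\<bar> \<partial>lborel)\<bar> \<partial>gauss_seq)"
        using gauss_seq.norm_integral_iexp_diff_le[OF m i] by simp
      also have "\<dots> \<le> (\<integral>w. \<bar>u\<bar> * (\<integral>t. \<bar>G n w t - W w t\<bar> \<partial>lborel) \<partial>gauss_seq)"
        by (intro integral_mono integrable_abs i integrable_mult_right di pw)
      also have "\<dots> \<le> \<bar>u\<bar> * \<rho> n" using dle[of n] by (simp add: mult_left_mono)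
      finally show ?thesis .
    qed
  qed
qed

end

section \<open>Empirical processes\<close>

(* As a measurability rule this matches every function application. *)
declare gauss_seq_coord [measurable del]

text \<open>The coefficients enter through \<open>\<alpha>_mix\<close>, an integrated form tested on
  bounded functions of the past, and the tail through the mean of
  \<open>|1(X0 <= t) - F(t)|\<close>. Both are derived from the original condition in the last
  section.\<close>

locale empirical_process = filtered_automorphism +
  fixes X0 :: "'a \<Rightarrow> real" and \<alpha> :: "nat \<Rightarrow> real"
  assumes X0: "X0 \<in> borel_measurable F0" and X0_int: "integrable M X0"
    and \<alpha>_summable: "summable \<alpha>"
    and \<alpha>_mix: "\<And>\<xi> C t k. \<xi> \<in> borel_measurable F0 \<Longrightarrow> (\<And>x. \<bar>\<xi> x\<bar> \<le> C) \<Longrightarrow>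
      \<bar>\<integral>x. \<xi> x * (indicator {..t} (X0 ((T ^^ k) x)) - cdf (distr M borel X0) t) \<partial>M\<bar> \<le> C * \<alpha> k"
    and sqrt_S_int: "integrable lborel (\<lambda>t. sqrt (\<Sum>k. min (\<alpha> k)
      (\<integral>x. \<bar>indicator {..t} (X0 x) - cdf (distr M borel X0) t\<bar> \<partial>M)))"
begin

definition F :: "real \<Rightarrow> real" where
  "F t = cdf (distr M borel X0) t"

definition e :: "real \<Rightarrow> 'a \<Rightarrow> real" where
  "e t x = indicator {..t} (X0 x) - F t"

definition h :: "real \<Rightarrow> real" where
  "h t = (\<integral>x. \<bar>e t x\<bar> \<partial>M)"

definition S2 :: "real \<Rightarrow> real" where
  "S2 t = (\<Sum>k. min (\<alpha> k) (h t))"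

text \<open>Up to constants, \<open>\<omega> |F t - F s|\<close> bounds the variance per step of
  increments of the process, as \<open>S2 t\<close> bounds that of its values.\<close>

definition \<omega> :: "real \<Rightarrow> real" where
  "\<omega> y = (\<Sum>k. min (\<alpha> k) y)"

definition \<gamma> :: "nat \<Rightarrow> real \<Rightarrow> real \<Rightarrow> real" where
  "\<gamma> k s t = (\<integral>x. e s x * e t ((T ^^ k) x) \<partial>M)"

text \<open>The sum over all integers of the covariances between the indicators at levels
  \<open>s\<close> and \<open>t\<close>; by stationarity the terms of negative index appear with
  \<open>s\<close> and \<open>t\<close> exchanged.\<close>

definition K :: "real \<Rightarrow> real \<Rightarrow> real" where
  "K s t = \<gamma> 0 s t + (\<Sum>k. \<gamma> (Suc k) s t + \<gamma> (Suc k) t s)"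

lemma sqrt_S2_int: "integrable lborel (\<lambda>t. sqrt (S2 t))"
  using sqrt_S_int unfolding S2_def h_def e_def F_def .

lemma X0_meas [measurable]: "X0 \<in> borel_measurable M"
  using X0 by (rule F0_meas)

sublocale X0_distr: real_distribution "distr M borel X0"
  by (rule real_distribution_distr) simp

lemma F_eq: "F t = (\<integral>x. indicator {..t} (X0 x) \<partial>M)"
  unfolding F_def by (rule integral_indicator_atMost_eq_cdf[symmetric]) simp

lemma F_01: "0 \<le> F t" "F t \<le> 1"
  unfolding F_def by (auto simp: cdf_def)

lemma F_mono: "s \<le> t \<Longrightarrow> F s \<le> F t"
  unfolding F_def by (rule X0_distr.cdf_nondecreasing)

lemma F_meas [measurable]: "F \<in> borel_measurable borel"
  by (intro borel_measurable_mono monoI F_mono)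

lemma e_meas [measurable]: "e t \<in> borel_measurable M"
  unfolding e_def[abs_def] by measurable

lemma e_F0: "e t \<in> borel_measurable F0"
proof -
  have "(\<lambda>x. indicator {..t} (X0 x) :: real) \<in> borel_measurable F0"
    by (rule measurable_compose[OF X0]) simp
  then show ?thesis unfolding e_def[abs_def] by simp
qed

lemma abs_e_le: "\<bar>e t x\<bar> \<le> 1"
  using F_01[of t] by (auto simp: e_def indicator_def)

lemma e_int: "integrable M (e t)"
  by (rule integrable_bounded[where B=1]) (auto simp: abs_e_le)

lemma e_mix:
  "\<xi> \<in> borel_measurable F0 \<Longrightarrow> (\<And>x. \<bar>\<xi> x\<bar> \<le> C) \<Longrightarrow> \<bar>\<integral>x. \<xi> x * e t ((T ^^ k) x) \<partial>M\<bar> \<le> C * \<alpha> k"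
  unfolding e_def F_def by (rule \<alpha>_mix)

lemma \<alpha>_nonneg: "0 \<le> \<alpha> k"
  using e_mix[of "\<lambda>_. 1" 1 0 k] by simp

lemma h_nonneg: "0 \<le> h t"
  unfolding h_def by simp

lemma min_summable: "summable (\<lambda>k. min (\<alpha> k) y)" if "0 \<le> y"
  by (rule summable_comparison_test'[OF \<alpha>_summable, of 0]) (use that \<alpha>_nonneg in auto)

text \<open>Mixing with \<open>e s\<close> as test function, against the trivial bounds from
  \<open>|e| <= 1\<close>. Both minima are kept because either level may be the one with small
  \<open>h\<close>.\<close>

lemma abs_\<gamma>_le: "\<bar>\<gamma> k s t\<bar> \<le> min (\<alpha> k) (h s)" "\<bar>\<gamma> k s t\<bar> \<le> min (\<alpha> k) (h t)"
proof -
  have i: "integrable M (\<lambda>x. e s x * e t ((T ^^ k) x))"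
    by (rule integrable_bounded[where B=1]) (auto simp: abs_mult intro!: mult_le_one abs_e_le)
  have 1: "\<bar>\<gamma> k s t\<bar> \<le> \<alpha> k"
    unfolding \<gamma>_def using e_mix[OF e_F0 abs_e_le, of s t k] by simp
  have "\<bar>\<gamma> k s t\<bar> \<le> (\<integral>x. \<bar>e s x\<bar> \<partial>M)"
    unfolding \<gamma>_def real_norm_def[symmetric]
  proof (rule norm_integral_le_integral[OF i])
    show "norm (e s x * e t ((T ^^ k) x)) \<le> norm (e s x)" for x
      using mult_left_mono[OF abs_e_le, of "\<bar>e s x\<bar>"] by (simp add: abs_mult)
  qed (use e_int in auto)
  moreover have "\<bar>\<gamma> k s t\<bar> \<le> (\<integral>x. \<bar>e t ((T ^^ k) x)\<bar> \<partial>M)"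
    unfolding \<gamma>_def real_norm_def[symmetric]
  proof (rule norm_integral_le_integral[OF i])
    show "integrable M (\<lambda>x. norm (e t ((T ^^ k) x)))"
      by (rule integrable_bounded[where B=1]) (auto simp: abs_e_le)
    show "norm (e s x * e t ((T ^^ k) x)) \<le> norm (e t ((T ^^ k) x))" for x
      using mult_right_mono[OF abs_e_le, of "\<bar>e t ((T ^^ k) x)\<bar>"] by (simp add: abs_mult)
  qed
  moreover have "(\<integral>x. \<bar>e t ((T ^^ k) x)\<bar> \<partial>M) = h t"
    unfolding h_def by (rule integral_funpow_T[of "\<lambda>x. \<bar>e t x\<bar>"]) simp
  ultimately show "\<bar>\<gamma> k s t\<bar> \<le> min (\<alpha> k) (h s)" "\<bar>\<gamma> k s t\<bar> \<le> min (\<alpha> k) (h t)"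
    using 1 by (auto simp: h_def)
qed

lemma \<gamma>_summable: "summable (\<lambda>k. \<gamma> k s t)" "summable (\<lambda>k. \<gamma> (Suc k) s t)"
proof -
  show "summable (\<lambda>k. \<gamma> k s t)"
    by (rule summable_comparison_test'[OF \<alpha>_summable, of 0]) (use abs_\<gamma>_le in auto)
  then show "summable (\<lambda>k. \<gamma> (Suc k) s t)" using summable_Suc_iff[of "\<lambda>k. \<gamma> k s t"] by simp
qed

context
  fixes p :: nat and a x :: "nat \<Rightarrow> real"
begin

definition Y :: "'a \<Rightarrow> real" where
  "Y w = (\<Sum>j<p. a j * e (x j) w)"

lemma Y_F0: "Y \<in> borel_measurable F0"
  unfolding Y_def[abs_def] using e_F0 by simp

lemma abs_Y_le: "\<bar>Y w\<bar> \<le> (\<Sum>j<p. \<bar>a j\<bar>)"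
  unfolding Y_def
  by (rule order_trans[OF sum_abs]) (auto intro!: sum_mono simp: abs_mult mult_left_le abs_e_le)

lemma Y_mix:
  assumes \<xi>: "\<xi> \<in> borel_measurable F0" and C: "\<And>w. \<bar>\<xi> w\<bar> \<le> C"
  shows "\<bar>\<integral>w. \<xi> w * Y ((T ^^ k) w) \<partial>M\<bar> \<le> C * ((\<Sum>j<p. \<bar>a j\<bar>) * \<alpha> k)"
proof -
  have C0: "0 \<le> C" using C[of undefined] by linarith
  have [measurable]: "\<xi> \<in> borel_measurable M" using \<xi> by (rule F0_meas)
  have i: "integrable M (\<lambda>w. \<xi> w * e t ((T ^^ k) w))" for t
    by (rule integrable_bounded[where B="C * 1"]) (auto simp: abs_mult C0 intro!: mult_mono abs_e_le C simp del: mult_1_right)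
  have "(\<integral>w. \<xi> w * Y ((T ^^ k) w) \<partial>M) = (\<integral>w. (\<Sum>j<p. a j * (\<xi> w * e (x j) ((T ^^ k) w))) \<partial>M)"
    by (simp add: Y_def sum_distrib_left mult_ac)
  also have "\<dots> = (\<Sum>j<p. a j * (\<integral>w. \<xi> w * e (x j) ((T ^^ k) w) \<partial>M))"
    using i by (simp add: Bochner_Integration.integral_sum)
  also have "\<bar>\<dots>\<bar> \<le> (\<Sum>j<p. \<bar>a j\<bar> * (C * \<alpha> k))"
    by (rule order_trans[OF sum_abs]) (auto simp: abs_mult intro!: sum_mono mult_left_mono e_mix \<xi> C)
  also have "\<dots> = C * ((\<Sum>j<p. \<bar>a j\<bar>) * \<alpha> k)" by (simp add: sum_distrib_right sum_distrib_left mult_ac)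
  finally show ?thesis .
qed

lemma Y_cov: "(\<integral>w. Y w * Y ((T ^^ k) w) \<partial>M) = (\<Sum>i<p. \<Sum>j<p. a i * a j * \<gamma> k (x i) (x j))"
proof -
  have i: "integrable M (\<lambda>w. e s w * e t ((T ^^ k) w))" for s t
    by (rule integrable_bounded[where B=1]) (auto simp: abs_mult intro!: mult_le_one abs_e_le)
  have "(\<integral>w. Y w * Y ((T ^^ k) w) \<partial>M) = (\<integral>w. (\<Sum>i<p. \<Sum>j<p. a i * a j * (e (x i) w * e (x j) ((T ^^ k) w))) \<partial>M)"
    by (simp add: Y_def sum_product mult_ac)
  also have "\<dots> = (\<Sum>i<p. \<Sum>j<p. a i * a j * \<gamma> k (x i) (x j))"
    using i by (simp add: Bochner_Integration.integral_sum \<gamma>_def)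
  finally show ?thesis .
qed

text \<open>\<open>bounded_clt\<close> produces a one-sided sum with factor two. Exchanging the
  summation indices symmetrises it, and the two halves become the two terms in
  \<open>K\<close>.\<close>

lemma Y_cov_sum:
  "(\<integral>w. Y w * Y ((T ^^ 0) w) \<partial>M) + 2 * (\<Sum>k. \<integral>w. Y w * Y ((T ^^ Suc k) w) \<partial>M) = (\<Sum>i<p. \<Sum>j<p. a i * a j * K (x i) (x j))"
proof -
  define c where "c k = (\<Sum>i<p. \<Sum>j<p. a i * a j * \<gamma> k (x i) (x j))" for k
  have sym: "2 * c (Suc k) = (\<Sum>i<p. \<Sum>j<p. a i * a j * (\<gamma> (Suc k) (x i) (x j) + \<gamma> (Suc k) (x j) (x i)))" for k
  proof -
    have "c (Suc k) = (\<Sum>i<p. \<Sum>j<p. a i * a j * \<gamma> (Suc k) (x j) (x i))"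
      unfolding c_def by (subst sum.swap) (simp add: mult.commute)
    then show ?thesis by (simp add: c_def distrib_left sum.distrib)
  qed
  have "(\<lambda>k. \<Sum>i<p. \<Sum>j<p. a i * a j * (\<gamma> (Suc k) (x i) (x j) + \<gamma> (Suc k) (x j) (x i))) sums
     (\<Sum>i<p. \<Sum>j<p. a i * a j * (\<Sum>k. \<gamma> (Suc k) (x i) (x j) + \<gamma> (Suc k) (x j) (x i)))"
    by (intro sums_sum sums_mult summable_sums summable_add \<gamma>_summable)
  then have "(\<lambda>k. 2 * c (Suc k)) sums (\<Sum>i<p. \<Sum>j<p. a i * a j * (\<Sum>k. \<gamma> (Suc k) (x i) (x j) + \<gamma> (Suc k) (x j) (x i)))"
    unfolding sym .
  moreover have "summable (\<lambda>k. c (Suc k))"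
    unfolding c_def by (intro summable_sum summable_mult \<gamma>_summable)
  then have "(\<lambda>k. 2 * c (Suc k)) sums (2 * (\<Sum>k. c (Suc k)))"
    by (intro sums_mult summable_sums)
  ultimately have "2 * (\<Sum>k. c (Suc k)) = (\<Sum>i<p. \<Sum>j<p. a i * a j * (\<Sum>k. \<gamma> (Suc k) (x i) (x j) + \<gamma> (Suc k) (x j) (x i)))"
    by (rule sums_unique2[rotated])
  then show ?thesis
    unfolding Y_cov c_def[symmetric] by (simp add: c_def K_def distrib_left sum.distrib)
qed

lemma Y_clt:
  "(\<lambda>n. \<integral>w. iexp (u / sqrt (real n) * (\<Sum>k<n. Y ((T ^^ k) w))) \<partial>M)
     \<longlonglongrightarrow> exp (- (u\<^sup>2 * (\<Sum>i<p. \<Sum>j<p. a i * a j * K (x i) (x j)) / 2))"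
  using bounded_clt[OF Y_F0 abs_Y_le Y_mix summable_mult[OF \<alpha>_summable], of u] unfolding Y_cov_sum .

text \<open>The form is the limit of the normalised second moments of partial sums of
  \<open>Y\<close>, which are nonnegative.\<close>

lemma K_sum_nonneg: "0 \<le> (\<Sum>i<p. \<Sum>j<p. a i * a j * K (x i) (x j))"
proof -
  have "summable (\<lambda>k. \<integral>w. Y w * Y ((T ^^ Suc k) w) \<partial>M)"
    unfolding Y_cov by (intro summable_sum summable_mult \<gamma>_summable)
  from integral_sum_funpow_sq_tendsto[OF F0_meas[OF Y_F0] abs_Y_le this] show ?thesis
    unfolding Y_cov_sum by (rule LIMSEQ_le_const) auto
qed

end

lemma K_sym: "K s t = K t s"
proof -
  have "\<gamma> 0 s t = \<gamma> 0 t s" by (simp add: \<gamma>_def mult.commute)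
  then show ?thesis by (simp add: K_def add.commute)
qed

lemma psd_K: "psd_kernel K"
  unfolding psd_kernel_def using K_sym K_sum_nonneg by blast

lemma \<gamma>_meas2 [measurable]: "(\<lambda>z. \<gamma> k (fst z) (snd z)) \<in> borel_measurable (borel \<Otimes>\<^sub>M borel)"
proof -
  have "(\<lambda>(z, x). e (fst z) x * e (snd z) ((T ^^ k) x)) \<in> borel_measurable ((borel \<Otimes>\<^sub>M borel) \<Otimes>\<^sub>M M)"
    unfolding e_def indicator_def atMost_iff by measurable
  then show ?thesis
    unfolding \<gamma>_def by (rule borel_measurable_lebesgue_integral)
qed

lemma \<gamma>_meas [measurable]: "(\<lambda>s. \<gamma> k s t) \<in> borel_measurable borel" "(\<lambda>s. \<gamma> k t s) \<in> borel_measurable borel"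
  using measurable_compose[OF _ \<gamma>_meas2[of k], of "\<lambda>s. (s, t)" borel] measurable_compose[OF _ \<gamma>_meas2[of k], of "\<lambda>s. (t, s)" borel]
  by auto

lemma K_meas: "(\<lambda>s. K s t) \<in> borel_measurable borel"
  unfolding K_def by measurable

lemma S2_nonneg: "0 \<le> S2 t"
  unfolding S2_def using \<alpha>_nonneg h_nonneg by (intro suminf_nonneg min_summable) auto

text \<open>On the diagonal lag \<open>0\<close> occurs once and every other lag twice; the factor
  two covers all of them.\<close>

lemma K_diag_le: "K t t \<le> 2 * S2 t"
proof -
  have ms: "summable (\<lambda>k. min (\<alpha> (Suc k)) (h t))"
    using summable_Suc_iff[of "\<lambda>k. min (\<alpha> k) (h t)"] min_summable[OF h_nonneg] by simp
  have m1: "\<gamma> 0 t t \<le> min (\<alpha> 0) (h t)" using abs_\<gamma>_le(1)[of 0 t t] by linarith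
  have m2: "(\<Sum>k. \<gamma> (Suc k) t t + \<gamma> (Suc k) t t) \<le> (\<Sum>k. 2 * min (\<alpha> (Suc k)) (h t))"
  proof (rule suminf_le)
    show "\<gamma> (Suc k) t t + \<gamma> (Suc k) t t \<le> 2 * min (\<alpha> (Suc k)) (h t)" for k
      using abs_\<gamma>_le(1)[of "Suc k" t t] by linarith
  qed (use ms \<gamma>_summable in \<open>auto intro!: summable_add summable_mult\<close>)
  have m3: "(\<Sum>k. 2 * min (\<alpha> (Suc k)) (h t)) = 2 * (S2 t - min (\<alpha> 0) (h t))"
    unfolding S2_def suminf_mult[OF ms] suminf_split_head[OF min_summable[OF h_nonneg[of t]]] ..
  have "0 \<le> min (\<alpha> 0) (h t)" using \<alpha>_nonneg h_nonneg by simp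
  moreover have "K t t \<le> min (\<alpha> 0) (h t) + 2 * (S2 t - min (\<alpha> 0) (h t))"
    unfolding K_def using m2 unfolding m3 by (rule add_mono[OF m1])
  ultimately show ?thesis by argo
qed

lemma K_int: "integrable lborel (\<lambda>t. sqrt (K t t))"
proof (rule Bochner_Integration.integrable_bound[OF integrable_mult_right[OF sqrt_S2_int, of "sqrt 2"]])
  have [measurable]: "(\<lambda>s. \<gamma> k s s) \<in> borel_measurable borel" for k
    using measurable_compose[OF _ \<gamma>_meas2[of k], of "\<lambda>s. (s, s)" borel] by simp
  have "(\<lambda>t. K t t) \<in> borel_measurable borel"
    unfolding K_def by measurable
  then show "(\<lambda>t. sqrt (K t t)) \<in> borel_measurable lborel" by simp
  show "AE t in lborel. norm (sqrt (K t t)) \<le> norm (sqrt 2 * sqrt (S2 t))"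
    using K_diag_le psd_kernel_diag[OF psd_K] S2_nonneg by (intro AE_I2) (simp add: real_sqrt_mult[symmetric])
qed

lemma e_sum_sq_le: "(\<integral>w. (\<Sum>k<n. e t ((T ^^ k) w))\<^sup>2 \<partial>M) \<le> 2 * real n * S2 t"
  unfolding S2_def
  by (rule integral_sum_funpow_sq_le[OF e_meas abs_e_le _ min_summable[OF h_nonneg]])
     (use abs_\<gamma>_le in \<open>simp add: \<gamma>_def\<close>)

text \<open>The increment is the indicator of \<open>{s<..t}\<close> minus its mean. It is bounded
  by one, two uses of mixing cost \<open>2 * \<alpha> k\<close>, and its mean modulus is at most
  \<open>2 |F t - F s|\<close>.\<close>

lemma e_diff_cov_le:
  "\<bar>\<integral>w. (e t w - e s w) * (e t ((T ^^ k) w) - e s ((T ^^ k) w)) \<partial>M\<bar> \<le> 2 * min (\<alpha> k) \<bar>F t - F s\<bar>"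
proof -
  have wl: "\<bar>\<integral>w. (e t w - e s w) * (e t ((T ^^ k) w) - e s ((T ^^ k) w)) \<partial>M\<bar> \<le> 2 * min (\<alpha> k) \<bar>F t - F s\<bar>"
    if st: "s \<le> t" for s t
  proof -
    define d where "d w = e t w - e s w" for w
    have d: "d w = indicator {s<..t} (X0 w) - (F t - F s)" for w
      using st by (auto simp: d_def e_def indicator_def)
    have d_F0: "d \<in> borel_measurable F0" unfolding d_def[abs_def] by (intro borel_measurable_diff e_F0)
    have [measurable]: "d \<in> borel_measurable M" using d_F0 by (rule F0_meas)
    have d1: "\<bar>d w\<bar> \<le> 1" for w
      unfolding d using F_mono[OF st] F_01[of t] F_01[of s] by (auto simp: indicator_def)
    have i: "integrable M (\<lambda>w. d w * e r ((T ^^ k) w))" for r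
      by (rule integrable_bounded[where B=1]) (auto simp: abs_mult intro!: mult_le_one abs_e_le d1)
    have "(\<integral>w. d w * d ((T ^^ k) w) \<partial>M) = (\<integral>w. d w * e t ((T ^^ k) w) \<partial>M) - (\<integral>w. d w * e s ((T ^^ k) w) \<partial>M)"
      unfolding d_def[of "(T ^^ k) _"] using i by (simp add: right_diff_distrib)
    then have 1: "\<bar>\<integral>w. d w * d ((T ^^ k) w) \<partial>M\<bar> \<le> 2 * \<alpha> k"
      using e_mix[OF d_F0 d1, of t k] e_mix[OF d_F0 d1, of s k] by linarith
    have "\<bar>\<integral>w. d w * d ((T ^^ k) w) \<partial>M\<bar> \<le> (\<integral>w. \<bar>d w\<bar> \<partial>M)"
      unfolding real_norm_def[symmetric]
    proof (rule norm_integral_le_integral)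
      show "integrable M (\<lambda>w. d w * d ((T ^^ k) w))"
        by (rule integrable_bounded[where B=1]) (auto simp: abs_mult intro!: mult_le_one d1)
      show "integrable M (\<lambda>w. norm (d w))"
        by (rule integrable_bounded[where B="1"]) (auto simp: d1)
      show "norm (d w * d ((T ^^ k) w)) \<le> norm (d w)" for w
        using mult_left_mono[OF d1, of "\<bar>d w\<bar>"] by (simp add: abs_mult)
    qed
    also have "\<dots> \<le> (\<integral>w. (indicator {..t} (X0 w) - indicator {..s} (X0 w)) + (F t - F s) \<partial>M)"
    proof (rule integral_mono)
      show "integrable M (\<lambda>w. \<bar>d w\<bar>)" by (rule integrable_bounded[where B="1"]) (auto simp: d1)
      show "integrable M (\<lambda>w. (indicator {..t} (X0 w) - indicator {..s} (X0 w)) + (F t - F s))"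
        by (intro Bochner_Integration.integrable_add Bochner_Integration.integrable_diff integrable_const
             integrable_bounded[where B=1]) auto
      show "\<bar>d w\<bar> \<le> (indicator {..t} (X0 w) - indicator {..s} (X0 w)) + (F t - F s)" for w
        unfolding d using F_mono[OF st] st F_01[of t] F_01[of s] by (auto simp: indicator_def)
    qed
    also have "\<dots> = 2 * \<bar>F t - F s\<bar>"
    proof -
      have "integrable M (\<lambda>w. indicator {..r} (X0 w) :: real)" for r
        by (rule integrable_bounded[where B=1]) auto
      then show ?thesis using F_mono[OF st] by (simp add: F_eq[symmetric] prob_space)
    qed
    finally show ?thesis using 1 unfolding d_def by auto
  qed
  show ?thesis
  proof (cases "s \<le> t")
    case False
    then have "t \<le> s" by simp
    from wl[OF this] show ?thesis
      by (simp add: abs_minus_commute mult_ac algebra_simps)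
  qed (rule wl)
qed

lemma e_diff_sum_sq_le:
  "(\<integral>w. (\<Sum>k<n. e t ((T ^^ k) w) - e s ((T ^^ k) w))\<^sup>2 \<partial>M) \<le> 4 * real n * \<omega> \<bar>F t - F s\<bar>"
proof -
  have "(\<integral>w. (\<Sum>k<n. (\<lambda>x. e t x - e s x) ((T ^^ k) w))\<^sup>2 \<partial>M) \<le> 2 * real n * (\<Sum>k. 2 * min (\<alpha> k) \<bar>F t - F s\<bar>)"
  proof (rule integral_sum_funpow_sq_le[where B=2])
    show "\<bar>e t x - e s x\<bar> \<le> 2" for x using abs_e_le[of t x] abs_e_le[of s x] by linarith
  qed (use e_diff_cov_le min_summable in \<open>auto intro!: summable_mult\<close>)
  also have "(\<Sum>k. 2 * min (\<alpha> k) \<bar>F t - F s\<bar>) = 2 * \<omega> \<bar>F t - F s\<bar>"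
    unfolding \<omega>_def by (rule suminf_mult[OF min_summable]) simp
  finally show ?thesis by simp
qed

lemma \<omega>_nonneg: "0 \<le> y \<Longrightarrow> 0 \<le> \<omega> y"
  unfolding \<omega>_def using \<alpha>_nonneg by (intro suminf_nonneg min_summable) auto

lemma \<omega>_mono: "0 \<le> y \<Longrightarrow> y \<le> z \<Longrightarrow> \<omega> y \<le> \<omega> z"
  unfolding \<omega>_def by (intro suminf_le min_summable min.mono) auto

text \<open>Dominated convergence for series, with \<open>\<alpha>\<close> as majorant.\<close>

lemma \<omega>_tendsto:
  assumes "(y \<longlongrightarrow> 0) G" "\<And>n. 0 \<le> y n" "G \<noteq> bot"
  shows "((\<lambda>n. \<omega> (y n)) \<longlongrightarrow> 0) G"
proof -
  have "((\<lambda>n. \<Sum>k. min (\<alpha> k) (y n)) \<longlongrightarrow> (\<Sum>k. min (\<alpha> k) 0)) G"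
  proof (rule tannerys_theorem[THEN conjunct2, THEN conjunct2])
    show "((\<lambda>n. min (\<alpha> k) (y n)) \<longlongrightarrow> min (\<alpha> k) 0) G" for k by (intro tendsto_intros assms)
    show "\<forall>\<^sub>F (k, n) in at_top \<times>\<^sub>F G. norm (min (\<alpha> k) (y n)) \<le> \<alpha> k"
      using assms(2) \<alpha>_nonneg by (intro always_eventually) auto
  qed (use \<alpha>_summable assms in auto)
  moreover have "min (\<alpha> k) 0 = 0" for k using \<alpha>_nonneg[of k] by simp
  ultimately show ?thesis unfolding \<omega>_def by simp
qed

text \<open>The left side is the long-run variance of an increment, hence a limit of normalised
  second moments that all obey the bound.\<close>

lemma K_diff_le: "K s s - 2 * K s t + K t t \<le> 4 * \<omega> \<bar>F t - F s\<bar>"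
proof -
  define a :: "nat \<Rightarrow> real" where "a i = (if i = 0 then -1 else 1)" for i
  define x where "x i = (if i = 0 then s else t)" for i :: nat
  have Ye: "Y 2 a x w = e t w - e s w" for w
    by (simp add: Y_def a_def x_def numeral_2_eq_2)
  have "K s s - 2 * K s t + K t t = (\<Sum>i<2. \<Sum>j<2. a i * a j * K (x i) (x j))"
    using K_sym[of s t] by (simp add: a_def x_def numeral_2_eq_2)
  moreover have "(\<Sum>i<2. \<Sum>j<2. a i * a j * K (x i) (x j)) \<le> 4 * \<omega> \<bar>F t - F s\<bar>"
  proof -
    have "summable (\<lambda>k. \<integral>w. Y 2 a x w * Y 2 a x ((T ^^ Suc k) w) \<partial>M)"
      unfolding Y_cov by (intro summable_sum summable_mult \<gamma>_summable)
    from integral_sum_funpow_sq_tendsto[OF F0_meas[OF Y_F0] abs_Y_le this]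
    have lim: "(\<lambda>n. (\<integral>w. (\<Sum>k<n. Y 2 a x ((T ^^ k) w))\<^sup>2 \<partial>M) / real n) \<longlonglongrightarrow> (\<Sum>i<2. \<Sum>j<2. a i * a j * K (x i) (x j))"
      unfolding Y_cov_sum .
    have "(\<integral>w. (\<Sum>k<n. Y 2 a x ((T ^^ k) w))\<^sup>2 \<partial>M) / real n \<le> 4 * \<omega> \<bar>F t - F s\<bar>" if "n \<ge> 1" for n
      using e_diff_sum_sq_le[of t s n] that unfolding Ye by (simp add: field_simps)
    then show ?thesis by (intro LIMSEQ_le_const2[OF lim]) blast
  qed
  ultimately show ?thesis by simp
qed

definition q :: "nat \<Rightarrow> real" where
  "q = from_nat_into \<rat>"

lemma range_q: "range q = \<rat>"
  unfolding q_def by (rule range_from_nat_into) (auto intro: countable_rat Rats_0)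

text \<open>\<open>F\<close> may jump at \<open>s\<close> but is continuous from the right there, so
  rationals slightly above \<open>s\<close> approximate it in the pseudometric of
  \<open>K\<close>.\<close>

lemma K_dense:
  assumes "0 < \<epsilon>"
  shows "\<exists>j. K s s - 2 * K s (q j) + K (q j) (q j) < \<epsilon>"
proof -
  have "(F \<longlongrightarrow> F s) (at_right s)"
    using X0_distr.cdf_is_right_cont[of s] unfolding continuous_within F_def[abs_def] .
  then have "((\<lambda>t. \<bar>F t - F s\<bar>) \<longlongrightarrow> \<bar>F s - F s\<bar>) (at_right s)" by (intro tendsto_intros)
  then have "((\<lambda>t. \<omega> \<bar>F t - F s\<bar>) \<longlongrightarrow> 0) (at_right s)" by (intro \<omega>_tendsto) auto
  then have "\<forall>\<^sub>F t in at_right s. \<omega> \<bar>F t - F s\<bar> < \<epsilon> / 4" using assms by (intro order_tendstoD) auto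
  then obtain b where b: "b > s" "\<And>t. s < t \<Longrightarrow> t < b \<Longrightarrow> \<omega> \<bar>F t - F s\<bar> < \<epsilon> / 4"
    unfolding eventually_at_right_field by blast
  obtain r where r: "r \<in> \<rat>" "s < r" "r < b" using Rats_dense_in_real[OF b(1)] by blast
  then obtain j where j: "r = q j" using range_q by (metis imageE)
  have "K s s - 2 * K s (q j) + K (q j) (q j) \<le> 4 * \<omega> \<bar>F (q j) - F s\<bar>" by (rule K_diff_le)
  also have "\<dots> < \<epsilon>" using b(2)[OF r(2,3)] j by simp
  finally show ?thesis by blast
qed

sublocale gs: gaussian_series K q
  by standard (intro psd_K K_meas K_int K_dense)+

end

section \<open>Convergence of the norms\<close>

definition grid_point :: "nat \<Rightarrow> nat \<Rightarrow> nat \<Rightarrow> real" where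
  "grid_point A m j = (real j + 1) / real m - real A"

text \<open>Points are rounded up and not to the nearest grid point: \<open>F\<close> is right
  continuous, so its rounding errors vanish under approach from above.\<close>

definition grid_ceil :: "nat \<Rightarrow> real \<Rightarrow> real" where
  "grid_ceil m t = real_of_int \<lceil>t * real m\<rceil> / real m"

definition grid_step :: "nat \<Rightarrow> nat \<Rightarrow> (real \<Rightarrow> real) \<Rightarrow> real \<Rightarrow> real" where
  "grid_step A m f t = (\<Sum>j<2 * A * m. indicator {real j / real m - real A<..grid_point A m j} t * f (grid_point A m j))"

lemma grid_ceil_meas [measurable]: "grid_ceil m \<in> borel_measurable borel"
  unfolding grid_ceil_def[abs_def] by measurable

text \<open>The half-open cells tile \<open>(-A, A]\<close>, and on each of them
  \<open>grid_ceil\<close> is the right end point. The index of the cell of \<open>t\<close> is the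
  ceiling of \<open>t * m\<close> plus \<open>A * m - 1\<close>.\<close>

lemma grid_step_eq:
  assumes m: "m > 0"
  shows "grid_step A m f t = (if - real A < t \<and> t \<le> real A then f (grid_ceil m t) else 0)"
proof -
  have cell: "t \<in> {real j / real m - real A<..grid_point A m j} \<longleftrightarrow> \<lceil>t * real m\<rceil> = int j + 1 - int A * int m" for j
  proof -
    have "\<lceil>t * real m\<rceil> = int j + 1 - int A * int m \<longleftrightarrow>
        real j - real A * real m < t * real m \<and> t * real m \<le> real j + 1 - real A * real m"
      by (simp add: ceiling_eq_iff)
    also have "\<dots> \<longleftrightarrow> t \<in> {real j / real m - real A<..grid_point A m j}"
      using m by (auto simp: grid_point_def field_simps)
    finally show ?thesis ..
  qed
  have gp: "grid_point A m j = grid_ceil m t" if "\<lceil>t * real m\<rceil> = int j + 1 - int A * int m" for j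
  proof -
    have "real_of_int \<lceil>t * real m\<rceil> = real j + 1 - real A * real m" unfolding that by simp
    then show ?thesis using m by (simp add: grid_point_def grid_ceil_def field_simps)
  qed
  show ?thesis
  proof (cases "- real A < t \<and> t \<le> real A")
    case True
    then have 1: "- (real A * real m) < t * real m" "t * real m \<le> real A * real m"
      using m mult_strict_right_mono[of "- real A" t "real m"] by (auto intro: mult_right_mono)
    have c: "- (int A * int m) < \<lceil>t * real m\<rceil>" "\<lceil>t * real m\<rceil> \<le> int A * int m"
      using 1 by (simp_all add: less_ceiling_iff ceiling_le_iff)
    define i where "i = nat (\<lceil>t * real m\<rceil> - 1 + int A * int m)"
    have i: "\<lceil>t * real m\<rceil> = int i + 1 - int A * int m" using c by (simp add: i_def)
    have il: "i < 2 * A * m"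
    proof -
      have "int i < int (2 * A * m)" using c i by simp
      then show ?thesis by (simp only: of_nat_less_iff)
    qed
    have "grid_step A m f t = (\<Sum>j<2 * A * m. if j = i then f (grid_ceil m t) else 0)"
      unfolding grid_step_def
    proof (intro sum.cong refl)
      fix j
      show "indicator {real j / real m - real A<..grid_point A m j} t * f (grid_point A m j) = (if j = i then f (grid_ceil m t) else 0)"
        using cell[of j] i gp[of j] by (auto simp: indicator_def)
    qed
    then show ?thesis using True il by simp
  next
    case False
    have "indicator {real j / real m - real A<..grid_point A m j} t = (0 :: real)" if j: "j < 2 * A * m" for j
    proof -
      have "real j + 1 \<le> 2 * real A * real m"
      proof -
        have "real (Suc j) \<le> real (2 * A * m)" using j by (simp only: of_nat_le_iff Suc_le_eq)
        then show ?thesis by simp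
      qed
      then have "grid_point A m j \<le> real A" using m by (simp add: grid_point_def field_simps)
      moreover have "0 \<le> real j / real m" by simp
      ultimately have "t \<notin> {real j / real m - real A<..grid_point A m j}"
        using False unfolding greaterThanAtMost_iff by linarith
      then show ?thesis by simp
    qed
    then show ?thesis unfolding if_not_P[OF False] grid_step_def by simp
  qed
qed

text \<open>All cells have length \<open>1 / m\<close>, so the norm of a step function is linear in
  the absolute values at the grid points, the form handled by
  \<open>joint_char_conv_abs\<close>.\<close>

lemma integral_abs_grid_step:
  assumes m: "m > 0"
  shows "(\<integral>t. \<bar>grid_step A m f t\<bar> \<partial>lborel) = (\<Sum>j<2 * A * m. \<bar>f (grid_point A m j)\<bar> / real m)"
    and "integrable lborel (grid_step A m f)"
proof -
  have ii: "integrable lborel (\<lambda>t. indicator {a<..b} t * c)" for a b c :: real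
    by (rule integrable_mult_left) (cases "a \<le> b", auto)
  have "\<bar>grid_step A m f t\<bar> = grid_step A m (\<lambda>s. \<bar>f s\<bar>) t" for t
    by (simp add: grid_step_eq[OF m])
  then have "(\<integral>t. \<bar>grid_step A m f t\<bar> \<partial>lborel) = (\<integral>t. grid_step A m (\<lambda>s. \<bar>f s\<bar>) t \<partial>lborel)" by simp
  also have "\<dots> = (\<Sum>j<2 * A * m. \<integral>t. indicator {real j / real m - real A<..grid_point A m j} t * \<bar>f (grid_point A m j)\<bar> \<partial>lborel)"
    unfolding grid_step_def by (rule Bochner_Integration.integral_sum) (rule ii)
  also have "\<dots> = (\<Sum>j<2 * A * m. \<bar>f (grid_point A m j)\<bar> / real m)"
  proof (intro sum.cong refl)
    fix j
    have "real j / real m - real A \<le> grid_point A m j"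
      using m by (simp add: grid_point_def field_simps)
    then have "measure lborel {real j / real m - real A<..grid_point A m j} = 1 / real m"
      using m by (simp add: grid_point_def field_simps)
    then show "(\<integral>t. indicator {real j / real m - real A<..grid_point A m j} t * \<bar>f (grid_point A m j)\<bar> \<partial>lborel) = \<bar>f (grid_point A m j)\<bar> / real m"
      by simp
  qed
  finally show "(\<integral>t. \<bar>grid_step A m f t\<bar> \<partial>lborel) = (\<Sum>j<2 * A * m. \<bar>f (grid_point A m j)\<bar> / real m)" .
  show "integrable lborel (grid_step A m f)"
    unfolding grid_step_def[abs_def] by (intro Bochner_Integration.integrable_sum ii)
qed

text \<open>Stated for a general family because it serves both the empirical process and the partial
  sums of the Gaussian series. These share the bounds \<open>s1\<close> and \<open>s2\<close>, which
  are free of \<open>n\<close>, so the discretisation error is uniform.\<close>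

lemma (in prob_space) discretized_L1_norm:
  fixes g :: "'a \<Rightarrow> real \<Rightarrow> real" and A :: nat
  assumes m: "m > 0"
    and g_meas [measurable]: "(\<lambda>(x, t). g x t) \<in> borel_measurable (M \<Otimes>\<^sub>M lborel)"
    and s1: "\<And>t. (\<integral>\<^sup>+x. ennreal \<bar>g x t\<bar> \<partial>M) \<le> ennreal (s1 t)" "integrable lborel s1" "\<And>t. 0 \<le> s1 t"
    and s2: "\<And>s t. (\<integral>\<^sup>+x. ennreal \<bar>g x t - g x s\<bar> \<partial>M) \<le> ennreal (s2 s t)" "\<And>s t. 0 \<le> s2 s t"
  defines "d \<equiv> \<lambda>t. if - real A < t \<and> t \<le> real A then s2 (grid_ceil m t) t else s1 t"
  assumes d_int: "integrable lborel d"
  shows "norm ((\<integral>x. iexp (u * (\<integral>t. \<bar>g x t\<bar> \<partial>lborel)) \<partial>M)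
     - (\<integral>x. iexp (\<Sum>j<2 * A * m. u / real m * \<bar>g x (grid_point A m j)\<bar>) \<partial>M)) \<le> \<bar>u\<bar> * (\<integral>t. d t \<partial>lborel)"
proof -
  interpret PL: pair_sigma_finite M lborel ..
  have g_sec: "(\<lambda>x. g x s) \<in> borel_measurable M" for s
    using measurable_compose[OF measurable_Pair2'[of s lborel M] g_meas] by simp
  have [measurable]: "(\<lambda>z. g (fst z) s) \<in> borel_measurable (M \<Otimes>\<^sub>M lborel)" for s
    by (rule measurable_compose[OF measurable_fst g_sec])
  define r where "r x t = g x t - grid_step A m (g x) t" for x t
  have r_meas [measurable]: "(\<lambda>(x, t). r x t) \<in> borel_measurable (M \<Otimes>\<^sub>M lborel)"
    unfolding r_def grid_step_def split_beta' using g_meas[unfolded split_beta'] by measurable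
  have r_eq: "r x t = (if - real A < t \<and> t \<le> real A then g x t - g x (grid_ceil m t) else g x t)" for x t
    by (simp add: r_def grid_step_eq[OF m])
  have d0: "0 \<le> d t" for t using s1(3) s2(2) by (simp add: d_def)
  have r_nn: "(\<integral>\<^sup>+z. ennreal \<bar>(\<lambda>(x, t). r x t) z\<bar> \<partial>(M \<Otimes>\<^sub>M lborel)) \<le> ennreal (\<integral>t. d t \<partial>lborel)"
  proof -
    have "(\<integral>\<^sup>+z. ennreal \<bar>(\<lambda>(x, t). r x t) z\<bar> \<partial>(M \<Otimes>\<^sub>M lborel)) = (\<integral>\<^sup>+t. \<integral>\<^sup>+x. ennreal \<bar>r x t\<bar> \<partial>M \<partial>lborel)"
      by (subst PL.nn_integral_snd[symmetric]) auto
    also have "\<dots> \<le> (\<integral>\<^sup>+t. ennreal (d t) \<partial>lborel)"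
    proof (rule nn_integral_mono)
      fix t
      show "(\<integral>\<^sup>+x. ennreal \<bar>r x t\<bar> \<partial>M) \<le> ennreal (d t)"
        using s1(1) s2(1) by (cases "- real A < t \<and> t \<le> real A") (auto simp: r_eq d_def)
    qed
    also have "\<dots> = ennreal (\<integral>t. d t \<partial>lborel)"
      using d0 by (intro nn_integral_eq_integral d_int) auto
    finally show ?thesis .
  qed
  have r_int: "integrable (M \<Otimes>\<^sub>M lborel) (\<lambda>(x, t). r x t)"
    using r_nn by (intro integrableI_bounded) (auto simp: real_norm_def intro: le_less_trans)
  have g_int: "integrable (M \<Otimes>\<^sub>M lborel) (\<lambda>(x, t). g x t)"
  proof (rule integrableI_bounded[OF g_meas])
    have "(\<integral>\<^sup>+z. ennreal (norm ((\<lambda>(x, t). g x t) z)) \<partial>(M \<Otimes>\<^sub>M lborel)) = (\<integral>\<^sup>+t. \<integral>\<^sup>+x. ennreal \<bar>g x t\<bar> \<partial>M \<partial>lborel)"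
      by (subst PL.nn_integral_snd[symmetric]) auto
    also have "\<dots> \<le> (\<integral>\<^sup>+t. ennreal (s1 t) \<partial>lborel)"
      by (intro nn_integral_mono s1(1))
    also have "\<dots> < \<infinity>" using s1(2,3) by (subst nn_integral_eq_integral) auto
    finally show "(\<integral>\<^sup>+z. ennreal (norm ((\<lambda>(x, t). g x t) z)) \<partial>(M \<Otimes>\<^sub>M lborel)) < \<infinity>" .
  qed
  define R where "R x = (\<integral>t. \<bar>r x t\<bar> \<partial>lborel)" for x
  have ra: "integrable (M \<Otimes>\<^sub>M lborel) (\<lambda>(x, t). \<bar>r x t\<bar>)"
    using integrable_abs[OF r_int] by (simp add: split_beta')
  have R_int: "integrable M R" unfolding R_def by (rule PL.integrable_fst[OF ra])
  have R_le: "(\<integral>x. R x \<partial>M) \<le> (\<integral>t. d t \<partial>lborel)"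
  proof -
    have "(\<integral>x. R x \<partial>M) = (\<integral>z. \<bar>(\<lambda>(x, t). r x t) z\<bar> \<partial>(M \<Otimes>\<^sub>M lborel))"
      unfolding R_def using PL.integral_fst[OF ra] by (simp add: split_beta')
    also have "ennreal \<dots> = (\<integral>\<^sup>+z. ennreal \<bar>(\<lambda>(x, t). r x t) z\<bar> \<partial>(M \<Otimes>\<^sub>M lborel))"
      using r_int by (intro nn_integral_eq_integral[symmetric] integrable_abs) auto
    also note r_nn
    finally show ?thesis using d0 by (subst (asm) ennreal_le_iff) (auto intro: integral_nonneg_AE)
  qed
  define a where "a x = (\<integral>t. \<bar>g x t\<bar> \<partial>lborel)" for x
  define b where "b x = (\<Sum>j<2 * A * m. \<bar>g x (grid_point A m j)\<bar> / real m)" for x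
  have ga: "integrable (M \<Otimes>\<^sub>M lborel) (\<lambda>(x, t). \<bar>g x t\<bar>)"
    using integrable_abs[OF g_int] by (simp add: split_beta')
  have a_meas: "a \<in> borel_measurable M"
    using borel_measurable_integrable[OF PL.integrable_fst[OF ga]] unfolding a_def[abs_def] .
  have b_meas: "b \<in> borel_measurable M"
    unfolding b_def[abs_def] using g_sec by simp
  \<comment> \<open>Integrability of the path \<open>g x\<close> is known almost surely, by Fubini,
    and the norms are compared accordingly.\<close>
  have ab: "AE x in M. \<bar>a x - b x\<bar> \<le> R x"
    using PL.AE_integrable_fst'[OF g_int]
  proof eventually_elim
    fix x assume "integrable lborel (\<lambda>t. (\<lambda>(x, t). g x t) (x, t))"
    then have i: "integrable lborel (g x)" by simp
    have j: "integrable lborel (grid_step A m (g x))" by (rule integral_abs_grid_step(2)[OF m])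
    have "\<bar>a x - b x\<bar> = \<bar>\<integral>t. \<bar>g x t\<bar> - \<bar>grid_step A m (g x) t\<bar> \<partial>lborel\<bar>"
      unfolding a_def b_def integral_abs_grid_step(1)[OF m, symmetric] using i j by simp
    also have "\<dots> \<le> (\<integral>t. \<bar>r x t\<bar> \<partial>lborel)"
      unfolding r_def using i j norm_integral_le_integral[of lborel "\<lambda>t. \<bar>g x t\<bar> - \<bar>grid_step A m (g x) t\<bar>" "\<lambda>t. \<bar>g x t - grid_step A m (g x) t\<bar>"]
      by auto
    finally show "\<bar>a x - b x\<bar> \<le> R x" by (simp add: R_def)
  qed
  have abu: "AE x in M. \<bar>u * a x - u * b x\<bar> \<le> \<bar>u\<bar> * R x"
    using ab by eventually_elim (simp add: right_diff_distrib[symmetric] abs_mult mult_left_mono)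
  have mu: "(\<lambda>x. u * a x) \<in> borel_measurable M" "(\<lambda>x. u * b x) \<in> borel_measurable M"
    using a_meas b_meas by auto
  have R0: "0 \<le> R x" for x unfolding R_def by simp
  have i: "integrable M (\<lambda>x. u * a x - u * b x)"
    by (rule Bochner_Integration.integrable_bound[OF integrable_mult_right[OF R_int, of "\<bar>u\<bar>"]])
       (use mu abu R0 in \<open>auto simp: abs_mult\<close>)
  have eq: "(\<Sum>j<2 * A * m. u / real m * \<bar>g x (grid_point A m j)\<bar>) = u * b x" for x
    by (simp add: b_def sum_distrib_left)
  have "norm ((\<integral>x. iexp (u * a x) \<partial>M) - (\<integral>x. iexp (u * b x) \<partial>M)) \<le> (\<integral>x. \<bar>u * a x - u * b x\<bar> \<partial>M)"
    by (rule norm_integral_iexp_diff_le[OF mu i])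
  also have "\<dots> \<le> (\<integral>x. \<bar>u\<bar> * R x \<partial>M)"
    by (rule integral_mono_AE) (use i R_int abu in auto)
  also have "\<dots> \<le> \<bar>u\<bar> * (\<integral>t. d t \<partial>lborel)" using R_le by (simp add: mult_left_mono)
  finally show ?thesis unfolding eq a_def .
qed

context empirical_process
begin

text \<open>The sums start at time \<open>0\<close>, whereas the empirical measure uses times
  \<open>1\<close> to \<open>n\<close>; the two differ by one shift, which preserves the
  law.\<close>

definition E :: "nat \<Rightarrow> 'a \<Rightarrow> real \<Rightarrow> real" where
  "E n x t = (\<Sum>k<n. e t ((T ^^ k) x)) / sqrt (real n)"

lemma E_meas [measurable]: "(\<lambda>(x, t). E n x t) \<in> borel_measurable (M \<Otimes>\<^sub>M lborel)"
  unfolding E_def e_def indicator_def atMost_iff by measurable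

definition moment_bound :: "real \<Rightarrow> real" where
  "moment_bound t = sqrt 2 * sqrt (S2 t)"

definition incr_bound :: "real \<Rightarrow> real \<Rightarrow> real" where
  "incr_bound s t = sqrt (4 * \<omega> \<bar>F t - F s\<bar>)"

lemma \<omega>_meas [measurable]: "\<omega> \<in> borel_measurable borel"
  unfolding \<omega>_def[abs_def] by measurable

lemma moment_bound_int: "integrable lborel moment_bound"
  unfolding moment_bound_def[abs_def] by (intro integrable_mult_right sqrt_S2_int)

lemma bounds_nonneg: "0 \<le> moment_bound t" "0 \<le> incr_bound s t"
  by (auto simp: moment_bound_def incr_bound_def S2_nonneg \<omega>_nonneg)

lemma nn_integral_scaled_sum_le:
  fixes f :: "'a \<Rightarrow> real"
  assumes [measurable]: "f \<in> borel_measurable M" and f: "\<And>x. \<bar>f x\<bar> \<le> B"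
    and le: "(\<integral>x. (\<Sum>k<n. f ((T ^^ k) x))\<^sup>2 \<partial>M) \<le> real n * c" and c: "0 \<le> c"
  shows "(\<integral>\<^sup>+x. ennreal \<bar>(\<Sum>k<n. f ((T ^^ k) x)) / sqrt (real n)\<bar> \<partial>M) \<le> ennreal (sqrt c)"
proof (cases "n = 0")
  case False
  define s where "s x = (\<Sum>k<n. f ((T ^^ k) x))" for x
  have s_bd: "\<bar>s x\<bar> \<le> real n * B" for x
    unfolding s_def using sum_bounded_above[of "{..<n}" "\<lambda>k. \<bar>f ((T ^^ k) x)\<bar>" B] f
    by (intro order_trans[OF sum_abs]) auto
  have [measurable]: "s \<in> borel_measurable M" unfolding s_def[abs_def] by measurable
  have i: "integrable M s" by (rule integrable_bounded[where B="real n * B"]) (auto simp: s_bd)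
  have i2: "integrable M (\<lambda>x. (s x)\<^sup>2)"
    by (rule integrable_bounded[where B="(real n * B)\<^sup>2"]) (use power_mono[OF s_bd, of _ 2] in auto)
  have "(\<integral>\<^sup>+x. ennreal \<bar>s x / sqrt (real n)\<bar> \<partial>M) = ennreal (\<integral>x. \<bar>s x / sqrt (real n)\<bar> \<partial>M)"
    using i by (intro nn_integral_eq_integral) auto
  also have "(\<integral>x. \<bar>s x / sqrt (real n)\<bar> \<partial>M) = (\<integral>x. \<bar>s x\<bar> \<partial>M) / sqrt (real n)"
    by (simp add: abs_divide)
  also have "\<dots> \<le> sqrt (real n * c) / sqrt (real n)"
    using le order_trans[OF integral_abs_le_sqrt[OF i i2]] unfolding s_def by (intro divide_right_mono) auto
  also have "\<dots> = sqrt c" using False by (simp add: real_sqrt_mult)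
  finally show ?thesis unfolding s_def by (simp add: ennreal_leI)
qed simp

lemma E_bounds:
  "(\<integral>\<^sup>+x. ennreal \<bar>E n x t\<bar> \<partial>M) \<le> ennreal (moment_bound t)"
  "(\<integral>\<^sup>+x. ennreal \<bar>E n x t - E n x s\<bar> \<partial>M) \<le> ennreal (incr_bound s t)"
proof -
  have "(\<integral>\<^sup>+x. ennreal \<bar>E n x t\<bar> \<partial>M) \<le> ennreal (sqrt (2 * S2 t))"
    unfolding E_def
    by (rule nn_integral_scaled_sum_le[OF e_meas abs_e_le]) (use e_sum_sq_le[of t n] S2_nonneg in \<open>auto simp: mult_ac\<close>)
  then show "(\<integral>\<^sup>+x. ennreal \<bar>E n x t\<bar> \<partial>M) \<le> ennreal (moment_bound t)" by (simp add: moment_bound_def real_sqrt_mult)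
  have "(\<integral>\<^sup>+x. ennreal \<bar>(\<Sum>k<n. (\<lambda>x. e t x - e s x) ((T ^^ k) x)) / sqrt (real n)\<bar> \<partial>M) \<le> ennreal (incr_bound s t)"
    unfolding incr_bound_def
  proof (rule nn_integral_scaled_sum_le[where B=2])
    show "\<bar>e t x - e s x\<bar> \<le> 2" for x using abs_e_le[of t x] abs_e_le[of s x] by linarith
  qed (use e_diff_sum_sq_le[of t s n] \<omega>_nonneg in \<open>auto simp: mult_ac\<close>)
  then show "(\<integral>\<^sup>+x. ennreal \<bar>E n x t - E n x s\<bar> \<partial>M) \<le> ennreal (incr_bound s t)"
    by (simp add: E_def sum_subtractf diff_divide_distrib)
qed

text \<open>Bessel's inequality for the coefficients transfers the bounds on \<open>K\<close> to
  every partial sum, with the same right sides as for \<open>E\<close>.\<close>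

lemma G_bounds:
  "(\<integral>\<^sup>+w. ennreal \<bar>gs.G n w t\<bar> \<partial>gauss_seq) \<le> ennreal (moment_bound t)"
  "(\<integral>\<^sup>+w. ennreal \<bar>gs.G n w t - gs.G n w s\<bar> \<partial>gauss_seq) \<le> ennreal (incr_bound s t)"
proof -
  have le: "(\<integral>\<^sup>+w. ennreal \<bar>\<Sum>k<n. a k * w k\<bar> \<partial>gauss_seq) \<le> ennreal (sqrt (\<Sum>k<n. (a k)\<^sup>2))" for a :: "nat \<Rightarrow> real"
    using integral_abs_gauss_sum_le[where n=n and a=a]
    by (subst nn_integral_eq_integral) (auto intro!: ennreal_leI integrable_gauss_sum)
  have "(\<integral>\<^sup>+w. ennreal \<bar>gs.G n w t\<bar> \<partial>gauss_seq) \<le> ennreal (sqrt (\<Sum>k<n. (gs.L k t)\<^sup>2))"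
    unfolding gs.G_def by (rule le)
  also have "\<dots> \<le> ennreal (moment_bound t)"
    unfolding moment_bound_def real_sqrt_mult[symmetric]
    by (intro ennreal_leI real_sqrt_le_mono order_trans[OF sum_gs_coeff_sq_le[OF psd_K] K_diag_le])
  finally show "(\<integral>\<^sup>+w. ennreal \<bar>gs.G n w t\<bar> \<partial>gauss_seq) \<le> ennreal (moment_bound t)" .
  have "(\<integral>\<^sup>+w. ennreal \<bar>gs.G n w t - gs.G n w s\<bar> \<partial>gauss_seq) \<le> ennreal (sqrt (\<Sum>k<n. (gs.L k t - gs.L k s)\<^sup>2))"
    unfolding gs.G_def sum_subtractf[symmetric] left_diff_distrib[symmetric] by (rule le)
  also have "\<dots> \<le> ennreal (incr_bound s t)"
    unfolding incr_bound_def
  proof (intro ennreal_leI real_sqrt_le_mono)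
    have "(\<Sum>k<n. (gs.L k t - gs.L k s)\<^sup>2) \<le> K t t - 2 * K t s + K s s" by (rule sum_gs_coeff_diff_sq_le[OF psd_K])
    also have "\<dots> \<le> 4 * \<omega> \<bar>F s - F t\<bar>" by (rule K_diff_le)
    finally show "(\<Sum>k<n. (gs.L k t - gs.L k s)\<^sup>2) \<le> 4 * \<omega> \<bar>F t - F s\<bar>" by (simp add: abs_minus_commute)
  qed
  finally show "(\<integral>\<^sup>+w. ennreal \<bar>gs.G n w t - gs.G n w s\<bar> \<partial>gauss_seq) \<le> ennreal (incr_bound s t)" .
qed

definition grid_error :: "nat \<Rightarrow> nat \<Rightarrow> real \<Rightarrow> real" where
  "grid_error A m t = (if - real A < t \<and> t \<le> real A then incr_bound (grid_ceil m t) t else moment_bound t)"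

lemma incr_bound_le: "incr_bound s t \<le> sqrt (4 * \<omega> 1)"
proof -
  have "\<bar>F t - F s\<bar> \<le> 1" using F_01[of t] F_01[of s] by linarith
  then show ?thesis unfolding incr_bound_def by (intro real_sqrt_le_mono mult_left_mono \<omega>_mono) auto
qed

lemma incr_bound_grid_meas [measurable]: "(\<lambda>t. incr_bound (grid_ceil m t) t) \<in> borel_measurable borel"
  unfolding incr_bound_def by measurable

lemma grid_error_split: "grid_error A m t = indicator {- real A<..real A} t * incr_bound (grid_ceil m t) t + indicator (- {- real A<..real A}) t * moment_bound t"
  by (auto simp: grid_error_def indicator_def)

lemma grid_error_int1: "integrable lborel (\<lambda>t. indicator {- real A<..real A} t * incr_bound (grid_ceil m t) t)"
proof (rule Bochner_Integration.integrable_bound)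
  show "integrable lborel (\<lambda>t. indicator {- real A<..real A} t * sqrt (4 * \<omega> 1))" by simp
  show "AE t in lborel. norm (indicator {- real A<..real A} t * incr_bound (grid_ceil m t) t) \<le> norm (indicator {- real A<..real A} t * sqrt (4 * \<omega> 1))"
    using incr_bound_le bounds_nonneg(2) by (intro AE_I2) (auto simp: indicator_def intro: order_trans[OF _ abs_ge_self])
qed simp

lemma grid_error_int2: "integrable lborel (\<lambda>t. indicator (- {- real A<..real A}) t * moment_bound t)"
  using integrable_real_mult_indicator[OF _ moment_bound_int, of "- {- real A<..real A}"] by (simp add: mult.commute)

lemma grid_error_int: "integrable lborel (grid_error A m)"
  unfolding grid_error_split[abs_def] by (intro Bochner_Integration.integrable_add grid_error_int1 grid_error_int2)

lemma grid_ceil_tendsto: "(\<lambda>m. grid_ceil (Suc m) t) \<longlonglongrightarrow> t" and grid_ceil_ge: "t \<le> grid_ceil (Suc m) t"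
proof -
  have ge: "t \<le> grid_ceil (Suc m) t" for m
  proof -
    have "t * real (Suc m) \<le> real_of_int \<lceil>t * real (Suc m)\<rceil>" by (rule le_of_int_ceiling)
    then show ?thesis unfolding grid_ceil_def by (subst pos_le_divide_eq) auto
  qed
  show "t \<le> grid_ceil (Suc m) t" by (rule ge)
  have le: "grid_ceil (Suc m) t \<le> t + inverse (real (Suc m))" for m
  proof -
    have "real_of_int \<lceil>t * real (Suc m)\<rceil> \<le> t * real (Suc m) + 1" by (rule of_int_ceiling_le_add_one)
    then have "grid_ceil (Suc m) t \<le> (t * real (Suc m) + 1) / real (Suc m)"
      unfolding grid_ceil_def by (intro divide_right_mono) auto
    also have "\<dots> = t + inverse (real (Suc m))" by (simp add: add_divide_distrib inverse_eq_divide del: of_nat_Suc)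
    finally show ?thesis .
  qed
  show "(\<lambda>m. grid_ceil (Suc m) t) \<longlonglongrightarrow> t"
  proof (rule tendsto_sandwich[OF _ _ tendsto_const])
    have "(\<lambda>m. t + inverse (real (Suc m))) \<longlonglongrightarrow> t + 0" by (intro tendsto_intros LIMSEQ_inverse_real_of_nat)
    then show "(\<lambda>m. t + inverse (real (Suc m))) \<longlonglongrightarrow> t" by simp
  qed (use ge le in auto)
qed

text \<open>The rounded points approach \<open>t\<close> from above or coincide with it, so right
  continuity suffices.\<close>

lemma F_grid_ceil_tendsto: "(\<lambda>m. F (grid_ceil (Suc m) t)) \<longlonglongrightarrow> F t"
proof (rule tendstoI)
  fix \<epsilon> :: real assume "0 < \<epsilon>"
  have "(F \<longlongrightarrow> F t) (at_right t)"
    using X0_distr.cdf_is_right_cont[of t] unfolding continuous_within F_def[abs_def] .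
  then have "\<forall>\<^sub>F s in at_right t. dist (F s) (F t) < \<epsilon>" using \<open>0 < \<epsilon>\<close> by (rule tendstoD)
  then obtain b where b: "b > t" "\<And>s. t < s \<Longrightarrow> s < b \<Longrightarrow> dist (F s) (F t) < \<epsilon>"
    unfolding eventually_at_right_field by blast
  have "\<forall>\<^sub>F m in sequentially. grid_ceil (Suc m) t < b" by (rule order_tendstoD(2)[OF grid_ceil_tendsto b(1)])
  then show "\<forall>\<^sub>F m in sequentially. dist (F (grid_ceil (Suc m) t)) (F t) < \<epsilon>"
  proof eventually_elim
    fix m assume "grid_ceil (Suc m) t < b"
    then show "dist (F (grid_ceil (Suc m) t)) (F t) < \<epsilon>"
      using grid_ceil_ge[of t m] b(2)[of "grid_ceil (Suc m) t"] \<open>0 < \<epsilon>\<close> by (cases "grid_ceil (Suc m) t = t") auto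
  qed
qed

text \<open>\<open>A\<close> is chosen first, from integrability of the moment bound at infinity;
  then \<open>m\<close>, by dominated convergence on the bounded interval.\<close>

lemma grid_error_small:
  assumes \<epsilon>: "0 < \<epsilon>"
  shows "\<exists>A m. m > 0 \<and> (\<integral>t. grid_error A m t \<partial>lborel) < \<epsilon>"
proof -
  have "(\<lambda>A. \<integral>t. indicator (- {- real A<..real A}) t * moment_bound t \<partial>lborel) \<longlonglongrightarrow> (\<integral>t. 0 \<partial>(lborel :: real measure))"
  proof (rule integral_dominated_convergence[where w=moment_bound])
    show "AE t in lborel. (\<lambda>A. indicator (- {- real A<..real A}) t * moment_bound t) \<longlonglongrightarrow> 0"
    proof (rule AE_I2)
      fix t :: real
      obtain A0 :: nat where A0: "\<bar>t\<bar> < real A0" using reals_Archimedean2 by blast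
      have "indicator (- {- real A<..real A}) t * moment_bound t = 0" if "A \<ge> A0" for A
        using A0 that by (auto simp: indicator_def abs_less_iff)
      then show "(\<lambda>A. indicator (- {- real A<..real A}) t * moment_bound t) \<longlonglongrightarrow> 0"
        by (intro tendsto_eventually) (auto simp: eventually_sequentially)
    qed
    show "AE t in lborel. norm (indicator (- {- real A<..real A}) t * moment_bound t) \<le> moment_bound t" for A
      using bounds_nonneg(1) by (intro AE_I2) (auto simp: indicator_def)
  qed (use moment_bound_int borel_measurable_integrable[OF grid_error_int2] in auto)
  then have "(\<lambda>A. \<integral>t. indicator (- {- real A<..real A}) t * moment_bound t \<partial>lborel) \<longlonglongrightarrow> 0" by simp
  from order_tendstoD(2)[OF this, of "\<epsilon>/2"] \<epsilon> obtain A where A: "(\<integral>t. indicator (- {- real A<..real A}) t * moment_bound t \<partial>lborel) < \<epsilon> / 2"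
    by (auto simp: eventually_sequentially)
  have "(\<lambda>m. \<integral>t. indicator {- real A<..real A} t * incr_bound (grid_ceil (Suc m) t) t \<partial>lborel) \<longlonglongrightarrow> (\<integral>t. 0 \<partial>(lborel :: real measure))"
  proof (rule integral_dominated_convergence[where w="\<lambda>t. indicator {- real A<..real A} t * sqrt (4 * \<omega> 1)"])
    show "AE t in lborel. (\<lambda>m. indicator {- real A<..real A} t * incr_bound (grid_ceil (Suc m) t) t) \<longlonglongrightarrow> 0"
    proof (rule AE_I2)
      fix t
      have "(\<lambda>m. \<bar>F t - F (grid_ceil (Suc m) t)\<bar>) \<longlonglongrightarrow> \<bar>F t - F t\<bar>"
        by (intro tendsto_intros F_grid_ceil_tendsto)
      then have "(\<lambda>m. \<omega> \<bar>F t - F (grid_ceil (Suc m) t)\<bar>) \<longlonglongrightarrow> 0" by (intro \<omega>_tendsto) auto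
      then have "(\<lambda>m. indicator {- real A<..real A} t * sqrt (4 * \<omega> \<bar>F t - F (grid_ceil (Suc m) t)\<bar>)) \<longlonglongrightarrow> indicator {- real A<..real A} t * sqrt (4 * 0)"
        by (intro tendsto_intros)
      then show "(\<lambda>m. indicator {- real A<..real A} t * incr_bound (grid_ceil (Suc m) t) t) \<longlonglongrightarrow> 0"
        by (simp add: incr_bound_def)
    qed
    show "AE t in lborel. norm (indicator {- real A<..real A} t * incr_bound (grid_ceil (Suc m) t) t) \<le> indicator {- real A<..real A} t * sqrt (4 * \<omega> 1)" for m
      using incr_bound_le bounds_nonneg(2) by (intro AE_I2) (auto simp: indicator_def)
  qed (use borel_measurable_integrable[OF grid_error_int1] in auto)
  then have "(\<lambda>m. \<integral>t. indicator {- real A<..real A} t * incr_bound (grid_ceil (Suc m) t) t \<partial>lborel) \<longlonglongrightarrow> 0" by simp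
  from order_tendstoD(2)[OF this, of "\<epsilon>/2"] \<epsilon> obtain m where m: "(\<integral>t. indicator {- real A<..real A} t * incr_bound (grid_ceil (Suc m) t) t \<partial>lborel) < \<epsilon> / 2"
    by (auto simp: eventually_sequentially)
  have "(\<integral>t. grid_error A (Suc m) t \<partial>lborel) < \<epsilon>"
    unfolding grid_error_split Bochner_Integration.integral_add[OF grid_error_int1 grid_error_int2] using A m by linarith
  then show ?thesis by blast
qed

text \<open>Grid points are rational, hence terms of the sequence \<open>q\<close>. Once
  \<open>n'\<close> exceeds all their indices, the partial sum has covariance exactly
  \<open>K\<close> on the grid, as has the limit in \<open>Y_clt\<close>.\<close>

lemma grid_char_tendsto:
  assumes m: "m > 0"
  shows "\<exists>n0. \<forall>n'\<ge>n0. (\<lambda>n. \<integral>x. iexp (\<Sum>j<2 * A * m. u / real m * \<bar>E n x (grid_point A m j)\<bar>) \<partial>M)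
     \<longlonglongrightarrow> (\<integral>w. iexp (\<Sum>j<2 * A * m. u / real m * \<bar>gs.G n' w (grid_point A m j)\<bar>) \<partial>gauss_seq)"
proof -
  let ?p = "2 * A * m" and ?x = "grid_point A m"
  have "?x j \<in> \<rat>" for j unfolding grid_point_def by simp
  then have "\<exists>i. ?x j = q i" for j using range_q by (metis imageE)
  then obtain i where i: "\<And>j. ?x j = q (i j)" by metis
  define n0 where "n0 = Suc (Max (i ` {..<?p}))"
  have n0: "i j < n0" if "j < ?p" for j
    unfolding n0_def using that by (simp add: less_Suc_eq_le)
  show ?thesis
  proof (intro exI allI impI)
    fix n' assume n': "n' \<ge> n0"
    show "(\<lambda>n. \<integral>x. iexp (\<Sum>j<?p. u / real m * \<bar>E n x (?x j)\<bar>) \<partial>M)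
     \<longlonglongrightarrow> (\<integral>w. iexp (\<Sum>j<?p. u / real m * \<bar>gs.G n' w (?x j)\<bar>) \<partial>gauss_seq)"
    proof (rule joint_char_conv_abs[OF prob_space_axioms prob_space_gauss_seq])
      show "(\<lambda>x. E n x (?x j)) \<in> borel_measurable M" for n j unfolding E_def by measurable
      show "(\<lambda>w. gs.G n' w (?x j)) \<in> borel_measurable gauss_seq" for j
        unfolding gs.G_def using gauss_seq_coord by measurable
      fix a :: "nat \<Rightarrow> real"
      have "(\<Sum>j<?p. a j * E n x (?x j)) = 1 / sqrt (real n) * (\<Sum>k<n. Y ?p a ?x ((T ^^ k) x))" for n x
      proof -
        have "(\<Sum>k<n. Y ?p a ?x ((T ^^ k) x)) = (\<Sum>j<?p. \<Sum>k<n. a j * e (?x j) ((T ^^ k) x))"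
          unfolding Y_def by (rule sum.swap)
        then show ?thesis by (simp add: E_def sum_distrib_left sum_divide_distrib)
      qed
      then have 1: "(\<lambda>n. \<integral>x. iexp (\<Sum>j<?p. a j * E n x (?x j)) \<partial>M) \<longlonglongrightarrow>
         exp (- (1\<^sup>2 * (\<Sum>i<?p. \<Sum>j<?p. a i * a j * K (?x i) (?x j)) / 2))"
        using Y_clt[of 1 ?p a ?x] by (simp only:)
      define b where "b k = (\<Sum>j<?p. a j * gs.L k (?x j))" for k
      have 2: "(\<Sum>j<?p. a j * gs.G n' w (?x j)) = (\<Sum>k<n'. b k * w k)" for w
      proof -
        have "(\<Sum>j<?p. a j * gs.G n' w (?x j)) = (\<Sum>j<?p. \<Sum>k<n'. a j * gs.L k (?x j) * w k)"
          by (simp add: gs.G_def sum_distrib_left mult.assoc)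
        also have "\<dots> = (\<Sum>k<n'. b k * w k)"
          unfolding b_def sum_distrib_right by (rule sum.swap)
        finally show ?thesis .
      qed
      have 3: "(\<Sum>k<n'. (b k)\<^sup>2) = (\<Sum>i<?p. \<Sum>j<?p. a i * a j * K (?x i) (?x j))"
      proof -
        have "(\<Sum>i<?p. \<Sum>j<?p. a i * a j * K (?x i) (?x j)) = (\<Sum>i<?p. \<Sum>j<?p. \<Sum>k<n'. (a i * gs.L k (?x i)) * (a j * gs.L k (?x j)))"
        proof (intro sum.cong refl)
          fix l j assume "j \<in> {..<?p}"
          then have "K (?x l) (q (i j)) = (\<Sum>k<n'. gs.L k (?x l) * gs.L k (q (i j)))"
            using n0[of j] n' by (intro kernel_eq_gs_sum[OF psd_K]) auto
          then show "a l * a j * K (?x l) (?x j) = (\<Sum>k<n'. (a l * gs.L k (?x l)) * (a j * gs.L k (?x j)))"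
            by (simp add: i sum_distrib_left mult_ac)
        qed
        also have "\<dots> = (\<Sum>l<?p. \<Sum>k<n'. \<Sum>j<?p. (a l * gs.L k (?x l)) * (a j * gs.L k (?x j)))"
          by (intro sum.cong refl sum.swap)
        also have "\<dots> = (\<Sum>k<n'. \<Sum>l<?p. \<Sum>j<?p. (a l * gs.L k (?x l)) * (a j * gs.L k (?x j)))"
          by (rule sum.swap)
        finally show ?thesis by (simp add: b_def power2_eq_square sum_product)
      qed
      show "(\<lambda>n. \<integral>x. iexp (\<Sum>j<?p. a j * E n x (?x j)) \<partial>M) \<longlonglongrightarrow> (\<integral>w. iexp (\<Sum>j<?p. a j * gs.G n' w (?x j)) \<partial>gauss_seq)"
        using 1 char_gauss_seq[where u=1 and n=n' and a=b] unfolding 2 3 by simp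
    qed
  qed
qed

text \<open>Four errors of \<open>\<epsilon> / 4\<close>: discretisation of the empirical process,
  the limit theorem on the grid, discretisation of a partial sum of the series, and its truncation.
  The discretisation errors are uniform in the index, so the grid, the truncation and
  \<open>n\<close> can be chosen in this order.\<close>

theorem empirical_L1_clt:
  obtains N :: "(real \<Rightarrow> real) measure" where "prob_space N" "sets N = sets L1_borel"
    "centered_gaussian_L1 N (\<lambda>w. w)"
    "\<And>f g. f \<in> Linfty \<Longrightarrow> g \<in> Linfty \<Longrightarrow>
       covariance N (\<lambda>w. \<integral>t. f t * w t \<partial>lborel) (\<lambda>w. \<integral>t. g t * w t \<partial>lborel) = gs.Q f g"
    "weak_conv_m (\<lambda>n. distr M borel (\<lambda>x. \<integral>t. \<bar>E n x t\<bar> \<partial>lborel)) (distr N borel (\<lambda>w. \<integral>t. \<bar>w t\<bar> \<partial>lborel))"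
proof -
  obtain N :: "(real \<Rightarrow> real) measure" where N: "prob_space N" "sets N = sets L1_borel"
    "centered_gaussian_L1 N (\<lambda>w. w)"
    "\<And>f g. f \<in> Linfty \<Longrightarrow> g \<in> Linfty \<Longrightarrow>
       covariance N (\<lambda>w. \<integral>t. f t * w t \<partial>lborel) (\<lambda>w. \<integral>t. g t * w t \<partial>lborel) = gs.Q f g"
    and cf: "\<And>u n. norm ((\<integral>w. iexp (u * (\<integral>t. \<bar>w t\<bar> \<partial>lborel)) \<partial>N) - (\<integral>w. iexp (u * (\<integral>t. \<bar>gs.G n w t\<bar> \<partial>lborel)) \<partial>gauss_seq)) \<le> \<bar>u\<bar> * gs.\<rho> n"
    using gs.gaussian_L1_law by blast
  interpret N: prob_space N by fact
  have Em: "(\<lambda>x. \<integral>t. \<bar>E n x t\<bar> \<partial>lborel) \<in> borel_measurable M" for n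
    using E_meas[of n] by (intro lborel.borel_measurable_lebesgue_integral) (simp add: split_beta')
  have Nm: "(\<lambda>w. \<integral>t. \<bar>w t\<bar> \<partial>lborel) \<in> borel_measurable N"
    using L1_norm_measurable measurable_cong_sets[OF N(2) refl] by blast
  have "weak_conv_m (\<lambda>n. distr M borel (\<lambda>x. \<integral>t. \<bar>E n x t\<bar> \<partial>lborel)) (distr N borel (\<lambda>w. \<integral>t. \<bar>w t\<bar> \<partial>lborel))"
  proof (rule levy_continuity)
    show "real_distribution (distr M borel (\<lambda>x. \<integral>t. \<bar>E n x t\<bar> \<partial>lborel))" for n
      by (rule real_distribution_distr[OF Em])
    show "real_distribution (distr N borel (\<lambda>w. \<integral>t. \<bar>w t\<bar> \<partial>lborel))"
      by (rule N.real_distribution_distr[OF Nm])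
    fix u :: real
    have c1: "char (distr M borel (\<lambda>x. \<integral>t. \<bar>E n x t\<bar> \<partial>lborel)) u = (\<integral>x. iexp (u * (\<integral>t. \<bar>E n x t\<bar> \<partial>lborel)) \<partial>M)" for n
      unfolding char_def by (rule integral_distr[OF Em]) simp
    have c2: "char (distr N borel (\<lambda>w. \<integral>t. \<bar>w t\<bar> \<partial>lborel)) u = (\<integral>w. iexp (u * (\<integral>t. \<bar>w t\<bar> \<partial>lborel)) \<partial>N)"
      unfolding char_def by (rule integral_distr[OF Nm]) simp
    show "(\<lambda>n. char (distr M borel (\<lambda>x. \<integral>t. \<bar>E n x t\<bar> \<partial>lborel)) u) \<longlonglongrightarrow> char (distr N borel (\<lambda>w. \<integral>t. \<bar>w t\<bar> \<partial>lborel)) u"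
      unfolding c1 c2
    proof (rule LIMSEQ_I)
      fix \<epsilon> :: real assume \<epsilon>: "0 < \<epsilon>"
      define \<delta> where "\<delta> = \<epsilon> / (4 * (\<bar>u\<bar> + 1))"
      have \<delta>: "0 < \<delta>" "\<bar>u\<bar> * \<delta> < \<epsilon> / 4"
      proof -
        show d: "0 < \<delta>" using \<epsilon> by (simp add: \<delta>_def)
        have "\<bar>u\<bar> * \<delta> < (\<bar>u\<bar> + 1) * \<delta>" using d by simp
        also have "\<dots> = \<epsilon> / 4"
        proof -
          have "s * (\<epsilon> / (4 * s)) = \<epsilon> / 4" if "0 < s" for s :: real using that by simp
          from this[of "\<bar>u\<bar> + 1"] show ?thesis unfolding \<delta>_def by linarith
        qed
        finally show "\<bar>u\<bar> * \<delta> < \<epsilon> / 4" .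
      qed
      obtain A m where m: "m > 0" and D: "(\<integral>t. grid_error A m t \<partial>lborel) < \<delta>" using grid_error_small[OF \<delta>(1)] by blast
      have uD: "\<bar>u\<bar> * (\<integral>t. grid_error A m t \<partial>lborel) < \<epsilon> / 4"
        using mult_left_mono[OF less_imp_le[OF D], of "\<bar>u\<bar>"] \<delta>(2) by linarith
      let ?gE = "\<lambda>n. \<integral>x. iexp (\<Sum>j<2 * A * m. u / real m * \<bar>E n x (grid_point A m j)\<bar>) \<partial>M"
      let ?gG = "\<lambda>n. \<integral>w. iexp (\<Sum>j<2 * A * m. u / real m * \<bar>gs.G n w (grid_point A m j)\<bar>) \<partial>gauss_seq"
      have e1: "norm ((\<integral>x. iexp (u * (\<integral>t. \<bar>E n x t\<bar> \<partial>lborel)) \<partial>M) - ?gE n) \<le> \<epsilon> / 4" for n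
        using discretized_L1_norm[OF m E_meas[of n] E_bounds(1)[where n=n] moment_bound_int bounds_nonneg(1) E_bounds(2)[where n=n] bounds_nonneg(2) grid_error_int[unfolded grid_error_def[abs_def]], where u=u and A=A, folded grid_error_def] uD
        by linarith
      have e3: "norm ((\<integral>w. iexp (u * (\<integral>t. \<bar>gs.G n w t\<bar> \<partial>lborel)) \<partial>gauss_seq) - ?gG n) \<le> \<epsilon> / 4" for n
        using gauss_seq.discretized_L1_norm[OF m gs.G_meas[of n] G_bounds(1)[where n=n] moment_bound_int bounds_nonneg(1) G_bounds(2)[where n=n] bounds_nonneg(2) grid_error_int[unfolded grid_error_def[abs_def]], where u=u and A=A, folded grid_error_def] uD
        by linarith
      obtain n0 where n0: "\<And>n'. n' \<ge> n0 \<Longrightarrow> ?gE \<longlonglongrightarrow> ?gG n'" using grid_char_tendsto[OF m] by blast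
      have "\<forall>\<^sub>F n in sequentially. gs.\<rho> n < \<delta>" by (rule order_tendstoD(2)[OF gs.\<rho>_tendsto \<delta>(1)])
      then obtain n1 where n1: "\<And>n. n \<ge> n1 \<Longrightarrow> gs.\<rho> n < \<delta>" by (auto simp: eventually_sequentially)
      define n' where "n' = max n0 n1"
      have e4: "norm ((\<integral>w. iexp (u * (\<integral>t. \<bar>w t\<bar> \<partial>lborel)) \<partial>N) - (\<integral>w. iexp (u * (\<integral>t. \<bar>gs.G n' w t\<bar> \<partial>lborel)) \<partial>gauss_seq)) < \<epsilon> / 4"
        using cf[of u n'] mult_left_mono[OF less_imp_le[OF n1[of n']], of "\<bar>u\<bar>"] \<delta>(2) by (simp add: n'_def)
      have "?gE \<longlonglongrightarrow> ?gG n'" by (rule n0) (simp add: n'_def)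
      from LIMSEQ_D[OF this, of "\<epsilon>/4"] \<epsilon> obtain n2 where n2: "\<And>n. n \<ge> n2 \<Longrightarrow> norm (?gE n - ?gG n') < \<epsilon> / 4" by auto
      have "norm ((\<integral>x. iexp (u * (\<integral>t. \<bar>E n x t\<bar> \<partial>lborel)) \<partial>M) - (\<integral>w. iexp (u * (\<integral>t. \<bar>w t\<bar> \<partial>lborel)) \<partial>N)) < \<epsilon>" if "n \<ge> n2" for n
      proof -
        have tri: "norm (a - z) < \<epsilon>" if "norm (a - b) \<le> \<epsilon>/4" "norm (b - c) < \<epsilon>/4" "norm (d - c) \<le> \<epsilon>/4" "norm (z - d) < \<epsilon>/4"
          for a b c d z :: complex
        proof -
          have "norm (a - z) \<le> norm (a - b) + norm (b - c) + norm (d - c) + norm (z - d)"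
            using norm_triangle_ineq4[of "(a - b) + (b - c)" "(d - c) + (z - d)"] norm_triangle_ineq[of "a - b" "b - c"]
              norm_triangle_ineq[of "d - c" "z - d"] by simp
          then show ?thesis using that by linarith
        qed
        show ?thesis by (rule tri[OF e1 n2[OF that] e3 e4])
      qed
      then show "\<exists>no. \<forall>n\<ge>no. norm ((\<integral>x. iexp (u * (\<integral>t. \<bar>E n x t\<bar> \<partial>lborel)) \<partial>M) - (\<integral>w. iexp (u * (\<integral>t. \<bar>w t\<bar> \<partial>lborel)) \<partial>N)) < \<epsilon>"
        by blast
    qed
  qed
  from that[OF N this] show thesis .
qed

end

section \<open>The covariance series\<close>

context empirical_process
begin

text \<open>By the layer-cake identity the integral of \<open>|e t x|\<close> over \<open>t\<close>
  is at most the mean distance from \<open>X0 x\<close> to \<open>X0\<close>, which is finite for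
  every \<open>x\<close> because \<open>X0\<close> is integrable.\<close>

lemma e_section_int: "integrable lborel (\<lambda>t. e t x)"
proof (rule integrableI_bounded)
  show "(\<lambda>t. e t x) \<in> borel_measurable lborel"
    unfolding e_def[abs_def] indicator_def atMost_iff by measurable
  interpret LM: pair_sigma_finite lborel M ..
  have "(\<integral>\<^sup>+t. ennreal (norm (e t x)) \<partial>lborel)
    \<le> (\<integral>\<^sup>+t. \<integral>\<^sup>+y. ennreal \<bar>indicator {..t} (X0 x) - indicator {..t} (X0 y)\<bar> \<partial>M \<partial>lborel)"
  proof (rule nn_integral_mono)
    fix t :: real
    have i: "integrable M (\<lambda>y. indicator {..t} (X0 y) :: real)"
      by (rule integrable_bounded[where B=1]) auto
    have "e t x = (\<integral>y. indicator {..t} (X0 x) - indicator {..t} (X0 y) \<partial>M)"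
      using i by (simp add: e_def F_eq prob_space)
    then have "norm (e t x) \<le> (\<integral>y. \<bar>indicator {..t} (X0 x) - indicator {..t} (X0 y)\<bar> \<partial>M)"
      by simp
    then have "ennreal (norm (e t x)) \<le> ennreal (\<integral>y. \<bar>indicator {..t} (X0 x) - indicator {..t} (X0 y)\<bar> \<partial>M)"
      by (rule ennreal_leI)
    also have "\<dots> = (\<integral>\<^sup>+y. ennreal \<bar>indicator {..t} (X0 x) - indicator {..t} (X0 y)\<bar> \<partial>M)"
      using i by (intro nn_integral_eq_integral[symmetric]) auto
    finally show "ennreal (norm (e t x)) \<le> \<dots>" .
  qed
  also have "\<dots> = (\<integral>\<^sup>+y. \<integral>\<^sup>+t. ennreal \<bar>indicator {..t} (X0 x) - indicator {..t} (X0 y)\<bar> \<partial>lborel \<partial>M)"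
    unfolding indicator_def atMost_iff by (intro LM.Fubini'[symmetric]) measurable
  also have "\<dots> = (\<integral>\<^sup>+y. ennreal \<bar>X0 x - X0 y\<bar> \<partial>M)"
    by (simp add: nn_integral_abs_diff_atMost_indicator)
  also have "\<dots> < \<infinity>"
    using X0_int by (subst nn_integral_eq_integral) auto
  finally show "(\<integral>\<^sup>+t. ennreal (norm (e t x)) \<partial>lborel) < \<infinity>" .
qed

text \<open>Testing the centred indicator at lag \<open>0\<close> against its own sign shows
  \<open>h t <= \<alpha> 0\<close>, so the first term of \<open>S2 t\<close> is
  \<open>h t\<close>.\<close>

lemma h_le_S2: "h t \<le> S2 t"
proof -
  have m: "(\<lambda>x. sgn (e t x)) \<in> borel_measurable F0"
    using e_F0 by measurable
  have "h t = (\<integral>x. sgn (e t x) * e t ((T ^^ 0) x) \<partial>M)"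
    unfolding h_def by (simp add: abs_sgn mult.commute)
  also have "\<dots> \<le> 1 * \<alpha> 0"
    using e_mix[OF m, of 1 t 0] by (simp add: sgn_if)
  finally have "min (\<alpha> 0) (h t) = h t" by simp
  moreover have "(\<Sum>k\<in>{0}. min (\<alpha> k) (h t)) \<le> S2 t"
    unfolding S2_def using \<alpha>_nonneg h_nonneg by (intro sum_le_suminf min_summable) auto
  ultimately show ?thesis by simp
qed

lemma Linfty_S2_int:
  assumes "f \<in> Linfty" "g \<in> Linfty"
  shows "integrable (lborel \<Otimes>\<^sub>M lborel) (\<lambda>z. \<bar>f (fst z) * sqrt (S2 (fst z))\<bar> * \<bar>g (snd z) * sqrt (S2 (snd z))\<bar>)"
  using assms by (intro lborel_pair_product(1)[where F="\<lambda>t. \<bar>f t * sqrt (S2 t)\<bar>" and G="\<lambda>t. \<bar>g t * sqrt (S2 t)\<bar>"]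
      integrable_abs integrable_Linfty_mult sqrt_S2_int)

text \<open>A minimum is at most a geometric mean. This separates the variables into integrable
  factors and justifies Fubini below.\<close>

lemma min_h_le: "min (h s) (h t) \<le> sqrt (S2 s) * sqrt (S2 t)"
proof -
  have "min (h s) (h t) = sqrt (min (h s) (h t) * min (h s) (h t))"
    using h_nonneg by simp
  also have "\<dots> \<le> sqrt (S2 s * S2 t)"
    using h_le_S2 h_nonneg S2_nonneg
    by (intro real_sqrt_le_mono mult_mono) (auto intro: order_trans[OF min.cobounded1] order_trans[OF min.cobounded2])
  finally show ?thesis by (simp add: real_sqrt_mult)
qed

definition cov_term :: "(real \<Rightarrow> real) \<Rightarrow> (real \<Rightarrow> real) \<Rightarrow> nat \<Rightarrow> real" where
  "cov_term f g k = (\<integral>z. f (fst z) * g (snd z) * \<gamma> k (fst z) (snd z) \<partial>(lborel \<Otimes>\<^sub>M lborel))"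

text \<open>For fixed levels the mean modulus of the product is at most
  \<open>min (h t) (h s)\<close>, so the triple integral converges absolutely and the mean can be
  taken inside.\<close>

lemma cov_term_eq:
  assumes f: "f \<in> Linfty" and g: "g \<in> Linfty"
  shows "(\<integral>x. (\<integral>t. f t * e t x \<partial>lborel) * (\<integral>s. g s * e s ((T ^^ k) x) \<partial>lborel) \<partial>M) = cov_term f g k"
proof -
  interpret L2: sigma_finite_measure "lborel \<Otimes>\<^sub>M (lborel :: real measure)"
    by (rule lborel_pair.sigma_finite_measure_axioms)
  interpret P: pair_sigma_finite M "lborel \<Otimes>\<^sub>M (lborel :: real measure)" ..
  have [measurable]: "f \<in> borel_measurable borel" "g \<in> borel_measurable borel"
    using f g by (auto intro: Linfty_measurable)
  define \<Phi> where "\<Phi> x z = (f (fst z) * e (fst z) x) * (g (snd z) * e (snd z) ((T ^^ k) x))" for x and z :: "real \<times> real"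
  have m [measurable]: "(\<lambda>(x, z). \<Phi> x z) \<in> borel_measurable (M \<Otimes>\<^sub>M (lborel \<Otimes>\<^sub>M lborel))"
    unfolding \<Phi>_def e_def indicator_def atMost_iff by measurable
  have "(\<integral>\<^sup>+y. ennreal (norm ((\<lambda>(x, z). \<Phi> x z) y)) \<partial>(M \<Otimes>\<^sub>M (lborel \<Otimes>\<^sub>M lborel)))
      = (\<integral>\<^sup>+z. \<integral>\<^sup>+x. ennreal \<bar>\<Phi> x z\<bar> \<partial>M \<partial>(lborel \<Otimes>\<^sub>M lborel))"
    by (subst P.nn_integral_snd[symmetric]) auto
  also have "\<dots> \<le> (\<integral>\<^sup>+z. ennreal (\<bar>f (fst z) * sqrt (S2 (fst z))\<bar> * \<bar>g (snd z) * sqrt (S2 (snd z))\<bar>) \<partial>(lborel \<Otimes>\<^sub>M lborel))"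
  proof (rule nn_integral_mono)
    fix z :: "real \<times> real"
    obtain t s where z: "z = (t, s)" by (cases z)
    have i: "integrable M (\<lambda>x. \<bar>e t x * e s ((T ^^ k) x)\<bar>)"
      by (rule integrable_bounded[where B=1]) (auto simp: abs_mult intro!: mult_le_one abs_e_le)
    have "(\<integral>x. \<bar>e t x * e s ((T ^^ k) x)\<bar> \<partial>M) \<le> h t"
      unfolding h_def using e_int mult_left_mono[OF abs_e_le, of "\<bar>e t x\<bar>" for x]
      by (intro integral_mono i) (auto simp: abs_mult)
    moreover have "(\<integral>x. \<bar>e t x * e s ((T ^^ k) x)\<bar> \<partial>M) \<le> h s"
    proof -
      have "(\<integral>x. \<bar>e t x * e s ((T ^^ k) x)\<bar> \<partial>M) \<le> (\<integral>x. \<bar>e s ((T ^^ k) x)\<bar> \<partial>M)"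
      proof (rule integral_mono[OF i])
        show "integrable M (\<lambda>x. \<bar>e s ((T ^^ k) x)\<bar>)"
          by (rule integrable_bounded[where B=1]) (auto simp: abs_e_le)
        show "\<bar>e t x * e s ((T ^^ k) x)\<bar> \<le> \<bar>e s ((T ^^ k) x)\<bar>" for x
          using mult_right_mono[OF abs_e_le[of t x], of "\<bar>e s ((T ^^ k) x)\<bar>"] by (simp add: abs_mult)
      qed
      also have "\<dots> = h s" unfolding h_def by (rule integral_funpow_T[of "\<lambda>x. \<bar>e s x\<bar>"]) simp
      finally show ?thesis .
    qed
    ultimately have b: "(\<integral>x. \<bar>e t x * e s ((T ^^ k) x)\<bar> \<partial>M) \<le> sqrt (S2 t) * sqrt (S2 s)"
      using min_h_le[of t s] by linarith
    have "(\<integral>\<^sup>+x. ennreal \<bar>\<Phi> x z\<bar> \<partial>M) = (\<integral>\<^sup>+x. ennreal (\<bar>f t * g s\<bar> * \<bar>e t x * e s ((T ^^ k) x)\<bar>) \<partial>M)"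
      unfolding \<Phi>_def z by (simp add: abs_mult mult_ac)
    also have "\<dots> = ennreal (\<bar>f t * g s\<bar> * (\<integral>x. \<bar>e t x * e s ((T ^^ k) x)\<bar> \<partial>M))"
      using i by (subst nn_integral_eq_integral) auto
    also have "\<dots> \<le> ennreal (\<bar>f t * g s\<bar> * (sqrt (S2 t) * sqrt (S2 s)))"
      by (intro ennreal_leI mult_left_mono b) simp
    finally show "(\<integral>\<^sup>+x. ennreal \<bar>\<Phi> x z\<bar> \<partial>M) \<le> ennreal (\<bar>f (fst z) * sqrt (S2 (fst z))\<bar> * \<bar>g (snd z) * sqrt (S2 (snd z))\<bar>)"
      using S2_nonneg by (simp add: z abs_mult mult_ac)
  qed
  also have "\<dots> < \<infinity>"
    using Linfty_S2_int[OF f g] by (subst nn_integral_eq_integral) auto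
  finally have i: "integrable (M \<Otimes>\<^sub>M (lborel \<Otimes>\<^sub>M lborel)) (\<lambda>(x, z). \<Phi> x z)"
    by (rule integrableI_bounded[OF m])
  have "(\<integral>x. (\<integral>t. f t * e t x \<partial>lborel) * (\<integral>s. g s * e s ((T ^^ k) x) \<partial>lborel) \<partial>M) = (\<integral>x. (\<integral>z. \<Phi> x z \<partial>(lborel \<Otimes>\<^sub>M lborel)) \<partial>M)"
    unfolding \<Phi>_def
    by (intro Bochner_Integration.integral_cong refl lborel_pair_product(2)[symmetric] integrable_Linfty_mult f g e_section_int)
  also have "\<dots> = (\<integral>z. (\<integral>x. \<Phi> x z \<partial>M) \<partial>(lborel \<Otimes>\<^sub>M lborel))"
    by (rule P.Fubini_integral[OF i, symmetric])
  also have "\<dots> = cov_term f g k"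
    unfolding cov_term_def
  proof (intro Bochner_Integration.integral_cong refl)
    fix z :: "real \<times> real"
    have "(\<integral>x. \<Phi> x z \<partial>M) = (\<integral>x. f (fst z) * g (snd z) * (e (fst z) x * e (snd z) ((T ^^ k) x)) \<partial>M)"
      by (simp add: \<Phi>_def mult_ac)
    also have "\<dots> = f (fst z) * g (snd z) * \<gamma> k (fst z) (snd z)"
      unfolding \<gamma>_def by (rule integral_mult_right_zero)
    finally show "(\<integral>x. \<Phi> x z \<partial>M) = \<dots>" .
  qed
  finally show ?thesis .
qed

text \<open>The sum is below both \<open>S2 s\<close> and \<open>S2 t\<close>, hence below their
  geometric mean, which separates the variables and dominates the whole covariance series.\<close>

lemma sum_abs_\<gamma>_le: "(\<Sum>k<n. \<bar>\<gamma> k s t\<bar>) \<le> sqrt (S2 s) * sqrt (S2 t)"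
proof -
  have a: "(\<Sum>k<n. \<bar>\<gamma> k s t\<bar>) \<le> S2 s" "(\<Sum>k<n. \<bar>\<gamma> k s t\<bar>) \<le> S2 t"
  proof -
    have "(\<Sum>k<n. min (\<alpha> k) (h r)) \<le> S2 r" for r
      unfolding S2_def using \<alpha>_nonneg h_nonneg by (intro sum_le_suminf min_summable) auto
    then show "(\<Sum>k<n. \<bar>\<gamma> k s t\<bar>) \<le> S2 s" "(\<Sum>k<n. \<bar>\<gamma> k s t\<bar>) \<le> S2 t"
      by (meson abs_\<gamma>_le sum_mono order_trans)+
  qed
  define y where "y = (\<Sum>k<n. \<bar>\<gamma> k s t\<bar>)"
  have y0: "0 \<le> y" unfolding y_def by (simp add: sum_nonneg)
  have "y = sqrt (y * y)" using y0 by simp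
  also have "\<dots> \<le> sqrt (S2 s * S2 t)"
    using a y0 S2_nonneg unfolding y_def[symmetric] by (intro real_sqrt_le_mono mult_mono) auto
  finally show ?thesis unfolding y_def by (simp add: real_sqrt_mult)
qed

lemma \<gamma>_meas_lborel [measurable]: "(\<lambda>z. \<gamma> k (fst z) (snd z)) \<in> borel_measurable (lborel \<Otimes>\<^sub>M lborel)"
  using \<gamma>_meas2[of k] by (simp add: measurable_cong_sets[OF sets_pair_measure_cong[OF sets_lborel sets_lborel] refl])

lemma cov_terms:
  assumes f: "f \<in> Linfty" and g: "g \<in> Linfty"
  shows "summable (\<lambda>k. \<bar>cov_term f g k\<bar>)"
    and "cov_term f g sums (\<integral>z. f (fst z) * g (snd z) * (\<Sum>k. \<gamma> k (fst z) (snd z)) \<partial>(lborel \<Otimes>\<^sub>M lborel))"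
    and "integrable (lborel \<Otimes>\<^sub>M lborel) (\<lambda>z. f (fst z) * g (snd z) * (\<Sum>k. \<gamma> k (fst z) (snd z)))"
    and "integrable (lborel \<Otimes>\<^sub>M lborel) (\<lambda>z. f (fst z) * g (snd z) * \<gamma> k (fst z) (snd z))"
proof -
  have [measurable]: "f \<in> borel_measurable borel" "g \<in> borel_measurable borel"
    using f g by (auto intro: Linfty_measurable)
  define u where "u k z = f (fst z) * g (snd z) * \<gamma> k (fst z) (snd z)" for k z
  define w where "w z = \<bar>f (fst z) * sqrt (S2 (fst z))\<bar> * \<bar>g (snd z) * sqrt (S2 (snd z))\<bar>" for z
  have w: "integrable (lborel \<Otimes>\<^sub>M lborel) w" unfolding w_def by (rule Linfty_S2_int[OF f g])
  have [measurable]: "u k \<in> borel_measurable (lborel \<Otimes>\<^sub>M lborel)" for k unfolding u_def[abs_def] by measurable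
  have sle: "(\<Sum>k<n. \<bar>u k z\<bar>) \<le> w z" for n z
  proof -
    have "(\<Sum>k<n. \<bar>u k z\<bar>) = \<bar>f (fst z) * g (snd z)\<bar> * (\<Sum>k<n. \<bar>\<gamma> k (fst z) (snd z)\<bar>)"
      by (simp add: u_def abs_mult sum_distrib_left)
    also have "\<dots> \<le> \<bar>f (fst z) * g (snd z)\<bar> * (sqrt (S2 (fst z)) * sqrt (S2 (snd z)))"
      by (intro mult_left_mono sum_abs_\<gamma>_le) simp
    also have "\<dots> = w z" using S2_nonneg by (simp add: w_def abs_mult mult_ac)
    finally show ?thesis .
  qed
  have u_int: "integrable (lborel \<Otimes>\<^sub>M lborel) (u k)" for k
  proof (rule Bochner_Integration.integrable_bound[OF w])
    have "\<bar>u k z\<bar> \<le> w z" for z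
    proof -
      have "0 \<le> (\<Sum>j<k. \<bar>u j z\<bar>)" by (simp add: sum_nonneg)
      then show ?thesis using sle[of z "Suc k"] unfolding sum.lessThan_Suc by linarith
    qed
    then show "AE z in lborel \<Otimes>\<^sub>M lborel. norm (u k z) \<le> norm (w z)"
      by (intro AE_I2) (auto intro: order_trans[OF _ abs_ge_self])
  qed simp
  have pt: "AE z in lborel \<Otimes>\<^sub>M lborel. summable (\<lambda>k. norm (u k z))"
  proof (rule AE_I2)
    fix z show "summable (\<lambda>k. norm (u k z))"
      using sle[of z] by (intro summableI_nonneg_bounded[where x="w z"]) auto
  qed
  have sn: "summable (\<lambda>k. \<integral>z. norm (u k z) \<partial>(lborel \<Otimes>\<^sub>M lborel))"
  proof (rule summableI_nonneg_bounded[where x="\<integral>z. w z \<partial>(lborel \<Otimes>\<^sub>M lborel)"])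
    fix n
    have "(\<Sum>k<n. \<integral>z. norm (u k z) \<partial>(lborel \<Otimes>\<^sub>M lborel)) = (\<integral>z. (\<Sum>k<n. \<bar>u k z\<bar>) \<partial>(lborel \<Otimes>\<^sub>M lborel))"
      using u_int by (simp add: Bochner_Integration.integral_sum)
    also have "\<dots> \<le> (\<integral>z. w z \<partial>(lborel \<Otimes>\<^sub>M lborel))"
      by (intro integral_mono w sle Bochner_Integration.integrable_sum integrable_abs u_int)
    finally show "(\<Sum>k<n. \<integral>z. norm (u k z) \<partial>(lborel \<Otimes>\<^sub>M lborel)) \<le> (\<integral>z. w z \<partial>(lborel \<Otimes>\<^sub>M lborel))" .
  qed simp
  have eq: "(\<lambda>z. \<Sum>k. u k z) = (\<lambda>z. f (fst z) * g (snd z) * (\<Sum>k. \<gamma> k (fst z) (snd z)))"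
    unfolding u_def by (intro ext suminf_mult \<gamma>_summable)
  have ct: "cov_term f g k = integral\<^sup>L (lborel \<Otimes>\<^sub>M lborel) (u k)" for k
    unfolding cov_term_def u_def[abs_def] ..
  show "summable (\<lambda>k. \<bar>cov_term f g k\<bar>)"
    by (rule summable_comparison_test'[OF sn, of 0]) (simp add: ct)
  show "cov_term f g sums (\<integral>z. f (fst z) * g (snd z) * (\<Sum>k. \<gamma> k (fst z) (snd z)) \<partial>(lborel \<Otimes>\<^sub>M lborel))"
    using sums_integral[OF u_int pt sn] unfolding eq[THEN fun_cong] ct[symmetric] by simp
  show "integrable (lborel \<Otimes>\<^sub>M lborel) (\<lambda>z. f (fst z) * g (snd z) * (\<Sum>k. \<gamma> k (fst z) (snd z)))"
    using integrable_suminf[OF u_int pt sn] unfolding eq .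
  show "integrable (lborel \<Otimes>\<^sub>M lborel) (\<lambda>z. f (fst z) * g (snd z) * \<gamma> k (fst z) (snd z))"
    using u_int[of k] unfolding u_def .
qed

text \<open>Exchanging the integration variables turns the part of \<open>K\<close> with exchanged
  arguments into terms \<open>cov_term g f\<close>. Lag \<open>0\<close> is taken off there, as the
  first series already contains it.\<close>

lemma Q_eq_cov_sums:
  assumes f: "f \<in> Linfty" and g: "g \<in> Linfty"
  shows "gs.Q f g = (\<Sum>k. cov_term f g k) + (\<Sum>k. cov_term g f (Suc k))"
proof -
  let ?P = "lborel \<Otimes>\<^sub>M (lborel :: real measure)"
  define a where "a z = f (fst z) * g (snd z) * (\<Sum>k. \<gamma> k (fst z) (snd z))" for z
  define b where "b z = g (fst z) * f (snd z) * (\<Sum>k. \<gamma> k (fst z) (snd z)) - g (fst z) * f (snd z) * \<gamma> 0 (fst z) (snd z)" for z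
  have [measurable]: "f \<in> borel_measurable borel" "g \<in> borel_measurable borel"
    using f g by (auto intro: Linfty_measurable)
  have ai: "integrable ?P a" unfolding a_def by (rule cov_terms(3)[OF f g])
  have bi: "integrable ?P b"
    unfolding b_def by (intro Bochner_Integration.integrable_diff cov_terms(3,4)[OF g f])
  have bm: "b \<in> borel_measurable ?P" using borel_measurable_integrable[OF bi] .
  have pt: "f (fst z) * g (snd z) * K (fst z) (snd z) = a z + b (snd z, fst z)" for z
  proof -
    obtain t s where z: "z = (t, s)" by (cases z)
    have "(\<Sum>k. \<gamma> (Suc k) t s + \<gamma> (Suc k) s t) = (\<Sum>k. \<gamma> (Suc k) t s) + (\<Sum>k. \<gamma> (Suc k) s t)"
      by (rule suminf_add[symmetric]) (rule \<gamma>_summable)+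
    then have Ks: "K t s = (\<Sum>k. \<gamma> k t s) + ((\<Sum>k. \<gamma> k s t) - \<gamma> 0 s t)"
      unfolding K_def suminf_split_head[OF \<gamma>_summable(1)] by simp
    show ?thesis unfolding z a_def b_def fst_conv snd_conv Ks by (simp add: algebra_simps)
  qed
  have swap: "integrable ?P (\<lambda>(x, y). b (y, x))" "(\<integral>(x, y). b (y, x) \<partial>?P) = integral\<^sup>L ?P b"
    using lborel_pair.integrable_product_swap[OF bi] lborel_pair.integral_product_swap[OF bm] by auto
  have "gs.Q f g = (\<integral>z. a z + b (snd z, fst z) \<partial>?P)" unfolding gs.Q_def pt ..
  also have "\<dots> = integral\<^sup>L ?P a + integral\<^sup>L ?P b"
    using swap ai by (simp add: split_beta')
  also have "integral\<^sup>L ?P a = (\<Sum>k. cov_term f g k)"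
    unfolding a_def by (rule sums_unique[OF cov_terms(2)[OF f g]])
  also have "integral\<^sup>L ?P b = (\<Sum>k. cov_term g f k) - cov_term g f 0"
    unfolding b_def sums_unique[OF cov_terms(2)[OF g f], symmetric] cov_term_def[of g f 0]
    by (subst Bochner_Integration.integral_diff[OF cov_terms(3,4)[OF g f]])
       (simp add: sums_unique[OF cov_terms(2)[OF g f]])
  also have "\<dots> = (\<Sum>k. cov_term g f (Suc k))"
    using suminf_split_head[OF sums_summable[OF cov_terms(2)[OF g f]]] by simp
  finally show ?thesis .
qed

text \<open>Absolute summability of both halves gives an unordered sum over the integers; the
  negative ones are enumerated by \<open>- int (Suc k)\<close>.\<close>

lemma cov_has_sum:
  assumes f: "f \<in> Linfty" and g: "g \<in> Linfty"
  shows "((\<lambda>k::int. if 0 \<le> k then cov_term f g (nat k) else cov_term g f (nat (- k))) has_sum gs.Q f g) UNIV"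
proof -
  let ?F = "\<lambda>k::int. if 0 \<le> k then cov_term f g (nat k) else cov_term g f (nat (- k))"
  have "(cov_term f g has_sum (\<Sum>k. cov_term f g k)) UNIV"
    using cov_terms(1,2)[OF f g] by (intro norm_summable_imp_has_sum summable_sums) (auto dest: sums_summable)
  then have 1: "(?F has_sum (\<Sum>k. cov_term f g k)) (range int)"
    by (subst has_sum_reindex) (auto simp: inj_on_def comp_def)
  have sg: "summable (\<lambda>k. \<bar>cov_term g f (Suc k)\<bar>)" "summable (\<lambda>k. cov_term g f (Suc k))"
    using cov_terms(1)[OF g f] summable_Suc_iff[of "\<lambda>k. \<bar>cov_term g f k\<bar>"]
      sums_summable[OF cov_terms(2)[OF g f]] summable_Suc_iff[of "cov_term g f"] by auto
  then have "((\<lambda>k. cov_term g f (Suc k)) has_sum (\<Sum>k. cov_term g f (Suc k))) UNIV"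
    by (intro norm_summable_imp_has_sum summable_sums) auto
  then have 2: "(?F has_sum (\<Sum>k. cov_term g f (Suc k))) (range (\<lambda>k. - int (Suc k)))"
    by (subst has_sum_reindex) (auto simp: inj_on_def comp_def nat_add_distrib simp del: of_nat_Suc)
  have "x \<in> range int \<union> range (\<lambda>k. - int (Suc k))" for x :: int
    by (cases x rule: int_cases) auto
  then have U: "UNIV = range int \<union> range (\<lambda>k. - int (Suc k))" by blast
  show ?thesis
    unfolding Q_eq_cov_sums[OF f g] U by (rule has_sum_Un_disjoint[OF 1 2]) auto
qed

end

section \<open>From the mixing condition to the theorem\<close>

lemma ennreal_sqrt_ennreal: "0 \<le> x \<Longrightarrow> ennreal_sqrt (ennreal x) = ennreal (sqrt x)"
  by (simp add: ennreal_sqrt_def)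

lemma ennreal_sqrt_mono: "x \<le> y \<Longrightarrow> ennreal_sqrt x \<le> ennreal_sqrt y"
  by (cases x; cases y) (auto simp: ennreal_sqrt_def top_unique)

lemma ennreal_sqrt_mult2: "ennreal_sqrt (2 * x) = ennreal (sqrt 2) * ennreal_sqrt x"
proof (cases x)
  case (real r)
  then have "2 * x = ennreal (2 * r)" by (simp add: ennreal_mult)
  then have "ennreal_sqrt (2 * x) = ennreal (sqrt (2 * r))" using real by (simp only: ennreal_sqrt_ennreal)
  then show ?thesis using real by (simp add: ennreal_sqrt_ennreal real_sqrt_mult ennreal_mult)
next
  case top
  then show ?thesis by (simp add: ennreal_sqrt_def ennreal_mult_top)
qed

lemma ennreal_sqrt_meas [measurable]: "ennreal_sqrt \<in> borel_measurable borel"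
  unfolding ennreal_sqrt_def[abs_def] by measurable

lemma ennreal_sqrt_lt_top: "ennreal_sqrt x < \<top> \<Longrightarrow> x < \<top>"
  by (auto simp: ennreal_sqrt_def less_top split: if_splits)

context prob_space
begin

text \<open>For \<open>0 <= p <= 1\<close> the modulus of an indicator minus \<open>p\<close> is an
  affine function of the indicator.\<close>

lemma integral_abs_indicator_minus_cdf:
  assumes [measurable]: "X \<in> borel_measurable M"
  defines "F \<equiv> cdf (distr M borel X)"
  shows "(\<integral>x. \<bar>indicator {..t} (X x) - F t\<bar> \<partial>M) = 2 * (F t * (1 - F t))"
proof -
  interpret D: real_distribution "distr M borel X" by (rule real_distribution_distr) simp
  have F: "0 \<le> F t" "F t \<le> 1" by (auto simp: F_def cdf_def)
  have i: "integrable M (\<lambda>x. indicator {..t} (X x) :: real)" by (rule integrable_bounded[where B=1]) auto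
  have "(\<integral>x. \<bar>indicator {..t} (X x) - F t\<bar> \<partial>M) = (\<integral>x. indicator {..t} (X x) * (1 - 2 * F t) + F t \<partial>M)"
    using F by (intro Bochner_Integration.integral_cong refl) (auto simp: indicator_def)
  also have "\<dots> = (\<integral>x. indicator {..t} (X x) \<partial>M) * (1 - 2 * F t) + F t"
    using i by (simp add: prob_space)
  also have "\<dots> = 2 * (F t * (1 - F t))"
    unfolding integral_indicator_atMost_eq_cdf[OF assms(1)] F_def[symmetric] by (simp add: algebra_simps)
  finally show ?thesis .
qed

text \<open>For \<open>t >= 0\<close> the bound comes from \<open>1 - F t\<close>. For
  \<open>t < 0\<close> the value \<open>F t\<close> may also count \<open>X = t\<close>, which the
  strict tail omits; the event \<open>|X| = - t\<close> has positive probability for countably many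
  \<open>t\<close> only.\<close>

lemma AE_cdf_variation_le_tail:
  assumes [measurable]: "X \<in> borel_measurable M"
  defines "F \<equiv> cdf (distr M borel X)"
  shows "AE t in lborel. F t * (1 - F t) \<le> tail_prob M X \<bar>t\<bar>"
proof -
  interpret D: real_distribution "distr M borel X" by (rule real_distribution_distr) simp
  interpret D': real_distribution "distr M borel (\<lambda>x. \<bar>X x\<bar>)" by (rule real_distribution_distr) simp
  have F: "0 \<le> F t" "F t \<le> 1" for t by (auto simp: F_def cdf_def)
  have Fp: "F t = prob {x \<in> space M. X x \<le> t}" for t
    unfolding F_def cdf_def by (subst measure_distr) (auto intro!: arg_cong[where f=prob])
  have "countable (uminus ` {x. measure (distr M borel (\<lambda>x. \<bar>X x\<bar>)) {x} \<noteq> 0})"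
    by (intro countable_image D'.countable_support)
  then have "uminus ` {x. measure (distr M borel (\<lambda>x. \<bar>X x\<bar>)) {x} \<noteq> 0} \<in> null_sets lborel"
    by (rule countable_imp_null_set_lborel)
  from AE_not_in[OF this] show ?thesis
  proof eventually_elim
    fix t assume t: "t \<notin> uminus ` {x. measure (distr M borel (\<lambda>x. \<bar>X x\<bar>)) {x} \<noteq> 0}"
    show "F t * (1 - F t) \<le> tail_prob M X \<bar>t\<bar>"
    proof (cases "0 \<le> t")
      case True
      have "F t * (1 - F t) \<le> 1 * (1 - F t)" using F[of t] by (intro mult_right_mono) auto
      also have "1 * (1 - F t) = prob {x \<in> space M. \<not> X x \<le> t}"
        unfolding Fp by (subst prob_neg) auto
      also have "\<dots> \<le> tail_prob M X \<bar>t\<bar>"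
        unfolding tail_prob_def using True by (intro finite_measure_mono) auto
      finally show ?thesis .
    next
      case False
      have z: "prob {x \<in> space M. \<bar>X x\<bar> = - t} = 0"
      proof -
        have "measure (distr M borel (\<lambda>x. \<bar>X x\<bar>)) {- t} = 0" using t by force
        then show ?thesis by (subst (asm) measure_distr) (auto simp: vimage_def Int_def conj_commute)
      qed
      have "F t * (1 - F t) \<le> F t * 1" using F[of t] by (intro mult_left_mono) auto
      also have "\<dots> \<le> prob ({x \<in> space M. \<bar>X x\<bar> > \<bar>t\<bar>} \<union> {x \<in> space M. \<bar>X x\<bar> = - t})"
        unfolding Fp using False by (simp, intro finite_measure_mono) auto
      also have "\<dots> \<le> tail_prob M X \<bar>t\<bar> + 0"
        unfolding tail_prob_def z[symmetric] by (rule measure_Un_le) auto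
      finally show ?thesis by simp
    qed
  qed
qed

text \<open>The hypothesis concerns the half line, and the reflected function
  \<open>\<Phi> (- t)\<close> covers negative \<open>t\<close>. The factor two of
  \<open>2 F (1 - F)\<close> passes through the minimum and leaves the root as
  \<open>sqrt 2\<close>.\<close>

lemma nn_integral_sqrt_series_finite:
  assumes X [measurable]: "X \<in> borel_measurable M" and \<alpha>: "\<And>k. 0 \<le> \<alpha> k"
    and fin: "(\<integral>\<^sup>+t\<in>{0..}. ennreal_sqrt (\<Sum>k. ennreal (min (\<alpha> k) (tail_prob M X t))) \<partial>lborel) < \<infinity>"
  shows "(\<integral>\<^sup>+t. ennreal_sqrt (\<Sum>k. ennreal (min (\<alpha> k)
     (\<integral>x. \<bar>indicator {..t} (X x) - cdf (distr M borel X) t\<bar> \<partial>M))) \<partial>lborel) < \<infinity>"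
proof -
  define \<Phi> where "\<Phi> t = ennreal_sqrt (\<Sum>k. ennreal (min (\<alpha> k) (tail_prob M X t))) * indicator {0..} t" for t
  have "(\<lambda>t. - tail_prob M X t) \<in> borel_measurable borel"
    unfolding tail_prob_def by (intro borel_measurable_mono monoI) (auto intro!: finite_measure_mono)
  then have "(\<lambda>t. - (- tail_prob M X t)) \<in> borel_measurable borel" by (rule borel_measurable_uminus)
  then have [measurable]: "tail_prob M X \<in> borel_measurable borel" by simp
  have [measurable]: "\<Phi> \<in> borel_measurable borel" unfolding \<Phi>_def[abs_def] by measurable
  have fin': "(\<integral>\<^sup>+t. \<Phi> t \<partial>lborel) < \<infinity>" using fin by (simp add: \<Phi>_def)
  have "(\<integral>\<^sup>+t. \<Phi> t \<partial>lborel) = (\<integral>\<^sup>+t. \<Phi> (- t) \<partial>lborel)"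
    using nn_integral_real_affine[of \<Phi> "-1" 0] by simp
  then have fin2: "(\<integral>\<^sup>+t. \<Phi> (- t) \<partial>lborel) < \<infinity>" using fin' by simp
  have "(\<integral>\<^sup>+t. ennreal_sqrt (\<Sum>k. ennreal (min (\<alpha> k) (\<integral>x. \<bar>indicator {..t} (X x) - cdf (distr M borel X) t\<bar> \<partial>M))) \<partial>lborel)
    \<le> (\<integral>\<^sup>+t. ennreal (sqrt 2) * (\<Phi> t + \<Phi> (- t)) \<partial>lborel)"
  proof (rule nn_integral_mono_AE)
    show "AE t in lborel. ennreal_sqrt (\<Sum>k. ennreal (min (\<alpha> k) (\<integral>x. \<bar>indicator {..t} (X x) - cdf (distr M borel X) t\<bar> \<partial>M)))
      \<le> ennreal (sqrt 2) * (\<Phi> t + \<Phi> (- t))"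
      using AE_cdf_variation_le_tail[OF X]
    proof eventually_elim
      fix t assume le: "cdf (distr M borel X) t * (1 - cdf (distr M borel X) t) \<le> tail_prob M X \<bar>t\<bar>"
      have tp: "0 \<le> tail_prob M X \<bar>t\<bar>" by (simp add: tail_prob_def)
      have "(\<Sum>k. ennreal (min (\<alpha> k) (\<integral>x. \<bar>indicator {..t} (X x) - cdf (distr M borel X) t\<bar> \<partial>M)))
        \<le> (\<Sum>k. 2 * ennreal (min (\<alpha> k) (tail_prob M X \<bar>t\<bar>)))"
      proof (rule suminf_le)
        fix k
        have "min (\<alpha> k) (\<integral>x. \<bar>indicator {..t} (X x) - cdf (distr M borel X) t\<bar> \<partial>M) \<le> 2 * min (\<alpha> k) (tail_prob M X \<bar>t\<bar>)"
          unfolding integral_abs_indicator_minus_cdf[OF X] using le tp \<alpha>[of k] by (simp add: min_def)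
        then have "ennreal (min (\<alpha> k) (\<integral>x. \<bar>indicator {..t} (X x) - cdf (distr M borel X) t\<bar> \<partial>M)) \<le> ennreal (2 * min (\<alpha> k) (tail_prob M X \<bar>t\<bar>))"
          by (rule ennreal_leI)
        then show "ennreal (min (\<alpha> k) (\<integral>x. \<bar>indicator {..t} (X x) - cdf (distr M borel X) t\<bar> \<partial>M)) \<le> 2 * ennreal (min (\<alpha> k) (tail_prob M X \<bar>t\<bar>))"
          using \<alpha>[of k] tp by (subst (asm) ennreal_mult) auto
      qed auto
      also have "\<dots> = 2 * (\<Sum>k. ennreal (min (\<alpha> k) (tail_prob M X \<bar>t\<bar>)))" by simp
      finally have "ennreal_sqrt (\<Sum>k. ennreal (min (\<alpha> k) (\<integral>x. \<bar>indicator {..t} (X x) - cdf (distr M borel X) t\<bar> \<partial>M)))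
        \<le> ennreal (sqrt 2) * ennreal_sqrt (\<Sum>k. ennreal (min (\<alpha> k) (tail_prob M X \<bar>t\<bar>)))"
        unfolding ennreal_sqrt_mult2[symmetric] by (rule ennreal_sqrt_mono)
      \<comment> \<open>One of the two summands is the value of \<open>\<Phi>\<close> at
        \<open>|t|\<close>.\<close>
      also have "\<dots> \<le> ennreal (sqrt 2) * (\<Phi> t + \<Phi> (- t))"
        by (intro mult_left_mono) (cases "0 \<le> t"; simp add: \<Phi>_def)+
      finally show "ennreal_sqrt (\<Sum>k. ennreal (min (\<alpha> k) (\<integral>x. \<bar>indicator {..t} (X x) - cdf (distr M borel X) t\<bar> \<partial>M)))
        \<le> ennreal (sqrt 2) * (\<Phi> t + \<Phi> (- t))" .
    qed
  qed
  also have "\<dots> = ennreal (sqrt 2) * ((\<integral>\<^sup>+t. \<Phi> t \<partial>lborel) + (\<integral>\<^sup>+t. \<Phi> (- t) \<partial>lborel))"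
    by (subst nn_integral_cmult, measurable, subst nn_integral_add) auto
  also have "\<dots> < \<infinity>" using fin' fin2 by (simp add: ennreal_mult_less_top)
  finally show ?thesis .
qed

text \<open>Finiteness of the integral forces the mixing coefficients themselves to be summable: at some level
  \<open>t\<close> the quantity \<open>2 F (1 - F)\<close> is positive and the truncated series converges.\<close>

lemma mixing_summable:
  assumes X [measurable]: "X \<in> borel_measurable M" and \<alpha>: "\<And>k. 0 \<le> \<alpha> k"
    and fin: "(\<integral>\<^sup>+t\<in>{0..}. ennreal_sqrt (\<Sum>k. ennreal (min (\<alpha> k) (tail_prob M X t))) \<partial>lborel) < \<infinity>"
    and zero: "\<And>k. (\<And>t. (\<integral>x. \<bar>indicator {..t} (X x) - cdf (distr M borel X) t\<bar> \<partial>M) = 0) \<Longrightarrow> \<alpha> k = 0"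
  shows "summable \<alpha>"
    and "integrable lborel (\<lambda>t. sqrt (\<Sum>k. min (\<alpha> k) (\<integral>x. \<bar>indicator {..t} (X x) - cdf (distr M borel X) t\<bar> \<partial>M)))"
proof -
  define F where "F = cdf (distr M borel X)"
  define h where "h t = (\<integral>x. \<bar>indicator {..t} (X x) - F t\<bar> \<partial>M)" for t
  interpret D: real_distribution "distr M borel X" by (rule real_distribution_distr) simp
  have F: "0 \<le> F t" "F t \<le> 1" for t by (auto simp: F_def cdf_def)
  have h_eq: "h t = 2 * (F t * (1 - F t))" for t
    unfolding h_def F_def by (rule integral_abs_indicator_minus_cdf[OF X])
  have h0: "0 \<le> h t" for t unfolding h_def by simp
  have [measurable]: "F \<in> borel_measurable borel"
    unfolding F_def by (intro borel_measurable_mono monoI D.cdf_nondecreasing)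
  have [measurable]: "h \<in> borel_measurable borel" unfolding h_eq[abs_def] by measurable
  have f: "(\<integral>\<^sup>+t. ennreal_sqrt (\<Sum>k. ennreal (min (\<alpha> k) (h t))) \<partial>lborel) < \<infinity>"
    using nn_integral_sqrt_series_finite[OF X \<alpha> fin] unfolding h_def F_def .
  show sm: "summable \<alpha>"
  proof (cases "\<exists>t0. h t0 > 0")
    case True
    then obtain t0 where t0: "h t0 > 0" by blast
    then have t0': "0 < F t0" "F t0 < 1" using F[of t0] unfolding h_eq by (auto simp: zero_less_mult_iff order_less_le)
    \<comment> \<open>The truncated series is known to be finite only for almost every level, so
      right continuity is used to spread positivity of \<open>h\<close> from one point to an
      interval.\<close>
    have "(F \<longlongrightarrow> F t0) (at_right t0)"
      using D.cdf_is_right_cont[of t0] unfolding continuous_within F_def .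
    then have "\<forall>\<^sub>F t in at_right t0. F t < 1" using t0'(2) by (rule order_tendstoD)
    then obtain b where b: "b > t0" "\<And>t. t0 < t \<Longrightarrow> t < b \<Longrightarrow> F t < 1"
      unfolding eventually_at_right_field by blast
    have hp: "h t > 0" if "t \<in> {t0<..<b}" for t
    proof -
      have "F t0 \<le> F t" unfolding F_def using that by (intro D.cdf_nondecreasing) auto
      then have "0 < F t" using t0'(1) by linarith
      then show ?thesis unfolding h_eq using b(2)[of t] that by (auto intro!: mult_pos_pos)
    qed
    have ae: "AE t in lborel. (\<Sum>k. ennreal (min (\<alpha> k) (h t))) < \<top>"
    proof -
      have "AE t in lborel. ennreal_sqrt (\<Sum>k. ennreal (min (\<alpha> k) (h t))) \<noteq> \<infinity>"
        by (rule nn_integral_PInf_AE) (use f in auto)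
      then show ?thesis by eventually_elim (auto intro!: ennreal_sqrt_lt_top simp: less_top)
    qed
    have "\<exists>t\<in>{t0<..<b}. (\<Sum>k. ennreal (min (\<alpha> k) (h t))) < \<top>"
    proof (rule ccontr)
      assume "\<not> ?thesis"
      with ae have "AE t in lborel. t \<notin> {t0<..<b}" by (auto elim: eventually_mono)
      then have "{t0<..<b} \<in> null_sets lborel" by (subst AE_iff_null_sets) auto
      then show False using b(1) by (auto simp: null_sets_def emeasure_lborel_Ioo)
    qed
    then obtain t where t: "t \<in> {t0<..<b}" "(\<Sum>k. ennreal (min (\<alpha> k) (h t))) < \<top>" by blast
    have "summable (\<lambda>k. min (\<alpha> k) (h t))"
      by (rule summable_suminf_not_top) (use \<alpha> h0 t(2) in auto)
    \<comment> \<open>Terms that tend to zero fall below the positive level \<open>h t\<close>, so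
      the truncation is eventually inactive.\<close>
    then have "(\<lambda>k. min (\<alpha> k) (h t)) \<longlonglongrightarrow> 0" by (rule summable_LIMSEQ_zero)
    then have "\<forall>\<^sub>F k in sequentially. min (\<alpha> k) (h t) < h t" using hp[OF t(1)] by (rule order_tendstoD)
    then have "\<forall>\<^sub>F k in sequentially. min (\<alpha> k) (h t) = \<alpha> k" by eventually_elim (auto simp: min_def split: if_splits)
    then show ?thesis using \<open>summable (\<lambda>k. min (\<alpha> k) (h t))\<close> summable_cong by force
  next
    case False
    \<comment> \<open>Here the law of \<open>X\<close> is a point mass and series truncated at
      \<open>h\<close> carry no information on \<open>\<alpha>\<close>; the assumption
      \<open>zero\<close> settles this case.\<close>
    then have "h t = 0" for t using h0[of t] by (metis order_less_le)
    then have "\<alpha> k = 0" for k by (intro zero) (simp add: h_def F_def)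
    then have "\<alpha> = (\<lambda>_. 0)" by auto
    then show ?thesis by simp
  qed
  have ms: "summable (\<lambda>k. min (\<alpha> k) (h t))" for t
    by (rule summable_comparison_test'[OF sm, of 0]) (use \<alpha> h0 in auto)
  have "integrable lborel (\<lambda>t. sqrt (\<Sum>k. min (\<alpha> k) (h t)))"
  proof (rule integrableI_nonneg)
    have "ennreal_sqrt (\<Sum>k. ennreal (min (\<alpha> k) (h t))) = ennreal (sqrt (\<Sum>k. min (\<alpha> k) (h t)))" for t
      using \<alpha> h0 ms by (subst suminf_ennreal2) (auto intro!: ennreal_sqrt_ennreal suminf_nonneg)
    then show "(\<integral>\<^sup>+t. ennreal (sqrt (\<Sum>k. min (\<alpha> k) (h t))) \<partial>lborel) < \<infinity>" using f by simp
    show "AE t in lborel. 0 \<le> sqrt (\<Sum>k. min (\<alpha> k) (h t))"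
      using \<alpha> h0 ms by (intro AE_I2) (auto intro!: suminf_nonneg)
  qed measurable
  then show "integrable lborel (\<lambda>t. sqrt (\<Sum>k. min (\<alpha> k) (\<integral>x. \<bar>indicator {..t} (X x) - cdf (distr M borel X) t\<bar> \<partial>M)))"
    by (simp add: h_def F_def)
qed

end

section \<open>The coefficients \<open>alpha1\<close> as mixing bounds\<close>

context filtered_automorphism
begin

context
  fixes X0 :: "'a \<Rightarrow> real" and X :: "int \<Rightarrow> 'a \<Rightarrow> real"
  assumes X0: "X0 \<in> borel_measurable F0" and X: "\<And>n. X (int n) = (\<lambda>x. X0 ((T ^^ n) x))"
begin

text \<open>Conditional expectation contracts the \<open>L1\<close> norm, so the expression under
  the supremum is at most the mean of \<open>|1(X0 <= t) - F(t)|\<close>, hence at most one. This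
  bounds the real-valued supremum and gives the vanishing clause; the mixing clause replaces the
  indicator by its conditional expectation.\<close>

lemma alpha1_props:
  defines "F \<equiv> cdf (distr M borel X0)"
  shows "0 \<le> alpha1 M F0 X k"
    and "\<And>\<xi> C t. \<xi> \<in> borel_measurable F0 \<Longrightarrow> (\<And>x. \<bar>\<xi> x\<bar> \<le> C) \<Longrightarrow>
      \<bar>\<integral>x. \<xi> x * (indicator {..t} (X0 ((T ^^ k) x)) - F t) \<partial>M\<bar> \<le> C * alpha1 M F0 X k"
    and "(\<And>t. (\<integral>x. \<bar>indicator {..t} (X0 x) - F t\<bar> \<partial>M) = 0) \<Longrightarrow> alpha1 M F0 X k = 0"
proof -
  have [measurable]: "X0 \<in> borel_measurable M" using X0 by (rule F0_meas)
  interpret D: real_distribution "distr M borel X0" by (rule real_distribution_distr) simp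
  have F: "0 \<le> F t" "F t \<le> 1" for t by (auto simp: F_def cdf_def)
  define f :: "real \<Rightarrow> 'a \<Rightarrow> real" where "f t x = indicator {..t} (X0 ((T ^^ k) x))" for t x
  have f_meas [measurable]: "f t \<in> borel_measurable M" for t unfolding f_def[abs_def] by measurable
  have f_int: "integrable M (f t)" for t by (rule integrable_bounded[where B=1]) (auto simp: f_def)
  define c where "c t = real_cond_exp M F0 (f t)" for t
  have c_F0: "c t \<in> borel_measurable F0" for t by (simp add: c_def)
  have c_meas [measurable]: "c t \<in> borel_measurable M" for t by (rule F0_meas[OF c_F0])
  have c_int: "integrable M (c t)" for t unfolding c_def by (rule real_cond_exp_int(1)[OF f_int])
  define d where "d t = (\<integral>x. \<bar>c t x - F t\<bar> \<partial>M)" for t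
  have X00: "X 0 = X0" using X[of 0] by simp
  have a_eq: "alpha1 M F0 X k = (SUP t. d t)"
    unfolding alpha1_def X X00 d_def c_def f_def F_def ..
  have d_le: "d t \<le> (\<integral>x. \<bar>indicator {..t} (X0 x) - F t\<bar> \<partial>M)" for t
  proof -
    have g_int: "integrable M (\<lambda>x. f t x - F t)" using f_int by simp
    have "AE x in M. real_cond_exp M F0 (\<lambda>x. f t x - F t) x = c t x - real_cond_exp M F0 (\<lambda>_. F t) x"
      unfolding c_def by (rule real_cond_exp_diff[OF f_int]) simp
    moreover have "AE x in M. real_cond_exp M F0 (\<lambda>_. F t) x = F t"
      by (rule real_cond_exp_F_meas) auto
    moreover have "AE x in M. \<bar>real_cond_exp M F0 (\<lambda>x. f t x - F t) x\<bar> \<le> nn_cond_exp M F0 (\<lambda>x. ennreal \<bar>f t x - F t\<bar>) x"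
      by (rule real_cond_exp_abs) measurable
    ultimately have "AE x in M. ennreal \<bar>c t x - F t\<bar> \<le> nn_cond_exp M F0 (\<lambda>x. ennreal \<bar>f t x - F t\<bar>) x"
      by eventually_elim simp
    then have "(\<integral>\<^sup>+x. ennreal \<bar>c t x - F t\<bar> \<partial>M) \<le> (\<integral>\<^sup>+x. nn_cond_exp M F0 (\<lambda>x. ennreal \<bar>f t x - F t\<bar>) x \<partial>M)"
      by (rule nn_integral_mono_AE)
    also have "\<dots> = (\<integral>\<^sup>+x. ennreal \<bar>f t x - F t\<bar> \<partial>M)"
      using nn_cond_exp_intg[of "\<lambda>_. 1" "\<lambda>x. ennreal \<bar>f t x - F t\<bar>"] by simp
    also have "\<dots> = ennreal (\<integral>x. \<bar>f t x - F t\<bar> \<partial>M)"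
      using g_int by (intro nn_integral_eq_integral) auto
    also have "(\<integral>x. \<bar>f t x - F t\<bar> \<partial>M) = (\<integral>x. \<bar>indicator {..t} (X0 x) - F t\<bar> \<partial>M)"
      unfolding f_def by (rule integral_funpow_T[of "\<lambda>x. \<bar>indicator {..t} (X0 x) - F t\<bar>"]) measurable
    also have "(\<integral>\<^sup>+x. ennreal \<bar>c t x - F t\<bar> \<partial>M) = ennreal (d t)"
      unfolding d_def using c_int by (intro nn_integral_eq_integral) auto
    finally show ?thesis by (subst (asm) ennreal_le_iff) auto
  qed
  have d0: "0 \<le> d t" for t unfolding d_def by simp
  have d1: "d t \<le> 1" for t
  proof -
    have "(\<integral>x. \<bar>indicator {..t} (X0 x) - F t\<bar> \<partial>M) \<le> (\<integral>x. 1 \<partial>M)"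
      using F[of t] by (intro integral_mono integrable_bounded[where B=1]) (auto simp: indicator_def)
    then show ?thesis using d_le[of t] by (simp add: prob_space)
  qed
  have bdd: "bdd_above (range d)" using d1 by (intro bdd_aboveI[of _ 1]) auto
  have d_alpha: "d t \<le> alpha1 M F0 X k" for t unfolding a_eq by (rule cSUP_upper[OF _ bdd]) simp
  show "0 \<le> alpha1 M F0 X k" using d0[of 0] d_alpha[of 0] by linarith
  show "\<bar>\<integral>x. \<xi> x * (indicator {..t} (X0 ((T ^^ k) x)) - F t) \<partial>M\<bar> \<le> C * alpha1 M F0 X k"
    if \<xi>: "\<xi> \<in> borel_measurable F0" and C: "\<And>x. \<bar>\<xi> x\<bar> \<le> C" for \<xi> C t
  proof -
    have C0: "0 \<le> C" using C[of undefined] by linarith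
    have [measurable]: "\<xi> \<in> borel_measurable M" using \<xi> by (rule F0_meas)
    have \<xi>i: "integrable M \<xi>" by (rule integrable_bounded[where B=C]) (auto simp: C)
    have \<xi>f: "integrable M (\<lambda>x. \<xi> x * f t x)"
      by (rule integrable_bounded[where B="C * 1"]) (auto simp: abs_mult f_def C C0 intro!: mult_mono simp del: mult_1_right)
    have ci: "(\<integral>x. \<xi> x * c t x \<partial>M) = (\<integral>x. \<xi> x * f t x \<partial>M)" "integrable M (\<lambda>x. \<xi> x * c t x)"
      unfolding c_def using real_cond_exp_intg[OF \<xi>f \<xi>] by auto
    have "(\<integral>x. \<xi> x * (f t x - F t) \<partial>M) = (\<integral>x. \<xi> x * (c t x - F t) \<partial>M)"
      using \<xi>f ci \<xi>i by (simp add: right_diff_distrib)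
    also have "\<bar>\<dots>\<bar> \<le> (\<integral>x. C * \<bar>c t x - F t\<bar> \<partial>M)"
      unfolding real_norm_def[symmetric]
    proof (rule norm_integral_le_integral)
      show "integrable M (\<lambda>x. \<xi> x * (c t x - F t))" using ci \<xi>i by (simp add: right_diff_distrib)
      show "norm (\<xi> x * (c t x - F t)) \<le> C * norm (c t x - F t)" for x
        unfolding norm_mult using C by (intro mult_right_mono) auto
    qed (use c_int in auto)
    also have "\<dots> = C * d t" by (simp add: d_def)
    also have "\<dots> \<le> C * alpha1 M F0 X k" by (intro mult_left_mono d_alpha C0)
    finally show ?thesis unfolding f_def .
  qed
  show "alpha1 M F0 X k = 0" if "\<And>t. (\<integral>x. \<bar>indicator {..t} (X0 x) - F t\<bar> \<partial>M) = 0"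
  proof -
    have "d t = 0" for t using d_le[of t] d0[of t] that[of t] by linarith
    then show ?thesis unfolding a_eq by simp
  qed
qed

end

end

section \<open>The Wasserstein statistic as a norm\<close>

lemma empirical_measure_cdf:
  assumes n: "n > 0"
  shows "real_distribution (empirical_measure X n \<omega>)"
    and "cdf (empirical_measure X n \<omega>) t = (\<Sum>k\<in>{1..n}. indicator {..t} (X (int k) \<omega>)) / real n"
proof -
  interpret U: prob_space "uniform_count_measure {1..n}"
    using n by (intro prob_space_uniform_count_measure) auto
  have m: "(\<lambda>k. X (int k) \<omega>) \<in> borel_measurable (uniform_count_measure {1..n})" by simp
  show "real_distribution (empirical_measure X n \<omega>)"
    unfolding empirical_measure_def by (rule U.real_distribution_distr[OF m])
  show "cdf (empirical_measure X n \<omega>) t = (\<Sum>k\<in>{1..n}. indicator {..t} (X (int k) \<omega>)) / real n"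
    unfolding empirical_measure_def U.integral_indicator_atMost_eq_cdf[OF m, symmetric]
    by (subst integral_uniform_count_measure) auto
qed

context empirical_process
begin

text \<open>Since the empirical measure starts at time \<open>1\<close>, the process is evaluated at
  \<open>T w\<close>. For \<open>n = 0\<close> the factor \<open>sqrt (real n)\<close> annihilates
  the left side, and the sums on the right are empty.\<close>

lemma wasserstein1_empirical_measure:
  assumes X: "\<And>n. X (int n) = (\<lambda>x. X0 ((T ^^ n) x))"
  shows "sqrt (real n) * enn2real (wasserstein1 (empirical_measure X n w) (distr M borel X0)) = (\<integral>t. \<bar>E n (T w) t\<bar> \<partial>lborel)"
proof (cases "n = 0")
  case True
  then show ?thesis by (simp add: E_def)
next
  case False
  then have n: "n > 0" by simp
  define s where "s t = (\<Sum>k<n. e t ((T ^^ k) (T w)))" for t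
  have d: "cdf (empirical_measure X n w) t - cdf (distr M borel X0) t = s t / real n" for t
  proof -
    have "s t = (\<Sum>k<n. indicator {..t} (X (int (Suc k)) w)) - real n * F t"
      by (simp add: s_def e_def X funpow_swap1 sum_subtractf del: of_nat_Suc)
    also have "(\<Sum>k<n. indicator {..t} (X (int (Suc k)) w)) = (\<Sum>k\<in>{1..n}. indicator {..t} (X (int k) w) :: real)"
      by (rule sum.reindex_bij_witness[where i="\<lambda>k. k - 1" and j=Suc]) auto
    finally show ?thesis
      using n by (simp add: empirical_measure_cdf(2)[OF n] F_def field_simps)
  qed
  \<comment> \<open>Integrability makes the distance finite, so that \<open>enn2real\<close> returns
    it and not its default value \<open>0\<close>.\<close>
  have i: "integrable lborel s" unfolding s_def[abs_def] by (simp add: e_section_int)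
  have "wasserstein1 (empirical_measure X n w) (distr M borel X0) = (\<integral>\<^sup>+t. ennreal \<bar>s t / real n\<bar> \<partial>lborel)"
    unfolding wasserstein1_eq_cdf[OF empirical_measure_cdf(1)[OF n] X0_distr.real_distribution_axioms] d ..
  also have "\<dots> = ennreal (\<integral>t. \<bar>s t / real n\<bar> \<partial>lborel)"
    using i by (intro nn_integral_eq_integral) auto
  finally have "enn2real (wasserstein1 (empirical_measure X n w) (distr M borel X0)) = (\<integral>t. \<bar>s t / real n\<bar> \<partial>lborel)"
    by simp
  then have "sqrt (real n) * enn2real (wasserstein1 (empirical_measure X n w) (distr M borel X0)) = (\<integral>t. sqrt (real n) * \<bar>s t / real n\<bar> \<partial>lborel)"
    by simp
  also have "\<dots> = (\<integral>t. \<bar>E n (T w) t\<bar> \<partial>lborel)"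
  proof (intro Bochner_Integration.integral_cong refl)
    fix t
    have "sqrt (real n) / real n = 1 / sqrt (real n)" using n by (simp add: field_simps)
    have "sqrt (real n) * (\<bar>s t\<bar> / real n) = \<bar>s t\<bar> * (sqrt (real n) / real n)" by simp
    also have "\<dots> = \<bar>s t\<bar> / sqrt (real n)" unfolding \<open>sqrt (real n) / real n = 1 / sqrt (real n)\<close> by simp
    finally show "sqrt (real n) * \<bar>s t / real n\<bar> = \<bar>E n (T w) t\<bar>"
      by (simp add: E_def s_def abs_divide)
  qed
  finally show ?thesis .
qed

text \<open>The extra shift by \<open>T\<close> disappears in law.\<close>

lemma wasserstein_distr:
  assumes X: "\<And>n. X (int n) = (\<lambda>x. X0 ((T ^^ n) x))"
  defines "W \<equiv> \<lambda>n w. sqrt (real n) * enn2real (wasserstein1 (empirical_measure X n w) (distr M borel X0))"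
  shows "W n \<in> borel_measurable M"
    and "distr M borel (W n) = distr M borel (\<lambda>x. \<integral>t. \<bar>E n x t\<bar> \<partial>lborel)"
proof -
  have Em: "(\<lambda>x. \<integral>t. \<bar>E n x t\<bar> \<partial>lborel) \<in> borel_measurable M"
    using E_meas[of n] by (intro lborel.borel_measurable_lebesgue_integral) (simp add: split_beta')
  have W: "W n = (\<lambda>w. \<integral>t. \<bar>E n (T w) t\<bar> \<partial>lborel)"
    unfolding W_def wasserstein1_empirical_measure[OF X] ..
  show "W n \<in> borel_measurable M"
    unfolding W by (rule measurable_compose[OF T_meas Em])
  have "distr M borel (W n) = distr (distr M M T) borel (\<lambda>x. \<integral>t. \<bar>E n x t\<bar> \<partial>lborel)"
    unfolding W by (subst distr_distr[OF Em T_meas]) (simp add: comp_def)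
  then show "distr M borel (W n) = distr M borel (\<lambda>x. \<integral>t. \<bar>E n x t\<bar> \<partial>lborel)" by (simp add: T_pres)
qed

end

theorem proposition3p1:
  fixes M F0 :: "'a measure" and T :: "'a \<Rightarrow> 'a" and X0 :: "'a \<Rightarrow> real"
    and X :: "int \<Rightarrow> 'a \<Rightarrow> real" and \<mu> :: "real measure" and F :: "real \<Rightarrow> real"
  assumes "prob_space M"
    and "measure_preserving_automorphism M T"
    and "subalgebra M F0"
    and "sets F0 \<subseteq> (\<lambda>B. T -` B \<inter> space M) ` sets F0"
    and "X0 \<in> borel_measurable F0"
    and "integrable M X0"
    and X: "X = orbit_process M T X0"
    and mu: "\<mu> = distr M borel X0"
    and F: "F = cdf \<mu>"
    and "ergodic M T"
    and "(\<integral>\<^sup>+t\<in>{0..}. ennreal_sqrt (\<Sum>k. ennreal (min (alpha1 M F0 X k) (tail_prob M X0 t))) \<partial>lborel) < \<infinity>"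
  shows "\<exists>(N :: (real \<Rightarrow> real) measure) G.
    prob_space N \<and>
    centered_gaussian_L1 N G \<and>
    (\<forall>f\<in>Linfty. \<forall>g\<in>Linfty.
       ((\<lambda>k::int. \<integral>\<omega>. (\<integral>s. (\<integral>t. f t * g s * (indicator {..t} (X 0 \<omega>) - F t)
                                        * (indicator {..s} (X k \<omega>) - F s) \<partial>lborel) \<partial>lborel) \<partial>M)
        has_sum covariance N (\<lambda>w. \<integral>t. f t * G w t \<partial>lborel) (\<lambda>w. \<integral>t. g t * G w t \<partial>lborel)) UNIV) \<and>
    converges_in_distribution
      M (\<lambda>n \<omega>. sqrt (real n) * enn2real (wasserstein1 (empirical_measure X n \<omega>) \<mu>))
      N (\<lambda>w. \<integral>t. \<bar>G w t\<bar> \<partial>lborel)"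
proof -
  define S where "S = the_inv_into (space M) T"
  have bij: "bij_betw T (space M) (space M)" and Tm: "T \<in> measurable M M" and Sm: "S \<in> measurable M M"
    and Tp: "distr M M T = M"
    using assms(2) by (auto simp: measure_preserving_automorphism_def S_def)
  have ST: "S (T x) = x" and TS: "T (S x) = x" if "x \<in> space M" for x
    using bij that by (auto simp: S_def bij_betw_def the_inv_into_f_f f_the_inv_into_f)
  \<comment> \<open>By the inclusion hypothesis every \<open>B\<close> in \<open>F0\<close> is the
    preimage under \<open>T\<close> of some \<open>A\<close> in \<open>F0\<close>; the preimage of
    \<open>B\<close> under the inverse map is then \<open>A\<close> itself.\<close>
  have SF: "S \<in> measurable F0 F0"
  proof (rule measurableI)
    have sp: "space F0 = space M" using assms(3) by (simp add: subalgebra_def)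
    show "S x \<in> space F0" if "x \<in> space F0" for x
      using measurable_space[OF Sm] that by (simp add: sp)
    fix B assume "B \<in> sets F0"
    with assms(4) obtain A where A: "A \<in> sets F0" "B = T -` A \<inter> space M" by blast
    have "A \<subseteq> space M" using sets.sets_into_space[OF A(1)] by (simp add: sp)
    then have "S -` B \<inter> space F0 = A"
      using measurable_space[OF Sm] TS by (auto simp: A(2) sp)
    with A(1) show "S -` B \<inter> space F0 \<in> sets F0" by simp
  qed
  interpret fa: filtered_automorphism M T S F0
    by (intro filtered_automorphism.intro ergodic_automorphism.intro automorphism.intro automorphism_axioms.intro
        ergodic_automorphism_axioms.intro filtered_automorphism_axioms.intro)
       (use assms Tm Sm ST TS Tp SF in auto)
  have XT: "X (int n) = (\<lambda>x. X0 ((T ^^ n) x))" for n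
    by (auto simp: X orbit_process_def int_iterate_def)
  have XS: "X (- int n) = (\<lambda>x. X0 ((S ^^ n) x))" for n
    by (cases "n = 0") (auto simp: X orbit_process_def int_iterate_def S_def)
  have X0M: "X0 \<in> borel_measurable M" using assms(5) by (rule fa.F0_meas)
  note al = fa.alpha1_props[OF assms(5) XT]
  note ms = fa.mixing_summable[OF X0M al(1) assms(11) al(3)]
  interpret ep: empirical_process M T S F0 X0 "alpha1 M F0 X"
    by (intro empirical_process.intro fa.filtered_automorphism_axioms empirical_process_axioms.intro assms(5,6) ms al(2))
  obtain N :: "(real \<Rightarrow> real) measure" where N: "prob_space N" "sets N = sets L1_borel"
    "centered_gaussian_L1 N (\<lambda>w. w)"
    and cov: "\<And>f g. f \<in> Linfty \<Longrightarrow> g \<in> Linfty \<Longrightarrow>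
       covariance N (\<lambda>w. \<integral>t. f t * w t \<partial>lborel) (\<lambda>w. \<integral>t. g t * w t \<partial>lborel) = ep.gs.Q f g"
    and wc: "weak_conv_m (\<lambda>n. distr M borel (\<lambda>x. \<integral>t. \<bar>ep.E n x t\<bar> \<partial>lborel)) (distr N borel (\<lambda>w. \<integral>t. \<bar>w t\<bar> \<partial>lborel))"
    using ep.empirical_L1_clt by blast
  have FF: "F = ep.F" unfolding F mu ep.F_def[abs_def] ..
  have term_eq: "(\<integral>\<omega>. (\<integral>s. (\<integral>t. f t * g s * (indicator {..t} (X 0 \<omega>) - F t) * (indicator {..s} (X k \<omega>) - F s) \<partial>lborel) \<partial>lborel) \<partial>M)
      = (if 0 \<le> k then ep.cov_term f g (nat k) else ep.cov_term g f (nat (- k)))"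
    if f: "f \<in> Linfty" and g: "g \<in> Linfty" for f g and k :: int
  proof -
    have X00: "X 0 = X0" using XT[of 0] by simp
    have "(\<integral>\<omega>. (\<integral>s. (\<integral>t. f t * g s * (indicator {..t} (X 0 \<omega>) - F t) * (indicator {..s} (X k \<omega>) - F s) \<partial>lborel) \<partial>lborel) \<partial>M)
      = (\<integral>\<omega>. (\<integral>t. f t * ep.e t \<omega> \<partial>lborel) * (\<integral>s. g s * (indicator {..s} (X k \<omega>) - F s) \<partial>lborel) \<partial>M)"
    proof (intro Bochner_Integration.integral_cong refl)
      fix \<omega>
      have "(\<integral>t. f t * g s * (indicator {..t} (X 0 \<omega>) - F t) * (indicator {..s} (X k \<omega>) - F s) \<partial>lborel)
         = (\<integral>t. f t * ep.e t \<omega> \<partial>lborel) * (g s * (indicator {..s} (X k \<omega>) - F s))" for s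
      proof -
        have "(\<integral>t. f t * g s * (indicator {..t} (X 0 \<omega>) - F t) * (indicator {..s} (X k \<omega>) - F s) \<partial>lborel)
          = (\<integral>t. (f t * ep.e t \<omega>) * (g s * (indicator {..s} (X k \<omega>) - F s)) \<partial>lborel)"
          by (simp add: X00 ep.e_def FF mult_ac)
        then show ?thesis by (simp only: integral_mult_left_zero)
      qed
      then show "(\<integral>s. (\<integral>t. f t * g s * (indicator {..t} (X 0 \<omega>) - F t) * (indicator {..s} (X k \<omega>) - F s) \<partial>lborel) \<partial>lborel)
        = (\<integral>t. f t * ep.e t \<omega> \<partial>lborel) * (\<integral>s. g s * (indicator {..s} (X k \<omega>) - F s) \<partial>lborel)"
        by (simp only: integral_mult_right_zero)
    qed
    also have "\<dots> = (if 0 \<le> k then ep.cov_term f g (nat k) else ep.cov_term g f (nat (- k)))"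
    proof (cases "0 \<le> k")
      case True
      then have "X k = (\<lambda>x. X0 ((T ^^ nat k) x))" using XT[of "nat k"] by simp
      then have "(\<integral>s. g s * (indicator {..s} (X k \<omega>) - F s) \<partial>lborel) = (\<integral>s. g s * ep.e s ((T ^^ nat k) \<omega>) \<partial>lborel)" for \<omega>
        by (simp add: ep.e_def FF)
      then show ?thesis using True ep.cov_term_eq[OF f g, of "nat k"] by simp
    next
      case False
      \<comment> \<open>For negative \<open>k\<close> the pair is shifted forward by
        \<open>n\<close>, which puts the earlier variable at time \<open>0\<close> and exchanges the
        roles of \<open>f\<close> and \<open>g\<close>.\<close>
      define n where "n = nat (- k)"
      have "X k = (\<lambda>x. X0 ((S ^^ n) x))" using XS[of n] False by (simp add: n_def)
      then have e: "(\<integral>s. g s * (indicator {..s} (X k \<omega>) - F s) \<partial>lborel) = (\<integral>s. g s * ep.e s ((S ^^ n) \<omega>) \<partial>lborel)" for \<omega>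
        by (simp add: ep.e_def FF)
      have m: "(\<lambda>\<omega>. \<integral>t. u t * ep.e t \<omega> \<partial>lborel) \<in> borel_measurable M" if "u \<in> Linfty" for u
      proof -
        have [measurable]: "u \<in> borel_measurable borel" using that by (rule Linfty_measurable)
        have [measurable]: "X0 \<in> borel_measurable M" by (rule X0M)
        have "(\<lambda>(\<omega>, t). u t * ep.e t \<omega>) \<in> borel_measurable (M \<Otimes>\<^sub>M lborel)"
          unfolding ep.e_def indicator_def atMost_iff by measurable
        then show ?thesis by (rule lborel.borel_measurable_lebesgue_integral)
      qed
      have "(\<integral>\<omega>. (\<integral>t. f t * ep.e t \<omega> \<partial>lborel) * (\<integral>s. g s * ep.e s ((S ^^ n) \<omega>) \<partial>lborel) \<partial>M)
        = (\<integral>\<omega>. (\<integral>s. g s * ep.e s ((S ^^ n) \<omega>) \<partial>lborel) * (\<integral>t. f t * ep.e t \<omega> \<partial>lborel) \<partial>M)"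
        by (simp add: mult.commute)
      also have "\<dots> = (\<integral>\<omega>. (\<integral>s. g s * ep.e s \<omega> \<partial>lborel) * (\<integral>t. f t * ep.e t ((T ^^ n) \<omega>) \<partial>lborel) \<partial>M)"
        by (rule fa.integral_mult_funpow_T[symmetric, OF m[OF g] m[OF f]])
      also have "\<dots> = ep.cov_term g f n" by (rule ep.cov_term_eq[OF g f])
      finally show ?thesis using False unfolding e by (simp add: n_def)
    qed
    finally show ?thesis .
  qed
  have wd: "(\<lambda>\<omega>. sqrt (real n) * enn2real (wasserstein1 (empirical_measure X n \<omega>) \<mu>)) \<in> borel_measurable M"
    "distr M borel (\<lambda>\<omega>. sqrt (real n) * enn2real (wasserstein1 (empirical_measure X n \<omega>) \<mu>)) = distr M borel (\<lambda>x. \<integral>t. \<bar>ep.E n x t\<bar> \<partial>lborel)" for n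
    unfolding mu by (rule ep.wasserstein_distr[OF XT])+
  have Zm: "(\<lambda>w. \<integral>t. \<bar>w t\<bar> \<partial>lborel) \<in> borel_measurable N"
    using L1_norm_measurable measurable_cong_sets[OF N(2) refl] by blast
  \<comment> \<open>The limit law itself serves as probability space, and \<open>G\<close> is the
    identity on it.\<close>
  show ?thesis
  proof (intro exI[of _ N] exI[of _ "\<lambda>w. w"] conjI ballI)
    show "((\<lambda>k::int. \<integral>\<omega>. (\<integral>s. (\<integral>t. f t * g s * (indicator {..t} (X 0 \<omega>) - F t)
                                        * (indicator {..s} (X k \<omega>) - F s) \<partial>lborel) \<partial>lborel) \<partial>M)
        has_sum covariance N (\<lambda>w. \<integral>t. f t * w t \<partial>lborel) (\<lambda>w. \<integral>t. g t * w t \<partial>lborel)) UNIV"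
      if "f \<in> Linfty" "g \<in> Linfty" for f g
      unfolding term_eq[OF that] cov[OF that] by (rule ep.cov_has_sum[OF that])
    show "converges_in_distribution
      M (\<lambda>n \<omega>. sqrt (real n) * enn2real (wasserstein1 (empirical_measure X n \<omega>) \<mu>))
      N (\<lambda>w. \<integral>t. \<bar>w t\<bar> \<partial>lborel)"
      unfolding converges_in_distribution_def wd(2) using wd(1) Zm wc by blast
  qed (rule N(1) N(3))+
qed

end
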